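(* Let $\mathcal M$ be a smooth connected Riemannian manifold with injectivity radius uniformly bounded from below by some $I>0$. Let $C(w)=\int_{\mathcal Z}Q(z,w)\,dP(z)$ be a three times continuously differentiable cost function on $\mathcal M$, and for $z\in\mathcal Z$, $w\in\mathcal M$ let $H(z,w)\in T_w\mathcal M$ satisfy $\int_{\mathcal Z} H(z,w)\,dP(z)=\nabla C(w)$ for all $w\in\mathcal M$. Let $(z_t)_{t\ge 0}$ be independent random variables with law $P$. Let $R_w$ be a twice continuously differentiable retraction on $\mathcal M$, and consider the algorithm $$w_{t+1}=R_{w_t}\bigl(-\gamma_t H(z_t,w_t)\bigr),\qquad t\ge 0,$$ started from some $w_0\in\mathcal M$, where the positive step sizes $(\gamma_t)_{t\ge0}$ satisfy $\sum_t\gamma_t^2<\infty$ and $\sum_t\gamma_t=+\infty$. Suppose there exists a compact set $K\subset\mathcal M$ such that $w_t\in K$ for all $t\ge 0$, and that there exists $A>0$ such that $\|H(z,w)\|\le A$ for all $w\in K$ and all $z\in\mathcal Z$. Then $C(w_t)$ converges almost surely and $\nabla C(w_t)\to 0$ almost surely.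
   Context: $(\mathcal Z,P)$ is a probability space (a measurable space with a probability measure $P$), $Q:\mathcal Z\times\mathcal M\to\mathbb R$ is the loss function, and $H:(z,w)\mapsto H(z,w)\in T_w\mathcal M$ is a measurable "stochastic gradient". $\nabla C(w)\in T_w\mathcal M$ is the Riemannian gradient of $C$, $\exp_w$ is the Riemannian exponential map at $w$, $\|\cdot\|$ is the Riemannian norm on tangent spaces and $d$ is the geodesic distance. A retraction is a family of maps $R_w:T_w\mathcal M\to\mathcal M$, $w\in\mathcal M$, such that $d(R_w(tv),\exp_w(tv))=O(t^2)$ as $t\to0$ for $v\in T_w\mathcal M$; it is twice continuously differentiable if $(w,v)\mapsto R_w(v)$ is $C^2$ on the tangent bundle. *)

theory Defs
  imports "HOL-Probability.Probability" "HOL-Library.Landau_Symbols"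
begin

section \<open>Functions of class \<open>C\<^sup>n\<close> on open subsets of a Euclidean space\<close>

text \<open>Intended for open \<open>S\<close> in a finite-dimensional space, where continuity of all
  iterated directional derivatives is equivalent to being \<open>C\<^sup>n\<close>.\<close>

primrec Ck_on :: "nat \<Rightarrow> ('a::euclidean_space \<Rightarrow> 'b::real_normed_vector) \<Rightarrow> 'a set \<Rightarrow> bool" where
  "Ck_on 0 f S = continuous_on S f"
| "Ck_on (Suc n) f S = (\<exists>f'. (\<forall>x\<in>S. (f has_derivative f' x) (at x)) \<and>
                             (\<forall>v. Ck_on n (\<lambda>x. f' x v) S))"

definition smooth_on :: "('a::euclidean_space \<Rightarrow> 'b::real_normed_vector) \<Rightarrow> 'a set \<Rightarrow> bool" where
  "smooth_on f S \<longleftrightarrow> (\<forall>n. Ck_on n f S)"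


section \<open>Smooth manifolds\<close>

text \<open>The manifold is the whole type \<open>'m\<close>, a second countable Hausdorff space; charts take
  values in \<open>'e\<close>, whose dimension is the dimension of the manifold. A chart is the pair of its
  domain and its coordinate map; the values of the map off the domain are irrelevant.\<close>

type_synonym ('m, 'e) chart = "'m set \<times> ('m \<Rightarrow> 'e)"

definition chart_inv :: "('m, 'e) chart \<Rightarrow> 'e \<Rightarrow> 'm" where
  "chart_inv c = inv_into (fst c) (snd c)"

definition is_chart :: "('m::topological_space, 'e::euclidean_space) chart \<Rightarrow> bool" where
  "is_chart c \<longleftrightarrow> open (fst c) \<and> open (snd c ` fst c) \<and>
     homeomorphism (fst c) (snd c ` fst c) (snd c) (chart_inv c)"

text \<open>The differential at \<open>p\<close> of the transition map from the chart \<open>c\<close> to the chart \<open>d\<close>.\<close>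

definition transition_deriv ::
  "('m, 'e::euclidean_space) chart \<Rightarrow> ('m, 'e) chart \<Rightarrow> 'm \<Rightarrow> 'e \<Rightarrow> 'e" where
  "transition_deriv c d p = frechet_derivative (snd d \<circ> chart_inv c) (at (snd c p))"

locale smooth_manifold =
  fixes atlas :: "('m::{t2_space, second_countable_topology}, 'e::euclidean_space) chart set"
  assumes atlas_chart: "\<And>c. c \<in> atlas \<Longrightarrow> is_chart c"
    and atlas_cover: "(\<Union>c\<in>atlas. fst c) = UNIV"
    and atlas_compatible: "\<And>c d. c \<in> atlas \<Longrightarrow> d \<in> atlas \<Longrightarrow>
          smooth_on (snd d \<circ> chart_inv c) (snd c ` (fst c \<inter> fst d))"
begin

text \<open>A tangent vector at \<open>p\<close> is encoded by its components in one chart around \<open>p\<close>, selected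
  once and for all. Thus every tangent space is the vector space \<open>'e\<close>, but the choice of the
  chart may vary wildly with \<open>p\<close>, so regularity of objects on the tangent bundle always has to
  be expressed through \<open>coords\<close> and \<open>of_coords\<close>, which pass between a vector
  tangent at \<open>p\<close> and its components in an arbitrary chart around \<open>p\<close>.\<close>

definition chart_at :: "'m \<Rightarrow> ('m, 'e) chart" where
  "chart_at p = (SOME c. c \<in> atlas \<and> p \<in> fst c)"

definition coords :: "('m, 'e) chart \<Rightarrow> 'm \<Rightarrow> 'e \<Rightarrow> 'e" where
  "coords c p = transition_deriv (chart_at p) c p"

definition of_coords :: "('m, 'e) chart \<Rightarrow> 'm \<Rightarrow> 'e \<Rightarrow> 'e" where
  "of_coords c p = transition_deriv c (chart_at p) p"

text \<open>Maps out of an open set \<open>W\<close> of the manifold, and maps from an open set \<open>S\<close> of a Euclidean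
  space into the manifold.\<close>

definition Ck_fun_on :: "nat \<Rightarrow> ('m \<Rightarrow> 'b::real_normed_vector) \<Rightarrow> 'm set \<Rightarrow> bool" where
  "Ck_fun_on n f W \<longleftrightarrow> (\<forall>c\<in>atlas. Ck_on n (f \<circ> chart_inv c) (snd c ` (fst c \<inter> W)))"

definition Ck_map_on :: "nat \<Rightarrow> ('a::euclidean_space \<Rightarrow> 'm) \<Rightarrow> 'a set \<Rightarrow> bool" where
  "Ck_map_on n F S \<longleftrightarrow> continuous_on S F \<and>
     (\<forall>c\<in>atlas. Ck_on n (snd c \<circ> F) (S \<inter> F -` fst c))"

definition diffeo_onto_image :: "('e \<Rightarrow> 'm) \<Rightarrow> 'e set \<Rightarrow> bool" where
  "diffeo_onto_image F S \<longleftrightarrow> inj_on F S \<and> open (F ` S) \<and>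
     (\<forall>n. Ck_map_on n F S) \<and> (\<forall>n. Ck_fun_on n (inv_into S F) (F ` S))"

definition Ck_on_tangent_bundle :: "nat \<Rightarrow> ('m \<Rightarrow> 'e \<Rightarrow> 'm) \<Rightarrow> bool" where
  "Ck_on_tangent_bundle n R \<longleftrightarrow>
     (\<forall>c\<in>atlas. Ck_map_on n (\<lambda>(x, \<xi>). R (chart_inv c x) (of_coords c (chart_inv c x) \<xi>))
                            ((snd c ` fst c) \<times> UNIV))"

text \<open>Measurability of \<open>(z, w) \<mapsto> H z w\<close> as a map from \<open>P \<times> 'm\<close> to the tangent bundle.\<close>

definition measurable_tangent_field :: "'z measure \<Rightarrow> ('z \<Rightarrow> 'm \<Rightarrow> 'e) \<Rightarrow> bool" where
  "measurable_tangent_field P H \<longleftrightarrow>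
     (\<forall>c\<in>atlas. (\<lambda>(z, w). coords c w (H z w))
        \<in> borel_measurable (restrict_space (P \<Otimes>\<^sub>M borel) (space P \<times> fst c)))"

definition differential :: "('m \<Rightarrow> real) \<Rightarrow> 'm \<Rightarrow> 'e \<Rightarrow> real" where
  "differential f p =
     frechet_derivative (f \<circ> chart_inv (chart_at p)) (at (snd (chart_at p) p))"

definition velocity :: "(real \<Rightarrow> 'm) \<Rightarrow> real \<Rightarrow> 'e" where
  "velocity \<gamma> t = vector_derivative (snd (chart_at (\<gamma> t)) \<circ> \<gamma>) (at t)"

definition C1_curve :: "(real \<Rightarrow> 'm) \<Rightarrow> real \<Rightarrow> real \<Rightarrow> bool" where
  "C1_curve \<gamma> a b \<longleftrightarrow> continuous_on {a..b} \<gamma> \<and>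
     (\<forall>c\<in>atlas. \<exists>D. continuous_on ({a..b} \<inter> \<gamma> -` fst c) D \<and>
        (\<forall>t\<in>{a..b} \<inter> \<gamma> -` fst c.
           ((snd c \<circ> \<gamma>) has_vector_derivative D t) (at t within {a..b})))"

text \<open>\<open>S\<close> is the set of break points; between consecutive ones the curve is \<open>C\<^sup>1\<close> up to and
  including the end points.\<close>

definition piecewise_C1_curve :: "(real \<Rightarrow> 'm) \<Rightarrow> real \<Rightarrow> real \<Rightarrow> bool" where
  "piecewise_C1_curve \<gamma> a b \<longleftrightarrow> continuous_on {a..b} \<gamma> \<and>
     (\<exists>S. finite S \<and>
        (\<forall>c d. a \<le> c \<and> c < d \<and> d \<le> b \<and> {c<..<d} \<inter> S = {} \<longrightarrow> C1_curve \<gamma> c d))"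

end


section \<open>Riemannian manifolds\<close>

locale riemannian_manifold = smooth_manifold atlas
  for atlas :: "('m::{t2_space, second_countable_topology}, 'e::euclidean_space) chart set" +
  fixes g :: "'m \<Rightarrow> 'e \<Rightarrow> 'e \<Rightarrow> real"
  assumes metric_bilinear: "\<And>p. bilinear (g p)"
    and metric_sym: "\<And>p u v. g p u v = g p v u"
    and metric_pos: "\<And>p v. v \<noteq> 0 \<Longrightarrow> 0 < g p v v"
    and metric_smooth: "\<And>c u v. c \<in> atlas \<Longrightarrow>
          smooth_on (\<lambda>x. g (chart_inv c x) (of_coords c (chart_inv c x) u)
                                           (of_coords c (chart_inv c x) v)) (snd c ` fst c)"
begin

definition tangent_norm :: "'m \<Rightarrow> 'e \<Rightarrow> real" where
  "tangent_norm p v = sqrt (g p v v)"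

definition gradient :: "('m \<Rightarrow> real) \<Rightarrow> 'm \<Rightarrow> 'e" where
  "gradient f p = (THE u. \<forall>v. g p u v = differential f p v)"

definition curve_length :: "(real \<Rightarrow> 'm) \<Rightarrow> real \<Rightarrow> real \<Rightarrow> real" where
  "curve_length \<gamma> a b = integral {a..b} (\<lambda>t. tangent_norm (\<gamma> t) (velocity \<gamma> t))"

definition geodesic_dist :: "'m \<Rightarrow> 'm \<Rightarrow> real" where
  "geodesic_dist p q =
     Inf {curve_length \<gamma> 0 1 | \<gamma>. piecewise_C1_curve \<gamma> 0 1 \<and> \<gamma> 0 = p \<and> \<gamma> 1 = q}"

definition local_metric :: "('m, 'e) chart \<Rightarrow> 'e \<Rightarrow> 'e \<Rightarrow> 'e \<Rightarrow> real" where
  "local_metric c x u v =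
     g (chart_inv c x) (of_coords c (chart_inv c x) u) (of_coords c (chart_inv c x) v)"

text \<open>The Christoffel symbols of the Levi-Civita connection in the chart \<open>c\<close>, first as a trilinear
  form (first kind) and then, with the index raised, as an \<open>'e\<close>-valued bilinear map
  \<open>(u, v) \<mapsto> (\<Sum>i j. \<Gamma>\<^sup>k\<^sub>i\<^sub>j u\<^sup>i v\<^sup>j)\<^sub>k\<close> (second kind).\<close>

definition christoffel1 :: "('m, 'e) chart \<Rightarrow> 'e \<Rightarrow> 'e \<Rightarrow> 'e \<Rightarrow> 'e \<Rightarrow> real" where
  "christoffel1 c x u v w =
     (frechet_derivative (\<lambda>y. local_metric c y v w) (at x) u +
      frechet_derivative (\<lambda>y. local_metric c y u w) (at x) v -
      frechet_derivative (\<lambda>y. local_metric c y u v) (at x) w) / 2"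

definition christoffel :: "('m, 'e) chart \<Rightarrow> 'e \<Rightarrow> 'e \<Rightarrow> 'e \<Rightarrow> 'e" where
  "christoffel c x u v = (THE k. \<forall>w. local_metric c x k w = christoffel1 c x u v w)"

definition geodesic_on :: "(real \<Rightarrow> 'm) \<Rightarrow> real set \<Rightarrow> bool" where
  "geodesic_on \<gamma> J \<longleftrightarrow> open J \<and> is_interval J \<and> continuous_on J \<gamma> \<and>
     (\<forall>c\<in>atlas. \<exists>x' x''. \<forall>t\<in>J \<inter> \<gamma> -` fst c.
        ((snd c \<circ> \<gamma>) has_vector_derivative x' t) (at t) \<and>
        (x' has_vector_derivative x'' t) (at t) \<and>
        x'' t + christoffel c (snd c (\<gamma> t)) (x' t) (x' t) = 0)"

text \<open>\<open>exp_reaches p v q\<close>: the geodesic starting at \<open>p\<close> with velocity \<open>v\<close> exists up to time 1, and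
  it is then at \<open>q\<close>. The exponential map at \<open>p\<close> is meaningful on \<open>exp_domain p\<close>.\<close>

definition exp_reaches :: "'m \<Rightarrow> 'e \<Rightarrow> 'm \<Rightarrow> bool" where
  "exp_reaches p v q \<longleftrightarrow>
     (\<exists>\<gamma> J. geodesic_on \<gamma> J \<and> {0..1} \<subseteq> J \<and> \<gamma> 0 = p \<and> velocity \<gamma> 0 = v \<and> \<gamma> 1 = q)"

definition exp_domain :: "'m \<Rightarrow> 'e set" where
  "exp_domain p = {v. \<exists>q. exp_reaches p v q}"

definition exp_map :: "'m \<Rightarrow> 'e \<Rightarrow> 'm" where
  "exp_map p v = (THE q. exp_reaches p v q)"

definition tangent_ball :: "'m \<Rightarrow> real \<Rightarrow> 'e set" where
  "tangent_ball p r = {v. tangent_norm p v < r}"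

definition injectivity_radius :: "'m \<Rightarrow> ereal" where
  "injectivity_radius p = Sup {ereal r | r. 0 < r \<and> tangent_ball p r \<subseteq> exp_domain p \<and>
                                 diffeo_onto_image (exp_map p) (tangent_ball p r)}"

definition retraction :: "('m \<Rightarrow> 'e \<Rightarrow> 'm) \<Rightarrow> bool" where
  "retraction R \<longleftrightarrow>
     (\<forall>w v. (\<lambda>t. geodesic_dist (R w (t *\<^sub>R v)) (exp_map w (t *\<^sub>R v))) \<in> O[at 0](\<lambda>t::real. t\<^sup>2))"

end

end

theory Submission
  imports Defs
begin

text \<open>Since the geodesic distance dominates the coordinate distance locally and geodesics are determined
  by their initial velocity, a retraction satisfies \<open>R\<^sub>w(0) = w\<close> and \<open>dR\<^sub>w(0) = id\<close>, so Taylor's formula in a chart gives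
  \<open>C(w\<^bsub>t+1\<^esub>) = C(w\<^sub>t) - \<gamma>\<^sub>t \<langle>\<nabla>C(w\<^sub>t), H(z\<^sub>t, w\<^sub>t)\<rangle> + O(\<gamma>\<^sub>t\<^sup>2)\<close> uniformly on \<open>K\<close>. The noise
  \<open>\<gamma>\<^sub>t \<langle>\<nabla>C, H - \<nabla>C\<rangle>\<close> consists of bounded martingale differences with summable variances, hence its sum
  converges almost surely. As \<open>C\<close> is bounded on \<open>K\<close>, it follows that \<open>\<Sum> \<gamma>\<^sub>t \<parallel>\<nabla>C(w\<^sub>t)\<parallel>\<^sup>2 < \<infinity>\<close> and that
  \<open>C(w\<^sub>t)\<close> converges. The rest is deterministic: steps have length \<open>O(\<gamma>\<^sub>t)\<close>, so returning infinitely
  often to a neighbourhood of a noncritical point would make that sum infinite.\<close>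

section \<open>Martingale differences\<close>

text \<open>The bound in \<open>retraction\<close> holds ray by ray, with a constant that may depend
  on the ray, so it cannot by itself give an error uniform on \<open>K\<close>. It identifies the
  value and the fibre derivative of \<open>R\<close> at the zero vector; uniformity comes from
  \<open>C^2\<close> regularity, through Taylor's formula on a compact ball in bundle coordinates.
  Tangent vectors are encoded in charts selected by \<open>SOME\<close>, so encoded quantities need
  not be continuous in the base point. Hence every estimate lives in one fixed chart near one point
  and is spread over \<open>K\<close> by a finite subcover. \<open>geodesic_dist\<close>,
  \<open>exp_map\<close>, \<open>gradient\<close> and \<open>christoffel\<close> are infima or
  definite descriptions. They carry information only once joining curves exist, geodesics are unique
  and functionals are represented by the metric; the injectivity radius supplies geodesics for small
  initial velocities. The noise is cut off outside \<open>K\<close>: the bound on \<open>H\<close>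
  is known only on \<open>K\<close> and the trajectory stays there only almost surely, whereas the
  probabilistic part asks for bounds everywhere.\<close>

text \<open>\<open>orth\<close> tests the increments against bounded \<open>F n\<close>-measurable
  functions. This says that the conditional expectation of \<open>X n\<close> given
  \<open>F n\<close> vanishes, in exactly the form in which orthogonality is applied.\<close>

locale martingale_differences = prob_space +
  fixes F :: "nat \<Rightarrow> 'a measure" and X :: "nat \<Rightarrow> 'a \<Rightarrow> real" and c :: "nat \<Rightarrow> real"
  assumes subalg: "\<And>n. subalgebra M (F n)"
    and F_mono: "\<And>n. subalgebra (F (Suc n)) (F n)"
    and adapted: "\<And>n. X n \<in> borel_measurable (F (Suc n))"
    and bound: "\<And>n \<omega>. \<omega> \<in> space M \<Longrightarrow> \<bar>X n \<omega>\<bar> \<le> c n"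
    and orth: "\<And>n Z B. Z \<in> borel_measurable (F n) \<Longrightarrow> (\<And>\<omega>. \<omega> \<in> space M \<Longrightarrow> \<bar>Z \<omega>\<bar> \<le> B) \<Longrightarrow>
                 expectation (\<lambda>\<omega>. Z \<omega> * X n \<omega>) = 0"
begin

lemma subalg_le: "m \<le> n \<Longrightarrow> subalgebra (F n) (F m)"
proof (induction n rule: dec_induct)
  case base
  then show ?case by (simp add: subalgebra_def)
next
  case (step n)
  then show ?case using F_mono[of n] by (auto simp: subalgebra_def)
qed

lemma adapted_le: "k < n \<Longrightarrow> X k \<in> borel_measurable (F n)"
  using measurable_from_subalg[OF subalg_le adapted, of k n] by simp

lemma measurable_M: "f \<in> borel_measurable (F n) \<Longrightarrow> f \<in> borel_measurable M"
  using measurable_from_subalg[OF subalg] by blast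

lemma X_measurable [measurable]: "X k \<in> borel_measurable M"
  using measurable_M adapted by blast

lemma sum_adapted: "n \<le> m \<Longrightarrow> (\<lambda>\<omega>. \<Sum>k<n. X k \<omega>) \<in> borel_measurable (F m)"
  by (intro borel_measurable_sum adapted_le) auto

lemma sum_bound: "\<omega> \<in> space M \<Longrightarrow> \<bar>\<Sum>k<n. X k \<omega>\<bar> \<le> (\<Sum>k<n. c k)"
  by (rule order_trans[OF sum_abs]) (intro sum_mono bound, auto)

text \<open>Expanding the square, the cross term vanishes because the partial sum is a bounded
  \<open>F n\<close>-measurable function; second moments therefore add.\<close>

lemma second_moment: "expectation (\<lambda>\<omega>. (\<Sum>k<n. X k \<omega>)\<^sup>2) \<le> (\<Sum>k<n. (c k)\<^sup>2)"
proof (induction n)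
  case 0
  then show ?case by simp
next
  case (Suc n)
  let ?S = "\<lambda>\<omega>. \<Sum>k<n. X k \<omega>"
  have S_bound: "\<bar>?S \<omega>\<bar> \<le> (\<Sum>k<n. c k)" if "\<omega> \<in> space M" for \<omega>
    by (rule sum_bound[OF that])
  have int_S: "integrable M (\<lambda>\<omega>. (?S \<omega>)\<^sup>2)"
    using S_bound by (intro integrable_const_bound[where B = "(\<Sum>k<n. c k)\<^sup>2"] AE_I2)
      (auto simp: abs_le_square_iff[symmetric] intro: order_trans[OF _ abs_ge_self])
  have int_SX: "integrable M (\<lambda>\<omega>. ?S \<omega> * X n \<omega>)"
    using S_bound bound by (intro integrable_const_bound[where B = "(\<Sum>k<n. c k) * c n"] AE_I2)
      (auto simp: abs_mult intro!: mult_mono intro: order_trans[OF abs_ge_zero])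
  have X2: "(X n \<omega>)\<^sup>2 \<le> (c n)\<^sup>2" if "\<omega> \<in> space M" for \<omega>
    using bound[OF that, of n] by (auto simp: abs_le_square_iff[symmetric] intro: order_trans)
  have int_X: "integrable M (\<lambda>\<omega>. (X n \<omega>)\<^sup>2)"
    using X2 by (intro integrable_const_bound[where B = "(c n)\<^sup>2"] AE_I2) auto
  have "expectation (\<lambda>\<omega>. ?S \<omega> * X n \<omega>) = 0"
    by (rule orth[OF sum_adapted S_bound]) auto
  moreover have "expectation (\<lambda>\<omega>. (X n \<omega>)\<^sup>2) \<le> (c n)\<^sup>2"
    using integral_mono[OF int_X integrable_const X2] by (simp add: prob_space)
  moreover have "(\<lambda>\<omega>. (\<Sum>k<Suc n. X k \<omega>)\<^sup>2)
      = (\<lambda>\<omega>. (?S \<omega>)\<^sup>2 + 2 * (?S \<omega> * X n \<omega>) + (X n \<omega>)\<^sup>2)"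
    by (simp add: power2_sum algebra_simps)
  ultimately show ?case
    using Suc int_S int_SX int_X by simp
qed

text \<open>The multipliers \<open>b\<close> switch the increments off once a partial sum has left the \<open>\<epsilon>\<close>-band, so that
  the maximum becomes a terminal value, to which Markov's inequality applies.\<close>

lemma maximal_inequality:
  assumes "\<epsilon> > 0" "m \<le> n"
  shows "prob {\<omega> \<in> space M. \<exists>k\<in>{m..n}. \<epsilon> \<le> \<bar>(\<Sum>i<k. X i \<omega>) - (\<Sum>i<m. X i \<omega>)\<bar>}
           \<le> (\<Sum>k=m..<n. (c k)\<^sup>2) / \<epsilon>\<^sup>2" (is "prob ?E \<le> _")
proof -
  define D where "D k \<omega> = (\<Sum>i<k. X i \<omega>) - (\<Sum>i<m. X i \<omega>)" for k \<omega>
  define b where "b k \<omega> = (if m \<le> k \<and> (\<forall>j\<in>{m..k}. \<bar>D j \<omega>\<bar> < \<epsilon>) then 1 else 0 :: real)" for k \<omega>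
  have D_adapted: "D j \<in> borel_measurable (F k)" if "m \<le> j" "j \<le> k" for j k
    unfolding D_def using that by (intro borel_measurable_diff sum_adapted) auto
  have b_adapted: "b k \<in> borel_measurable (F k)" for k
  proof (cases "m \<le> k")
    case True
    have [measurable]: "D j \<in> borel_measurable (F k)" if "j \<in> {m..k}" for j
      using that D_adapted by auto
    have "Measurable.pred (F k) (\<lambda>\<omega>. \<forall>j\<in>{m..k}. \<bar>D j \<omega>\<bar> < \<epsilon>)"
      by (intro pred_intros_finite) measurable
    then show ?thesis unfolding b_def using True by simp
  next
    case False
    then show ?thesis by (simp add: b_def[abs_def])
  qed
  have b_bound: "\<bar>b k \<omega>\<bar> \<le> 1" for k \<omega> by (simp add: b_def)
  \<comment> \<open>The multiplier \<open>b k\<close> is known at time \<open>k\<close>, before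
    \<open>X k\<close> is revealed, so the switched increments are again martingale differences.
    Indices below \<open>m\<close> get the bound 0.\<close>
  interpret Y: martingale_differences M F "\<lambda>k \<omega>. b k \<omega> * X k \<omega>" "\<lambda>k. if m \<le> k then c k else 0"
  proof
    show "(\<lambda>\<omega>. b n \<omega> * X n \<omega>) \<in> borel_measurable (F (Suc n))" for n
      using measurable_from_subalg[OF F_mono b_adapted] adapted by (intro borel_measurable_times)
    show "\<bar>b n \<omega> * X n \<omega>\<bar> \<le> (if m \<le> n then c n else 0)" if "\<omega> \<in> space M" for n \<omega>
      using bound[OF that, of n] by (auto simp: b_def intro: order_trans[OF abs_ge_zero])
    show "expectation (\<lambda>\<omega>. Z \<omega> * (b n \<omega> * X n \<omega>)) = 0"
      if Z: "Z \<in> borel_measurable (F n)" "\<And>\<omega>. \<omega> \<in> space M \<Longrightarrow> \<bar>Z \<omega>\<bar> \<le> B" for n Z B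
    proof -
      have "(\<lambda>\<omega>. Z \<omega> * b n \<omega>) \<in> borel_measurable (F n)"
        by (intro borel_measurable_times Z b_adapted)
      moreover have "\<bar>Z \<omega> * b n \<omega>\<bar> \<le> B" if "\<omega> \<in> space M" for \<omega>
        using Z(2)[OF that] by (auto simp: b_def)
      ultimately have "expectation (\<lambda>\<omega>. Z \<omega> * b n \<omega> * X n \<omega>) = 0" by (rule orth)
      then show ?thesis by (simp add: mult.assoc)
    qed
  qed (rule subalg F_mono)+
  let ?T = "\<lambda>\<omega>. \<Sum>k<n. b k \<omega> * X k \<omega>"
  have E_T: "\<epsilon>\<^sup>2 \<le> (?T \<omega>)\<^sup>2" if \<omega>: "\<omega> \<in> ?E" for \<omega>
  proof -
    obtain k where k: "k \<in> {m..n}" "\<epsilon> \<le> \<bar>D k \<omega>\<bar>" using \<omega> by (auto simp: D_def)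
    \<comment> \<open>\<open>k0\<close> is the first exit after time \<open>m\<close>. Exactly the
      increments from \<open>m\<close> to \<open>k0 - 1\<close> survive, so the terminal value
      \<open>?T \<omega>\<close> equals \<open>D k0 \<omega>\<close>.\<close>
    define k0 where "k0 = (LEAST k. m \<le> k \<and> \<epsilon> \<le> \<bar>D k \<omega>\<bar>)"
    have k0: "m \<le> k0" "\<epsilon> \<le> \<bar>D k0 \<omega>\<bar>" and "k0 \<le> k"
      using LeastI[of "\<lambda>k. m \<le> k \<and> \<epsilon> \<le> \<bar>D k \<omega>\<bar>" k] Least_le[of "\<lambda>k. m \<le> k \<and> \<epsilon> \<le> \<bar>D k \<omega>\<bar>" k] k
      by (auto simp: k0_def)
    have least: "\<bar>D j \<omega>\<bar> < \<epsilon>" if "m \<le> j" "j < k0" for j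
      using not_less_Least[of j "\<lambda>k. m \<le> k \<and> \<epsilon> \<le> \<bar>D k \<omega>\<bar>"] that by (auto simp: k0_def)
    have b_eq: "b j \<omega> = (if m \<le> j \<and> j < k0 then 1 else 0)" for j
    proof (cases "m \<le> j \<and> j < k0")
      case True
      then show ?thesis using least by (auto simp: b_def)
    next
      case False
      then show ?thesis using k0 by (force simp: b_def)
    qed
    have "?T \<omega> = (\<Sum>j<n. if m \<le> j \<and> j < k0 then X j \<omega> else 0)"
      by (intro sum.cong) (auto simp: b_eq)
    also have "\<dots> = (\<Sum>j\<in>{..<n} \<inter> {j. m \<le> j \<and> j < k0}. X j \<omega>)"
      by (simp add: sum.inter_restrict)
    also have "{..<n} \<inter> {j. m \<le> j \<and> j < k0} = {..<k0} - {..<m}"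
      using \<open>k0 \<le> k\<close> k by auto
    also have "(\<Sum>j\<in>{..<k0} - {..<m}. X j \<omega>) = D k0 \<omega>"
      unfolding D_def using k0 by (intro sum_diff) auto
    finally show ?thesis using k0 \<open>\<epsilon> > 0\<close> by (simp add: abs_le_square_iff[symmetric])
  qed
  have [measurable]: "?T \<in> borel_measurable M" by (intro borel_measurable_sum) (rule Y.X_measurable)
  have T_bound: "(?T \<omega>)\<^sup>2 \<le> (\<Sum>k<n. if m \<le> k then c k else 0)\<^sup>2" if "\<omega> \<in> space M" for \<omega>
    using Y.sum_bound[OF that, of n] by (auto simp: abs_le_square_iff[symmetric] intro: order_trans)
  have int: "integrable M (\<lambda>\<omega>. (?T \<omega>)\<^sup>2)"
    using T_bound by (intro integrable_const_bound[where B = "(\<Sum>k<n. if m \<le> k then c k else 0)\<^sup>2"] AE_I2) auto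
  have "prob ?E \<le> prob {\<omega> \<in> space M. \<epsilon>\<^sup>2 \<le> (?T \<omega>)\<^sup>2}"
    using E_T by (intro finite_measure_mono) auto
  also have "\<dots> \<le> expectation (\<lambda>\<omega>. (?T \<omega>)\<^sup>2) / \<epsilon>\<^sup>2"
    using assms by (intro integral_Markov_inequality_measure[OF int]) auto
  also have "\<dots> \<le> (\<Sum>k<n. (if m \<le> k then c k else 0)\<^sup>2) / \<epsilon>\<^sup>2"
    by (intro divide_right_mono Y.second_moment) auto
  also have "(\<Sum>k<n. (if m \<le> k then c k else 0)\<^sup>2) = (\<Sum>k=m..<n. (c k)\<^sup>2)"
    by (rule sum.mono_neutral_cong_right) auto
  finally show ?thesis .
qed

text \<open>The maximal inequality is bounded uniformly in the right end \<open>n\<close>, so it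
  passes to the union over \<open>n\<close>. An oscillation of size \<open>\<epsilon>\<close> after
  every time \<open>m\<close> then has probability below every tail of the convergent series of
  \<open>(c k)\<^sup>2\<close>, up to the factor \<open>1 / \<epsilon>\<^sup>2\<close>.\<close>

lemma AE_oscillation:
  assumes c: "summable (\<lambda>k. (c k)\<^sup>2)" and "\<epsilon> > 0"
  shows "AE \<omega> in M. \<exists>m. \<forall>k\<ge>m. \<bar>(\<Sum>i<k. X i \<omega>) - (\<Sum>i<m. X i \<omega>)\<bar> < \<epsilon>"
proof -
  define E where "E m n = {\<omega> \<in> space M. \<exists>k\<in>{m..n}. \<epsilon> \<le> \<bar>(\<Sum>i<k. X i \<omega>) - (\<Sum>i<m. X i \<omega>)\<bar>}" for m n
  have [measurable]: "E m n \<in> sets M" for m n unfolding E_def by measurable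
  have "incseq (E m)" for m by (force simp: E_def incseq_def)
  then have lim: "(\<lambda>n. prob (E m n)) \<longlonglongrightarrow> prob (\<Union>n. E m n)" for m
    by (intro finite_Lim_measure_incseq) auto
  have tail: "prob (\<Union>n. E m n) \<le> (\<Sum>k. (c (k + m))\<^sup>2) / \<epsilon>\<^sup>2" for m
  proof (rule LIMSEQ_le_const2[OF lim], intro exI[of _ m] allI impI)
    fix n assume "m \<le> n"
    have "prob (E m n) \<le> (\<Sum>k=m..<n. (c k)\<^sup>2) / \<epsilon>\<^sup>2"
      unfolding E_def by (rule maximal_inequality) fact+
    also have "(\<Sum>k=m..<n. (c k)\<^sup>2) = (\<Sum>k<n - m. (c (k + m))\<^sup>2)"
      using sum.shift_bounds_nat_ivl[of "\<lambda>k. (c k)\<^sup>2" 0 m "n - m"] \<open>m \<le> n\<close>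
      by (simp add: atLeast0LessThan)
    also have "\<dots> \<le> (\<Sum>k. (c (k + m))\<^sup>2)"
      using c by (intro sum_le_suminf) (auto simp: summable_iff_shift[of "\<lambda>k. (c k)\<^sup>2"])
    finally show "prob (E m n) \<le> (\<Sum>k. (c (k + m))\<^sup>2) / \<epsilon>\<^sup>2"
      by (simp add: divide_right_mono)
  qed
  have "(\<lambda>m. (\<Sum>k. (c (k + m))\<^sup>2) / \<epsilon>\<^sup>2) \<longlonglongrightarrow> 0 / \<epsilon>\<^sup>2"
    using suminf_exist_split2[OF c] \<open>\<epsilon> > 0\<close> by (intro tendsto_divide) auto
  moreover have "prob (\<Inter>m. \<Union>n. E m n) \<le> (\<Sum>k. (c (k + m))\<^sup>2) / \<epsilon>\<^sup>2" for m
    by (rule order_trans[OF finite_measure_mono tail]) auto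
  ultimately have "prob (\<Inter>m. \<Union>n. E m n) \<le> 0"
    using LIMSEQ_le_const by fastforce
  then have "prob (\<Inter>m. \<Union>n. E m n) = 0" using measure_nonneg by (simp add: order_antisym)
  then have "(\<Inter>m. \<Union>n. E m n) \<in> null_sets M"
    by (auto simp: null_sets_def emeasure_eq_measure)
  then show ?thesis
    by (rule AE_I') (force simp: E_def not_less)
qed

text \<open>Countably many levels \<open>1 / real (Suc j)\<close> suffice, so their exceptional null
  sets can be united; small oscillation at all levels is the Cauchy property.\<close>

theorem AE_convergent:
  assumes c: "summable (\<lambda>k. (c k)\<^sup>2)"
  shows "AE \<omega> in M. convergent (\<lambda>n. \<Sum>k<n. X k \<omega>)"
proof -
  have "AE \<omega> in M. \<forall>j. \<exists>m. \<forall>k\<ge>m. \<bar>(\<Sum>i<k. X i \<omega>) - (\<Sum>i<m. X i \<omega>)\<bar> < 1 / real (Suc j)"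
    unfolding AE_all_countable by (intro allI AE_oscillation c) auto
  then show ?thesis
  proof eventually_elim
    case (elim \<omega>)
    have "Cauchy (\<lambda>n. \<Sum>k<n. X k \<omega>)"
    proof (rule CauchyI')
      fix e :: real assume "e > 0"
      then obtain j where j: "1 / real (Suc j) < e / 2"
        using reals_Archimedean[of "e / 2"] by (auto simp: inverse_eq_divide)
      obtain m where m: "\<And>k. k \<ge> m \<Longrightarrow> \<bar>(\<Sum>i<k. X i \<omega>) - (\<Sum>i<m. X i \<omega>)\<bar> < e / 2"
        using elim[rule_format, of j] j by (meson less_trans)
      show "\<exists>N. \<forall>k\<ge>N. \<forall>n>k. dist (\<Sum>i<k. X i \<omega>) (\<Sum>i<n. X i \<omega>) < e"
      proof (intro exI[of _ m] allI impI)
        fix k n assume "m \<le> k" "k < n"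
        then show "dist (\<Sum>i<k. X i \<omega>) (\<Sum>i<n. X i \<omega>) < e"
          using m[of k] m[of n] by (simp add: dist_real_def abs_if split: if_splits)
      qed
    qed
    then show ?case by (rule Cauchy_convergent)
  qed
qed

end

section \<open>Noise along a Markov chain driven by independent samples\<close>

text \<open>\<open>w n\<close> is a function of the samples before time \<open>n\<close>, hence
  independent of \<open>z n\<close>; integrating out the fresh sample at a frozen state gives zero
  by \<open>y_mean\<close>.\<close>

lemma (in prob_space) AE_convergent_markov_chain:
  fixes z :: "nat \<Rightarrow> 'a \<Rightarrow> 'z" and w :: "nat \<Rightarrow> 'a \<Rightarrow> 'm" and y :: "'z \<times> 'm \<Rightarrow> real"
  assumes P: "prob_space P"
    and indep: "indep_vars (\<lambda>_. P) z UNIV"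
    and law: "\<And>t. distr M P (z t) = P"
    and w0: "w0 \<in> space N" "\<And>\<omega>. \<omega> \<in> space M \<Longrightarrow> w 0 \<omega> = w0"
    and step: "\<And>t \<omega>. \<omega> \<in> space M \<Longrightarrow> w (Suc t) \<omega> = \<Phi> t (z t \<omega>, w t \<omega>)"
    and \<Phi>: "\<And>t. \<Phi> t \<in> P \<Otimes>\<^sub>M N \<rightarrow>\<^sub>M N"
    and y: "y \<in> borel_measurable (P \<Otimes>\<^sub>M N)"
    and y_bound: "\<And>s q. s \<in> space P \<Longrightarrow> q \<in> space N \<Longrightarrow> \<bar>y (s, q)\<bar> \<le> B"
    and y_mean: "\<And>q. q \<in> space N \<Longrightarrow> (\<integral>s. y (s, q) \<partial>P) = 0"
    and \<gamma>: "summable (\<lambda>t. (\<gamma> t)\<^sup>2)"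
  shows "AE \<omega> in M. convergent (\<lambda>n. \<Sum>k<n. \<gamma> k * y (z k \<omega>, w k \<omega>))"
proof -
  interpret P: prob_space P by fact
  have z_meas [measurable]: "z t \<in> M \<rightarrow>\<^sub>M P" for t
    using indep by (auto simp: indep_vars_def)
  note [measurable] = \<Phi> y
  \<comment> \<open>The filtration is pulled back along the tuple of past samples: every event of
    \<open>F n\<close> is then a preimage under \<open>\<rho> n\<close>, and independence of blocks
    of variables applies directly.\<close>
  define \<rho> where "\<rho> n \<omega> = (\<lambda>i\<in>{..<n}. z i \<omega>)" for n \<omega>
  define F where "F n = vimage_algebra (space M) (\<rho> n) (Pi\<^sub>M {..<n} (\<lambda>_. P))" for n
  have \<rho>_meas [measurable]: "\<rho> n \<in> M \<rightarrow>\<^sub>M Pi\<^sub>M {..<n} (\<lambda>_. P)" for n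
    unfolding \<rho>_def by measurable
  have space_F [simp]: "space (F n) = space M" for n by (simp add: F_def)
  have subalg: "subalgebra M (F n)" for n
    unfolding subalgebra_def using \<rho>_meas[of n] measurable_space[OF \<rho>_meas[of n]]
    by (auto simp: F_def sets_vimage_algebra2 dest: measurable_sets)
  have z_F: "z i \<in> F n \<rightarrow>\<^sub>M P" if "i < n" for i n
  proof -
    have "\<rho> n \<in> F n \<rightarrow>\<^sub>M Pi\<^sub>M {..<n} (\<lambda>_. P)"
      unfolding F_def by (rule measurable_vimage_algebra1) (use measurable_space[OF \<rho>_meas] in auto)
    then have "(\<lambda>\<omega>. \<rho> n \<omega> i) \<in> F n \<rightarrow>\<^sub>M P"
      by (rule measurable_compose[OF _ measurable_component_singleton]) (use that in auto)
    then show ?thesis using that by (simp add: \<rho>_def)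
  qed
  have F_mono: "subalgebra (F (Suc n)) (F n)" for n
  proof -
    have "\<rho> n \<in> F (Suc n) \<rightarrow>\<^sub>M Pi\<^sub>M {..<n} (\<lambda>_. P)"
      unfolding \<rho>_def by (intro measurable_restrict z_F) auto
    then show ?thesis
      unfolding subalgebra_def using measurable_space[OF \<rho>_meas[of n]] measurable_sets[of "\<rho> n" "F (Suc n)"]
      by (auto simp: F_def[of n] sets_vimage_algebra2)
  qed
  have w_F: "w n \<in> F n \<rightarrow>\<^sub>M N" for n
  proof (induction n)
    case 0
    have "(\<lambda>_. w0) \<in> F 0 \<rightarrow>\<^sub>M N" using w0 by simp
    then show ?case using w0(2) by (subst measurable_cong[where g = "\<lambda>_. w0"]) auto
  next
    case (Suc n)
    have "w n \<in> F (Suc n) \<rightarrow>\<^sub>M N" by (rule measurable_from_subalg[OF F_mono Suc])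
    then have "(\<lambda>\<omega>. \<Phi> n (z n \<omega>, w n \<omega>)) \<in> F (Suc n) \<rightarrow>\<^sub>M N"
      using z_F[of n "Suc n"] by (intro measurable_compose[OF measurable_Pair \<Phi>]) auto
    then show ?case using step by (subst measurable_cong[where g = "\<lambda>\<omega>. \<Phi> n (z n \<omega>, w n \<omega>)"]) auto
  qed
  have w_meas [measurable]: "w n \<in> M \<rightarrow>\<^sub>M N" for n
    using measurable_from_subalg[OF subalg w_F] .
  interpret martingale_differences M F "\<lambda>k \<omega>. \<gamma> k * y (z k \<omega>, w k \<omega>)" "\<lambda>k. \<bar>\<gamma> k\<bar> * B"
  proof
    show "(\<lambda>\<omega>. \<gamma> n * y (z n \<omega>, w n \<omega>)) \<in> borel_measurable (F (Suc n))" for n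
      using z_F[of n "Suc n"] measurable_from_subalg[OF F_mono w_F[of n]]
      by (intro borel_measurable_times borel_measurable_const measurable_compose[OF measurable_Pair y]) auto
    show "\<bar>\<gamma> n * y (z n \<omega>, w n \<omega>)\<bar> \<le> \<bar>\<gamma> n\<bar> * B" if "\<omega> \<in> space M" for n \<omega>
      using that by (auto simp: abs_mult intro!: mult_left_mono y_bound measurable_space[OF z_meas] measurable_space[OF w_meas])
    show "expectation (\<lambda>\<omega>. Z \<omega> * (\<gamma> n * y (z n \<omega>, w n \<omega>))) = 0"
      if Z: "Z \<in> borel_measurable (F n)" "\<And>\<omega>. \<omega> \<in> space M \<Longrightarrow> \<bar>Z \<omega>\<bar> \<le> B'" for n Z B'
    proof -
      have [measurable]: "Z \<in> borel_measurable M" by (rule measurable_from_subalg[OF subalg Z(1)])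
      let ?h = "\<lambda>\<omega>. (Z \<omega>, w n \<omega>)"
      let ?BN = "(borel :: real measure) \<Otimes>\<^sub>M N"
      let ?\<mu> = "distr M ?BN ?h"
      have h_F: "?h \<in> F n \<rightarrow>\<^sub>M ?BN" by (intro measurable_Pair Z w_F)
      have ind: "indep_var (Pi\<^sub>M {..<n} (\<lambda>_. P)) (\<rho> n) (Pi\<^sub>M {n} (\<lambda>_. P)) (\<lambda>\<omega>. \<lambda>i\<in>{n}. z i \<omega>)"
        unfolding \<rho>_def by (rule indep_var_restrict[OF indep]) auto
      interpret h: prob_space "?\<mu>" by (rule prob_space_distr) measurable
      \<comment> \<open>Checked on rectangles: the event that \<open>?h\<close> lies in
        \<open>A\<close> belongs to \<open>F n\<close>, so it is a preimage under
        \<open>\<rho> n\<close>, which is independent of \<open>z n\<close>.\<close>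
      have joint: "?\<mu> \<Otimes>\<^sub>M P = distr M (?BN \<Otimes>\<^sub>M P) (\<lambda>\<omega>. (?h \<omega>, z n \<omega>))"
      proof (rule pair_measure_eqI)
        fix A B assume A: "A \<in> sets (?\<mu>)" and B: "B \<in> sets P"
        have "?h -` A \<inter> space (F n) \<in> sets (F n)" using A by (intro measurable_sets[OF h_F]) auto
        then obtain A' where A': "A' \<in> sets (Pi\<^sub>M {..<n} (\<lambda>_. P))" "?h -` A \<inter> space M = \<rho> n -` A' \<inter> space M"
          unfolding space_F using measurable_space[OF \<rho>_meas[of n]] by (auto simp: F_def sets_vimage_algebra2)
        define B' where "B' = (\<lambda>f. f n) -` B \<inter> space (Pi\<^sub>M {n} (\<lambda>_. P))"
        have B': "B' \<in> sets (Pi\<^sub>M {n} (\<lambda>_. P))"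
          unfolding B'_def using B by (intro measurable_sets[OF measurable_component_singleton]) auto
        have zB: "z n -` B \<inter> space M = (\<lambda>\<omega>. \<lambda>i\<in>{n}. z i \<omega>) -` B' \<inter> space M"
          using measurable_space[OF z_meas[of n]] by (auto simp: B'_def space_PiM)
        have "emeasure (distr M (?BN \<Otimes>\<^sub>M P) (\<lambda>\<omega>. (?h \<omega>, z n \<omega>))) (A \<times> B)
            = emeasure M ((\<lambda>\<omega>. (?h \<omega>, z n \<omega>)) -` (A \<times> B) \<inter> space M)"
          using A B by (intro emeasure_distr) auto
        also have "(\<lambda>\<omega>. (?h \<omega>, z n \<omega>)) -` (A \<times> B) \<inter> space M
            = (?h -` A \<inter> space M) \<inter> (z n -` B \<inter> space M)" by auto
        also have "\<dots> = (\<lambda>\<omega>. (\<rho> n \<omega>, \<lambda>i\<in>{n}. z i \<omega>)) -` (A' \<times> B') \<inter> space M"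
          unfolding A'(2) zB by auto
        also have "emeasure M \<dots> = ennreal (prob (?h -` A \<inter> space M) * prob (z n -` B \<inter> space M))"
          unfolding emeasure_eq_measure indep_varD[OF ind A'(1) B'] A'(2) zB ..
        also have "\<dots> = emeasure (?\<mu>) A * emeasure (distr M P (z n)) B"
          using A B by (simp add: emeasure_distr emeasure_eq_measure ennreal_mult)
        finally show "emeasure (?\<mu>) A * emeasure P B =
          emeasure (distr M (?BN \<Otimes>\<^sub>M P) (\<lambda>\<omega>. (?h \<omega>, z n \<omega>))) (A \<times> B)"
          unfolding law by simp
      qed (auto intro: h.sigma_finite_measure_axioms P.sigma_finite_measure_axioms)
      \<comment> \<open>Clamping the first coordinate to \<open>[-B', B']\<close> does not alter
        \<open>Z\<close> on \<open>space M\<close>, but makes the integrand bounded on the whole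
        product space, so that Fubini applies.\<close>
      let ?f = "\<lambda>x. max (- B') (min B' (fst (fst x))) * (\<gamma> n * y (snd x, snd (fst x)))"
      interpret hP: pair_prob_space "?\<mu>" P ..
      have f_meas [measurable]: "?f \<in> borel_measurable (?BN \<Otimes>\<^sub>M P)" by measurable
      have f_int: "integrable (?\<mu> \<Otimes>\<^sub>M P) ?f"
      proof (rule hP.integrable_const_bound[where B = "\<bar>B'\<bar> * (\<bar>\<gamma> n\<bar> * B)"])
        show "?f \<in> borel_measurable (?\<mu> \<Otimes>\<^sub>M P)"
          using f_meas by (simp cong: measurable_cong_sets sets_pair_measure_cong)
        show "AE x in ?\<mu> \<Otimes>\<^sub>M P. norm (?f x) \<le> \<bar>B'\<bar> * (\<bar>\<gamma> n\<bar> * B)"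
          by (intro AE_I2) (auto simp: space_pair_measure abs_mult intro!: mult_mono y_bound)
      qed
      have "expectation (\<lambda>\<omega>. Z \<omega> * (\<gamma> n * y (z n \<omega>, w n \<omega>))) = expectation (\<lambda>\<omega>. ?f (?h \<omega>, z n \<omega>))"
      proof (rule Bochner_Integration.integral_cong[OF refl])
        fix \<omega> assume "\<omega> \<in> space M"
        then have "max (- B') (min B' (Z \<omega>)) = Z \<omega>" using Z(2)[of \<omega>] by (auto simp: abs_le_iff)
        then show "Z \<omega> * (\<gamma> n * y (z n \<omega>, w n \<omega>)) = ?f (?h \<omega>, z n \<omega>)" by simp
      qed
      also have "\<dots> = integral\<^sup>L (?\<mu> \<Otimes>\<^sub>M P) ?f"
        unfolding joint by (subst integral_distr) (auto simp: f_meas)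
      also have "\<dots> = (\<integral>x. (\<integral>s. ?f (x, s) \<partial>P) \<partial>?\<mu>)"
        by (rule hP.integral_fst'[OF f_int, symmetric])
      also have "\<dots> = (\<integral>x. 0 \<partial>?\<mu>)"
        by (rule Bochner_Integration.integral_cong[OF refl]) (auto simp: y_mean space_pair_measure)
      finally show ?thesis by simp
    qed
  qed (rule subalg F_mono)+
  show ?thesis
    using \<gamma> by (intro AE_convergent) (simp add: power_mult_distrib summable_mult2)
qed

section \<open>Calculus\<close>

lemma Ck_on_Suc_imp: "Ck_on (Suc n) f S \<Longrightarrow> Ck_on n f S"
proof (induction n arbitrary: f)
  case 0
  then show ?case
    by (auto intro!: continuous_at_imp_continuous_on dest: has_derivative_continuous)
next
  case (Suc n)
  from Suc.prems obtain f' where "\<forall>x\<in>S. (f has_derivative f' x) (at x)" "\<forall>v. Ck_on (Suc n) (\<lambda>x. f' x v) S"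
    by (subst (asm) Ck_on.simps(2)) blast
  then show ?case using Suc.IH by auto
qed

lemma Ck_on_le: "m \<le> n \<Longrightarrow> Ck_on n f S \<Longrightarrow> Ck_on m f S"
  by (induction n rule: dec_induct) (auto dest: Ck_on_Suc_imp simp del: Ck_on.simps)

lemma Ck_on_cong:
  assumes "open S" "Ck_on n f S" "\<And>x. x \<in> S \<Longrightarrow> f x = h x"
  shows "Ck_on n h S"
proof (cases n)
  case 0
  then show ?thesis using assms by (simp cong: continuous_on_cong)
next
  case (Suc m)
  have "(h has_derivative f') (at x)" if "x \<in> S" "(f has_derivative f') (at x)" for x f'
    by (rule has_derivative_transform_within_open[OF that(2) assms(1) that(1)]) (simp add: assms(3))
  then show ?thesis using assms(2) unfolding Suc by auto
qed

text \<open>\<open>Ck_on\<close> only asserts that some derivative field is regular; derivatives are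
  unique, so an explicitly given field coincides with it on \<open>S\<close> and inherits its
  regularity.\<close>

lemma Ck_on_derivative:
  assumes "Ck_on (Suc n) f S" "\<And>x. x \<in> S \<Longrightarrow> (f has_derivative f' x) (at x)" "open S"
  shows "Ck_on n (\<lambda>x. f' x v) S"
proof -
  obtain F where F: "\<And>x. x \<in> S \<Longrightarrow> (f has_derivative F x) (at x)" "\<And>v. Ck_on n (\<lambda>x. F x v) S"
    using assms(1) by auto
  have "F x = f' x" if "x \<in> S" for x
    by (rule has_derivative_unique[OF F(1) assms(2)]) fact+
  then show ?thesis by (intro Ck_on_cong[OF assms(3) F(2)]) auto
qed

text \<open>\<open>Ck_on\<close> controls derivatives one fixed direction at a time; this passes
  from basis directions to all directions at the price of summing the bounds.\<close>

lemma norm_linear_le_Basis: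
  fixes f :: "'a::euclidean_space \<Rightarrow> 'b::real_normed_vector"
  assumes "linear f" "\<And>i. i \<in> Basis \<Longrightarrow> norm (f i) \<le> B i"
  shows "norm (f v) \<le> (\<Sum>i\<in>Basis. B i) * norm v"
proof -
  have "f v = f (\<Sum>i\<in>Basis. (v \<bullet> i) *\<^sub>R i)" by (simp add: euclidean_representation)
  also have "\<dots> = (\<Sum>i\<in>Basis. (v \<bullet> i) *\<^sub>R f i)"
    by (simp add: linear_sum[OF assms(1)] linear_cmul[OF assms(1)])
  also have "norm \<dots> \<le> (\<Sum>i\<in>Basis. B i * norm v)"
  proof (rule sum_norm_le)
    fix i :: 'a assume "i \<in> Basis"
    then show "norm ((v \<bullet> i) *\<^sub>R f i) \<le> B i * norm v"
      using mult_mono[OF Basis_le_norm[of i v] assms(2)[of i]] by (simp add: mult.commute)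
  qed
  finally show ?thesis by (simp add: sum_distrib_right)
qed

lemma linear_functional_Basis:
  fixes f :: "'a::euclidean_space \<Rightarrow> real"
  assumes "linear f"
  shows "f v = (\<Sum>i\<in>Basis. (v \<bullet> i) * f i)"
proof -
  have "f v = f (\<Sum>i\<in>Basis. (v \<bullet> i) *\<^sub>R i)" by (simp add: euclidean_representation)
  then show ?thesis by (simp add: linear_sum[OF assms] linear_cmul[OF assms])
qed

lemma linear_functional_inner:
  fixes f :: "'a::euclidean_space \<Rightarrow> real"
  assumes "linear f"
  shows "f v = (\<Sum>i\<in>Basis. f i *\<^sub>R i) \<bullet> v"
  by (subst linear_functional_Basis[OF assms]) (simp add: inner_sum_right inner_commute[of _ v] mult.commute)

text \<open>Directional derivatives along basis vectors are continuous, hence bounded on the compact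
  \<open>T\<close>; convexity allows the mean value inequality.\<close>

lemma C1_Lipschitz:
  fixes f :: "'a::euclidean_space \<Rightarrow> 'b::real_normed_vector"
  assumes "Ck_on 1 f S" "compact T" "convex T" "T \<subseteq> S"
  obtains L where "L \<ge> 0" "\<And>x y. x \<in> T \<Longrightarrow> y \<in> T \<Longrightarrow> norm (f x - f y) \<le> L * norm (x - y)"
proof -
  obtain f' where f': "\<And>x. x \<in> S \<Longrightarrow> (f has_derivative f' x) (at x)"
    and cont: "\<And>v. continuous_on S (\<lambda>x. f' x v)"
    using assms(1) by auto
  have "\<exists>B. \<forall>x\<in>T. norm (f' x i) \<le> B" for i
    using compact_imp_bounded[OF compact_continuous_image[OF continuous_on_subset[OF cont assms(4)] assms(2)]]
    by (auto simp: bounded_iff)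
  then obtain B where B: "\<And>i x. x \<in> T \<Longrightarrow> norm (f' x i) \<le> B i" by metis
  define L where "L = \<bar>\<Sum>i\<in>Basis. B i\<bar>"
  show thesis
  proof
    show "L \<ge> 0" by (simp add: L_def)
    fix x y assume "x \<in> T" "y \<in> T"
    then show "norm (f x - f y) \<le> L * norm (x - y)"
    proof (rule differentiable_bound[OF assms(3), rotated 2])
      fix x assume x: "x \<in> T"
      show "(f has_derivative f' x) (at x within T)"
        using f' x assms(4) by (auto intro: has_derivative_at_withinI)
      have "norm (f' x v) \<le> L * norm v" for v
      proof -
        have "norm (f' x v) \<le> (\<Sum>i\<in>Basis. B i) * norm v"
          using f'[of x] x assms(4) B[OF x] by (intro norm_linear_le_Basis has_derivative_linear) auto
        also have "\<dots> \<le> L * norm v" by (intro mult_right_mono) (auto simp: L_def)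
        finally show ?thesis .
      qed
      then show "onorm (f' x) \<le> L" by (rule onorm_le)
    qed
  qed
qed

text \<open>Each directional derivative is Lipschitz on \<open>T\<close>, so
  \<open>f' u - f' x\<close> has operator norm at most \<open>L * norm (y - x)\<close> on the
  segment. The mean value inequality for \<open>f\<close> minus its linear part at \<open>x\<close>
  contributes the second factor \<open>norm (y - x)\<close>.\<close>

lemma C2_Taylor:
  fixes f :: "'a::euclidean_space \<Rightarrow> 'b::real_normed_vector"
  assumes "Ck_on 2 f S" and f': "\<And>x. x \<in> S \<Longrightarrow> (f has_derivative f' x) (at x)"
    and "open S" "compact T" "convex T" "T \<subseteq> S"
  obtains L where "L \<ge> 0"
    "\<And>x y. x \<in> T \<Longrightarrow> y \<in> T \<Longrightarrow> norm (f y - f x - f' x (y - x)) \<le> L * (norm (y - x))\<^sup>2"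
proof -
  have "Ck_on 1 (\<lambda>x. f' x i) S" for i
    using assms(1) f' by (intro Ck_on_derivative[of 1, OF _ _ \<open>open S\<close>]) (simp_all add: numeral_2_eq_2 del: Ck_on.simps)
  then have "\<exists>L. \<forall>x\<in>T. \<forall>y\<in>T. norm (f' x i - f' y i) \<le> L * norm (x - y)" for i
    using C1_Lipschitz[OF _ assms(4-6)] by metis
  then obtain B where B: "\<And>i x y. x \<in> T \<Longrightarrow> y \<in> T \<Longrightarrow> norm (f' x i - f' y i) \<le> B i * norm (x - y)"
    by metis
  define L where "L = \<bar>\<Sum>i\<in>Basis. B i\<bar>"
  have L0: "L \<ge> 0" by (simp add: L_def)
  show thesis
  proof
    show "L \<ge> 0" by (rule L0)
    fix x y assume xy: "x \<in> T" "y \<in> T"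
    let ?h = "\<lambda>u. f u - f' x u"
    have lin: "linear (f' u)" if "u \<in> T" for u
      using f'[of u] that assms(6) by (auto dest: has_derivative_linear)
    have seg: "closed_segment x y \<subseteq> T" using xy assms(5) by (simp add: closed_segment_subset)
    have "norm (?h y - ?h x) \<le> (L * norm (y - x)) * norm (y - x)"
    proof (rule differentiable_bound[of "closed_segment x y"])
      fix u assume u: "u \<in> closed_segment x y"
      then have uT: "u \<in> T" using seg by auto
      show "(?h has_derivative (\<lambda>v. f' u v - f' x v)) (at u within closed_segment x y)"
        using f'[of u] uT assms(6) lin[OF xy(1)]
        by (intro has_derivative_diff has_derivative_at_withinI[OF f'] bounded_linear_imp_has_derivative)
          (auto intro: linear_conv_bounded_linear[THEN iffD1])
      show "onorm (\<lambda>v. f' u v - f' x v) \<le> L * norm (y - x)"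
      proof (rule onorm_le)
        fix v
        have "norm (f' u v - f' x v) \<le> (\<Sum>i\<in>Basis. B i * norm (u - x)) * norm v"
          using B uT xy(1) by (intro norm_linear_le_Basis linear_compose_sub lin) auto
        also have "\<dots> \<le> (L * norm (u - x)) * norm v"
          by (intro mult_right_mono) (auto simp: L_def sum_distrib_right[symmetric] intro: mult_right_mono)
        also have "\<dots> \<le> (L * norm (y - x)) * norm v"
          using segment_bound(1)[OF u] L0 by (intro mult_right_mono mult_left_mono) (auto simp: norm_minus_commute)
        finally show "norm (f' u v - f' x v) \<le> (L * norm (y - x)) * norm v" .
      qed
    qed auto
    moreover have "?h y - ?h x = f y - f x - f' x (y - x)"
      by (simp add: linear_diff[OF lin[OF xy(1)]])
    ultimately show "norm (f y - f x - f' x (y - x)) \<le> L * (norm (y - x))\<^sup>2"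
      by (simp add: power2_eq_square mult.assoc)
  qed
qed

text \<open>Gronwall's argument: \<open>\<psi> t * exp (- L * t)\<close> is nonincreasing and
  \<open>\<psi> t * exp (L * t)\<close> nondecreasing, so on either side of \<open>t0\<close> the
  nonnegative \<open>\<psi>\<close> is squeezed by its value 0 at \<open>t0\<close>.\<close>

lemma zero_if_derivative_le_self:
  fixes \<psi> :: "real \<Rightarrow> real"
  assumes J: "is_interval J" and "t0 \<in> J" "t \<in> J"
    and deriv: "\<And>t. t \<in> J \<Longrightarrow> (\<psi> has_real_derivative \<psi>' t) (at t)"
    and le: "\<And>t. t \<in> J \<Longrightarrow> \<bar>\<psi>' t\<bar> \<le> L * \<psi> t"
    and nonneg: "\<And>t. t \<in> J \<Longrightarrow> 0 \<le> \<psi> t" and "\<psi> t0 = 0"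
  shows "\<psi> t = 0"
proof (cases "t0 \<le> t")
  case True
  have "\<psi> t * exp (- L * t) \<le> \<psi> t0 * exp (- L * t0)"
  proof (rule DERIV_nonpos_imp_nonincreasing[OF True])
    fix s assume "t0 \<le> s" "s \<le> t"
    then have s: "s \<in> J" using J assms(2,3) by (meson mem_is_interval_1_I)
    have "((\<lambda>t. \<psi> t * exp (- L * t)) has_real_derivative (\<psi>' s - L * \<psi> s) * exp (- L * s)) (at s)"
      by (auto intro!: derivative_eq_intros deriv[OF s] simp: algebra_simps)
    moreover have "(\<psi>' s - L * \<psi> s) * exp (- L * s) \<le> 0"
      using le[OF s] by (intro mult_nonpos_nonneg) auto
    ultimately show "\<exists>y. ((\<lambda>t. \<psi> t * exp (- L * t)) has_real_derivative y) (at s) \<and> y \<le> 0" by blast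
  qed
  then show ?thesis using nonneg[OF \<open>t \<in> J\<close>] \<open>\<psi> t0 = 0\<close> by (simp add: mult_le_0_iff order_antisym)
next
  case False
  then have ge: "t \<le> t0" by simp
  have "\<psi> t * exp (L * t) \<le> \<psi> t0 * exp (L * t0)"
  proof (rule DERIV_nonneg_imp_nondecreasing[OF ge])
    fix s assume "t \<le> s" "s \<le> t0"
    then have s: "s \<in> J" using J assms(2,3) by (meson mem_is_interval_1_I)
    have "((\<lambda>t. \<psi> t * exp (L * t)) has_real_derivative (\<psi>' s + L * \<psi> s) * exp (L * s)) (at s)"
      by (auto intro!: derivative_eq_intros deriv[OF s] simp: algebra_simps)
    moreover have "0 \<le> (\<psi>' s + L * \<psi> s) * exp (L * s)"
      using le[OF s] by (intro mult_nonneg_nonneg) auto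
    ultimately show "\<exists>y. ((\<lambda>t. \<psi> t * exp (L * t)) has_real_derivative y) (at s) \<and> 0 \<le> y" by blast
  qed
  then show ?thesis using nonneg[OF \<open>t \<in> J\<close>] \<open>\<psi> t0 = 0\<close> by (simp add: mult_le_0_iff order_antisym)
qed

text \<open>Leaving the region \<open>\<rho> < r\<close> from \<open>\<rho> < r / 2\<close> uses up a fixed amount of
  \<open>\<Sum> \<gamma>\<close>, hence of the convergent sum \<open>\<Sum> \<gamma> a\<close>, while staying there for ever is
  impossible since \<open>\<Sum> \<gamma>\<close> diverges.\<close>

lemma eventually_far:
  fixes \<gamma> a \<rho> :: "nat \<Rightarrow> real"
  assumes \<gamma>: "\<And>t. \<gamma> t > 0" "filterlim (\<lambda>n. \<Sum>t<n. \<gamma> t) at_top sequentially"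
    and a: "\<And>t. a t \<ge> 0" "summable (\<lambda>t. \<gamma> t * a t)"
    and "\<epsilon> > 0" "r > 0" "L > 0"
    and near: "\<forall>\<^sub>F t in sequentially. \<rho> t < r \<longrightarrow> a t \<ge> \<epsilon> \<and> \<rho> (Suc t) \<le> \<rho> t + L * \<gamma> t"
  shows "\<forall>\<^sub>F t in sequentially. \<rho> t \<ge> r / 2"
proof -
  obtain T0 where T0: "\<And>t. t \<ge> T0 \<Longrightarrow> \<rho> t < r \<Longrightarrow> a t \<ge> \<epsilon> \<and> \<rho> (Suc t) \<le> \<rho> t + L * \<gamma> t"
    using near by (auto simp: eventually_sequentially)
  \<comment> \<open>The budget: covering a distance \<open>r / 2\<close> at speed \<open>L\<close>
    takes a total step size \<open>r / (2 * L)\<close>, during which \<open>a\<close> is at least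
    \<open>\<epsilon>\<close>. Late tails of the convergent series are smaller than this.\<close>
  have "\<epsilon> * r / (2 * L) > 0" using assms by simp
  then obtain T1 where T1: "\<And>m n. m \<ge> T1 \<Longrightarrow> norm (\<Sum>t=m..<n. \<gamma> t * a t) < \<epsilon> * r / (2 * L)"
    using a(2) unfolding summable_Cauchy by meson
  have "\<rho> m \<ge> r / 2" if m: "m \<ge> T0" "m \<ge> T1" for m
  proof (rule ccontr)
    assume small: "\<not> \<rho> m \<ge> r / 2"
    have sum_le: "\<epsilon> * (\<Sum>t=m..<n. \<gamma> t) < \<epsilon> * r / (2 * L)" if "\<And>t. m \<le> t \<Longrightarrow> t < n \<Longrightarrow> \<rho> t < r" for n
    proof -
      have "\<epsilon> * (\<Sum>t=m..<n. \<gamma> t) = (\<Sum>t=m..<n. \<gamma> t * \<epsilon>)" by (simp add: sum_distrib_left mult.commute)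
      also have "\<dots> \<le> (\<Sum>t=m..<n. \<gamma> t * a t)"
        using T0 that m \<gamma>(1) by (intro sum_mono mult_left_mono) (auto simp: less_imp_le)
      also have "\<dots> < \<epsilon> * r / (2 * L)" using T1[OF m(2), of n] by simp
      finally show ?thesis .
    qed
    \<comment> \<open>Both claims are carried together: being below \<open>r\<close> so far bounds
      the accumulated step size by \<open>r / (2 * L)\<close>, which keeps the next position below
      \<open>r / 2 + r / 2\<close>.\<close>
    have *: "n \<ge> m \<Longrightarrow> (\<forall>t. m \<le> t \<and> t \<le> n \<longrightarrow> \<rho> t < r) \<and> \<rho> n \<le> \<rho> m + L * (\<Sum>t=m..<n. \<gamma> t)" for n
    proof (induction n rule: dec_induct)
      case base
      then show ?case using small \<open>r > 0\<close> by (auto dest: order_antisym)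
    next
      case (step n)
      have "\<rho> (Suc n) \<le> \<rho> n + L * \<gamma> n" using T0[of n] step m by auto
      also have "\<dots> \<le> \<rho> m + L * (\<Sum>t=m..<Suc n. \<gamma> t)" using step by (simp add: algebra_simps)
      finally have 1: "\<rho> (Suc n) \<le> \<rho> m + L * (\<Sum>t=m..<Suc n. \<gamma> t)" .
      have "\<epsilon> * (\<Sum>t=m..<Suc n. \<gamma> t) < \<epsilon> * r / (2 * L)"
        by (rule sum_le) (use step in auto)
      then have "L * (\<Sum>t=m..<Suc n. \<gamma> t) < r / 2"
        using \<open>\<epsilon> > 0\<close> \<open>L > 0\<close> by (simp add: field_simps)
      then have "\<rho> (Suc n) < r" using 1 small by simp
      then show ?case using step 1 by (auto simp: le_Suc_eq)
    qed
    have bounded: "(\<Sum>t<n. \<gamma> t) \<le> (\<Sum>t<m. \<gamma> t) + r / (2 * L)" if "n \<ge> m" for n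
    proof -
      have "\<epsilon> * (\<Sum>t=m..<n. \<gamma> t) < \<epsilon> * r / (2 * L)"
        using *[OF that] by (intro sum_le) auto
      then have "(\<Sum>t=m..<n. \<gamma> t) \<le> r / (2 * L)" using \<open>\<epsilon> > 0\<close> \<open>L > 0\<close> by (simp add: field_simps)
      moreover have "(\<Sum>t<n. \<gamma> t) = (\<Sum>t<m. \<gamma> t) + (\<Sum>t=m..<n. \<gamma> t)"
        using sum.atLeastLessThan_concat[of 0 m n \<gamma>] that by (simp add: atLeast0LessThan)
      ultimately show ?thesis by simp
    qed
    have "\<forall>\<^sub>F n in sequentially. (\<Sum>t<n. \<gamma> t) > (\<Sum>t<m. \<gamma> t) + r / (2 * L)"
      using \<gamma>(2) by (simp add: filterlim_at_top_dense)
    then have "\<forall>\<^sub>F n in sequentially. False"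
      using eventually_ge_at_top[of m] by eventually_elim (use bounded in fastforce)
    then show False by simp
  qed
  then show ?thesis by (intro eventually_sequentiallyI[of "max T0 T1"]) auto
qed

section \<open>Bilinear forms on Euclidean spaces\<close>

lemma bilinear_Basis:
  fixes B :: "'e::euclidean_space \<Rightarrow> 'e \<Rightarrow> real"
  assumes "bilinear B"
  shows "B u v = (\<Sum>i\<in>Basis. \<Sum>j\<in>Basis. (u \<bullet> i) * (v \<bullet> j) * B i j)"
proof -
  have "B u v = B (\<Sum>i\<in>Basis. (u \<bullet> i) *\<^sub>R i) (\<Sum>j\<in>Basis. (v \<bullet> j) *\<^sub>R j)"
    by (simp add: euclidean_representation)
  also have "\<dots> = (\<Sum>i\<in>Basis. \<Sum>j\<in>Basis. (u \<bullet> i) * (v \<bullet> j) * B i j)"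
    by (simp add: bilinear_sum[OF assms] sum.cartesian_product[symmetric] bilinear_lmul[OF assms]
        bilinear_rmul[OF assms] mult_ac)
  finally show ?thesis .
qed

text \<open>The metric is known to be continuous in the base point for fixed arguments; the finite
  basis expansion upgrades this to joint continuity.\<close>

lemma continuous_on_bilinear:
  fixes b :: "'c::topological_space \<Rightarrow> 'e::euclidean_space \<Rightarrow> 'e \<Rightarrow> real"
  assumes "\<And>x. x \<in> S \<Longrightarrow> bilinear (b x)" "\<And>u v. continuous_on S (\<lambda>x. b x u v)"
    and "continuous_on T f" "f ` T \<subseteq> S" "continuous_on T u" "continuous_on T v"
  shows "continuous_on T (\<lambda>t. b (f t) (u t) (v t))"
proof -
  have "continuous_on T (\<lambda>t. b (f t) i j)" for i j
    by (rule continuous_on_compose2[OF assms(2,3,4)])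
  then have "continuous_on T (\<lambda>t. \<Sum>i\<in>Basis. \<Sum>j\<in>Basis. (u t \<bullet> i) * (v t \<bullet> j) * b (f t) i j)"
    by (intro continuous_intros assms)
  then show ?thesis
    by (rule continuous_on_eq) (use assms(1,4) in \<open>auto intro!: bilinear_Basis[symmetric]\<close>)
qed

text \<open>The constants are the extreme values of \<open>b x v v\<close> over the compact product
  of \<open>S\<close> and the unit sphere; homogeneity of degree 2 carries the bounds to all
  \<open>v\<close>.\<close>

lemma quadratic_form_comparison:
  fixes b :: "'c::euclidean_space \<Rightarrow> 'e::euclidean_space \<Rightarrow> 'e \<Rightarrow> real"
  assumes bil: "\<And>x. x \<in> S \<Longrightarrow> bilinear (b x)" and cont: "\<And>u v. continuous_on S (\<lambda>x. b x u v)"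
    and pos: "\<And>x v. x \<in> S \<Longrightarrow> v \<noteq> 0 \<Longrightarrow> 0 < b x v v" and "compact S"
  obtains m1 m2 where "0 < m1" "0 < m2"
    "\<And>x v. x \<in> S \<Longrightarrow> m1 * (norm v)\<^sup>2 \<le> b x v v" "\<And>x v. x \<in> S \<Longrightarrow> b x v v \<le> m2 * (norm v)\<^sup>2"
proof (cases "S = {}")
  case True
  show thesis by (rule that[of 1 1]) (auto simp: True)
next
  case False
  let ?K = "S \<times> sphere (0::'e) 1"
  have K: "compact ?K" "?K \<noteq> {}" using assms(4) False by (auto intro!: compact_Times)
  have c: "continuous_on ?K (\<lambda>(x, v). b x v v)"
    unfolding split_def by (intro continuous_on_bilinear[OF bil cont] continuous_intros) auto
  obtain p where p: "p \<in> ?K" "\<And>q. q \<in> ?K \<Longrightarrow> (\<lambda>(x, v). b x v v) p \<le> (\<lambda>(x, v). b x v v) q"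
    using continuous_attains_inf[OF K c] by blast
  obtain p' where p': "p' \<in> ?K" "\<And>q. q \<in> ?K \<Longrightarrow> (\<lambda>(x, v). b x v v) q \<le> (\<lambda>(x, v). b x v v) p'"
    using continuous_attains_sup[OF K c] by blast
  let ?m1 = "(\<lambda>(x, v). b x v v) p" and ?m2 = "(\<lambda>(x, v). b x v v) p'"
  have scale: "b x v v = b x (v /\<^sub>R norm v) (v /\<^sub>R norm v) * (norm v)\<^sup>2" if "x \<in> S" "v \<noteq> 0" for x v
    using bilinear_lmul[OF bil[OF that(1)]] bilinear_rmul[OF bil[OF that(1)]] that
    by (simp add: power2_eq_square field_simps)
  show thesis
  proof (rule that)
    show "0 < ?m1" "0 < ?m2" using p(1) p'(1) by (auto simp: case_prod_unfold intro!: pos)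
    fix x and v :: 'e assume x: "x \<in> S"
    have "?m1 * (norm v)\<^sup>2 \<le> b x v v \<and> b x v v \<le> ?m2 * (norm v)\<^sup>2"
    proof (cases "v = 0")
      case True then show ?thesis using bilinear_lzero[OF bil[OF x]] by simp
    next
      case False
      then have "?m1 \<le> b x (v /\<^sub>R norm v) (v /\<^sub>R norm v)" "b x (v /\<^sub>R norm v) (v /\<^sub>R norm v) \<le> ?m2"
        using p(2)[of "(x, v /\<^sub>R norm v)"] p'(2)[of "(x, v /\<^sub>R norm v)"] x by simp_all
      then show ?thesis unfolding scale[OF x False] by (intro conjI mult_right_mono) simp_all
    qed
    then show "?m1 * (norm v)\<^sup>2 \<le> b x v v" "b x v v \<le> ?m2 * (norm v)\<^sup>2" by auto
  qed
qed

text \<open>Definiteness makes the passage from \<open>u\<close> to the functional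
  \<open>B u\<close> injective, and finite dimension makes it onto. This gives meaning to the
  definite descriptions in \<open>gradient\<close> and \<open>christoffel\<close>.\<close>

lemma Riesz_bilinear:
  fixes B :: "'e::euclidean_space \<Rightarrow> 'e \<Rightarrow> real"
  assumes B: "bilinear B" and pos: "\<And>v. v \<noteq> 0 \<Longrightarrow> 0 < B v v" and f: "linear f"
  shows "\<exists>!u. \<forall>v. B u v = f v"
proof -
  let ?\<Phi> = "\<lambda>u. \<Sum>i\<in>Basis. B u i *\<^sub>R i"
  have lin: "linear ?\<Phi>"
    using bilinear_ladd[OF B] bilinear_lmul[OF B]
    by (intro linearI) (auto simp: scaleR_left_distrib sum.distrib scaleR_right.sum)
  have eq_Basis: "B u v = (\<Sum>i\<in>Basis. B u i *\<^sub>R i) \<bullet> v" for u v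
    using B by (intro linear_functional_inner) (auto simp: bilinear_def)
  have "u = 0" if "?\<Phi> u = 0" for u
    using eq_Basis[of u u] that pos[of u] by fastforce
  then have "inj ?\<Phi>" using linear_injective_0[OF lin] by blast
  then have "surj ?\<Phi>" by (intro linear_injective_imp_surjective[OF lin]) simp_all
  then obtain u where u: "(\<Sum>i\<in>Basis. f i *\<^sub>R i) = ?\<Phi> u" by (meson surjD)
  have "f v = (\<Sum>i\<in>Basis. f i *\<^sub>R i) \<bullet> v" for v by (rule linear_functional_inner[OF f])
  then have u_eq: "\<forall>v. B u v = f v" using eq_Basis u by metis
  show ?thesis
  proof (rule ex1I[of _ u])
    fix u' assume "\<forall>v. B u' v = f v"
    then have "B (u' - u) (u' - u) = 0"
      using u_eq by (simp add: bilinear_lsub[OF B])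
    then show "u' = u" using pos[of "u' - u"] by fastforce
  qed (rule u_eq)
qed

section \<open>Charts and tangent vectors\<close>

context smooth_manifold
begin

lemma chart_at: "chart_at p \<in> atlas" "p \<in> fst (chart_at p)"
proof -
  have "\<exists>c. c \<in> atlas \<and> p \<in> fst c" using atlas_cover by blast
  from someI_ex[OF this] show "chart_at p \<in> atlas" "p \<in> fst (chart_at p)"
    by (auto simp: chart_at_def)
qed

lemma
  assumes "c \<in> atlas"
  shows open_chart_dom: "open (fst c)"
    and open_chart_image: "open W \<Longrightarrow> open (snd c ` (fst c \<inter> W))"
    and inj_on_chart: "inj_on (snd c) (fst c)"
    and continuous_on_chart: "continuous_on (fst c) (snd c)"
    and continuous_on_chart_inv: "continuous_on (snd c ` fst c) (chart_inv c)"
    and chart_inv_chart: "p \<in> fst c \<Longrightarrow> chart_inv c (snd c p) = p"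
    and chart_chart_inv: "x \<in> snd c ` fst c \<Longrightarrow> snd c (chart_inv c x) = x"
    and chart_inv_in: "x \<in> snd c ` fst c \<Longrightarrow> chart_inv c x \<in> fst c"
proof -
  have c: "open (fst c)" "open (snd c ` fst c)"
    "homeomorphism (fst c) (snd c ` fst c) (snd c) (chart_inv c)"
    using atlas_chart[OF assms] by (auto simp: is_chart_def)
  show "open (fst c)" "continuous_on (fst c) (snd c)" "continuous_on (snd c ` fst c) (chart_inv c)"
    "p \<in> fst c \<Longrightarrow> chart_inv c (snd c p) = p" "x \<in> snd c ` fst c \<Longrightarrow> snd c (chart_inv c x) = x"
    "x \<in> snd c ` fst c \<Longrightarrow> chart_inv c x \<in> fst c"
    using c by (auto simp: homeomorphism_def)
  show "inj_on (snd c) (fst c)" using c(3) by (auto simp: homeomorphism_def intro: inj_on_inverseI)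
  show "open (snd c ` (fst c \<inter> W))" if "open W"
  proof -
    have "openin (top_of_set (snd c ` fst c)) (snd c ` (fst c \<inter> W))"
      using that by (intro homeomorphism_imp_open_map[OF c(3)]) (auto intro: openin_open_Int)
    then show ?thesis using c(2) by (simp add: openin_open_eq)
  qed
qed

lemma open_chart_range: "c \<in> atlas \<Longrightarrow> open (snd c ` fst c)"
  using open_chart_image[of c UNIV] by simp

lemma chart_nhd:
  assumes c: "c \<in> atlas" "p \<in> fst c" and W: "open W" "p \<in> W"
  obtains r where "r > 0" "cball (snd c p) r \<subseteq> snd c ` (fst c \<inter> W)"
    "\<And>x. x \<in> cball (snd c p) r \<Longrightarrow> chart_inv c x \<in> fst c \<inter> W"
proof -
  have "open (snd c ` (fst c \<inter> W))" "snd c p \<in> snd c ` (fst c \<inter> W)"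
    using open_chart_image[OF c(1) W(1)] assms by auto
  then obtain r where r: "r > 0" "cball (snd c p) r \<subseteq> snd c ` (fst c \<inter> W)"
    by (meson open_contains_cball)
  then have "chart_inv c x \<in> fst c \<inter> W" if x: "x \<in> cball (snd c p) r" for x
  proof -
    obtain q where "q \<in> fst c \<inter> W" "x = snd c q" using r(2) x by blast
    then show ?thesis using chart_inv_chart[OF c(1)] by simp
  qed
  then show thesis using that[OF r] by blast
qed

lemma open_chart_vimage:
  assumes "c \<in> atlas" "open B" shows "open (fst c \<inter> snd c -` B)"
  using continuous_on_chart[OF assms(1)] open_chart_dom[OF assms(1)] assms(2)
  by (simp add: continuous_on_open_vimage Int_commute)

lemma transition_has_derivative:
  assumes "c \<in> atlas" "d \<in> atlas" "p \<in> fst c" "p \<in> fst d"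
  shows "((snd d \<circ> chart_inv c) has_derivative transition_deriv c d p) (at (snd c p))"
proof -
  have "Ck_on 1 (snd d \<circ> chart_inv c) (snd c ` (fst c \<inter> fst d))"
    using atlas_compatible[OF assms(1,2)] by (auto simp: smooth_on_def)
  then have "(snd d \<circ> chart_inv c) differentiable (at (snd c p))"
    using assms by (auto simp: differentiable_def)
  then show ?thesis unfolding transition_deriv_def by (simp add: frechet_derivative_works)
qed

lemma linear_transition_deriv:
  "c \<in> atlas \<Longrightarrow> d \<in> atlas \<Longrightarrow> p \<in> fst c \<Longrightarrow> p \<in> fst d \<Longrightarrow> linear (transition_deriv c d p)"
  using transition_has_derivative has_derivative_linear by blast

text \<open>Chain rule: on the common domain of the three charts the transition from
  \<open>c\<close> to \<open>e\<close> factors through \<open>d\<close>. It makes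
  \<open>coords\<close> and \<open>of_coords\<close> inverse to each other.\<close>

lemma transition_deriv_comp:
  assumes "c \<in> atlas" "d \<in> atlas" "e \<in> atlas" "p \<in> fst c" "p \<in> fst d" "p \<in> fst e"
  shows "transition_deriv d e p (transition_deriv c d p v) = transition_deriv c e p v"
proof -
  let ?S = "snd c ` (fst c \<inter> (fst d \<inter> fst e))"
  have "((snd e \<circ> chart_inv d) has_derivative transition_deriv d e p) (at ((snd d \<circ> chart_inv c) (snd c p)))"
    using transition_has_derivative[of d e p] assms by (simp add: chart_inv_chart)
  from diff_chain_at[OF transition_has_derivative[OF assms(1,2,4,5)] this]
  have "((snd e \<circ> chart_inv d) \<circ> (snd d \<circ> chart_inv c) has_derivative
      (transition_deriv d e p \<circ> transition_deriv c d p)) (at (snd c p))" .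
  moreover have "open ?S" using assms by (intro open_chart_image open_Int open_chart_dom)
  moreover have "((snd e \<circ> chart_inv d) \<circ> (snd d \<circ> chart_inv c)) x = (snd e \<circ> chart_inv c) x" if "x \<in> ?S" for x
    using that assms by (auto simp: chart_inv_chart)
  ultimately have "((snd e \<circ> chart_inv c) has_derivative
      (transition_deriv d e p \<circ> transition_deriv c d p)) (at (snd c p))"
    using assms by (elim has_derivative_transform_within_open) auto
  from has_derivative_unique[OF this transition_has_derivative[of c e p]] assms
  show ?thesis by (metis comp_apply)
qed

lemma transition_deriv_self:
  assumes "c \<in> atlas" "p \<in> fst c"
  shows "transition_deriv c c p v = v"
proof -
  have "((\<lambda>x. x) has_derivative (\<lambda>x. x)) (at (snd c p))" by simp
  then have "((snd c \<circ> chart_inv c) has_derivative (\<lambda>x. x)) (at (snd c p))"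
    by (rule has_derivative_transform_within_open[OF _ open_chart_range[OF assms(1)]])
      (use assms chart_chart_inv in auto)
  from has_derivative_unique[OF this transition_has_derivative[OF assms(1,1,2,2)]]
  show ?thesis by metis
qed

lemma continuous_on_transition_deriv:
  assumes "c \<in> atlas" "d \<in> atlas"
  shows "continuous_on (snd c ` (fst c \<inter> fst d)) (\<lambda>x. transition_deriv c d (chart_inv c x) v)"
proof -
  have C1: "Ck_on (Suc 0) (snd d \<circ> chart_inv c) (snd c ` (fst c \<inter> fst d))"
    using atlas_compatible[OF assms] by (auto simp: smooth_on_def simp del: Ck_on.simps)
  have "Ck_on 0 (\<lambda>x. transition_deriv c d (chart_inv c x) v) (snd c ` (fst c \<inter> fst d))"
  proof (rule Ck_on_derivative[OF C1])
    fix x assume "x \<in> snd c ` (fst c \<inter> fst d)"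
    then show "((snd d \<circ> chart_inv c) has_derivative transition_deriv c d (chart_inv c x)) (at x)"
      using transition_has_derivative[OF assms] assms by (auto simp: chart_inv_chart)
  qed (intro open_chart_image open_chart_dom assms)
  then show ?thesis by simp
qed

lemma
  assumes c: "c \<in> atlas" "p \<in> fst c"
  shows linear_coords: "linear (coords c p)"
    and linear_of_coords: "linear (of_coords c p)"
    and coords_of_coords: "coords c p (of_coords c p v) = v"
    and of_coords_coords: "of_coords c p (coords c p v) = v"
  unfolding coords_def of_coords_def
  using assms chart_at[of p]
  by (auto simp: linear_transition_deriv transition_deriv_comp transition_deriv_self)

lemma coords_chart_at: "coords (chart_at p) p v = v"
  unfolding coords_def using chart_at[of p] by (simp add: transition_deriv_self)

text \<open>Continuity of \<open>\<gamma>\<close> is assumed separately because \<open>snd c\<close>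
  has arbitrary values off the domain of \<open>c\<close>: differentiability of
  \<open>snd c \<circ> \<gamma>\<close> alone would not keep \<open>\<gamma>\<close> in that domain
  near \<open>t\<close>.\<close>

lemma vector_derivative_change_chart:
  assumes c: "c \<in> atlas" "d \<in> atlas" "\<gamma> t \<in> fst c" "\<gamma> t \<in> fst d" and "t \<in> T"
    and \<gamma>: "continuous (at t within T) \<gamma>"
    and D: "((snd c \<circ> \<gamma>) has_vector_derivative D) (at t within T)"
  shows "((snd d \<circ> \<gamma>) has_vector_derivative transition_deriv c d (\<gamma> t) D) (at t within T)"
proof -
  have "((snd d \<circ> chart_inv c) has_derivative transition_deriv c d (\<gamma> t)) (at ((snd c \<circ> \<gamma>) t))"
    using transition_has_derivative[OF c] by simp
  from vector_derivative_diff_chain_within[OF D has_derivative_at_withinI[OF this]]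
  have "((snd d \<circ> chart_inv c) \<circ> (snd c \<circ> \<gamma>) has_vector_derivative transition_deriv c d (\<gamma> t) D) (at t within T)" .
  then show ?thesis unfolding has_vector_derivative_def
  proof (rule has_derivative_transform_eventually)
    have "\<forall>\<^sub>F s in at t within T. \<gamma> s \<in> fst c"
      using \<gamma> c open_chart_dom[OF c(1)] by (auto simp: continuous_within intro: topological_tendstoD)
    then show "\<forall>\<^sub>F s in at t within T. (snd d \<circ> chart_inv c \<circ> (snd c \<circ> \<gamma>)) s = (snd d \<circ> \<gamma>) s"
      by eventually_elim (simp add: chart_inv_chart[OF c(1)])
  qed (use c \<open>t \<in> T\<close> in \<open>auto simp: chart_inv_chart\<close>)
qed

text \<open>The velocity is a two-sided derivative; the one-sided version serves the end points of
  \<open>C\<^sup>1\<close> pieces.\<close>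

definition velocity_within :: "(real \<Rightarrow> 'm) \<Rightarrow> real \<Rightarrow> real set \<Rightarrow> 'e" where
  "velocity_within \<gamma> t T = vector_derivative (snd (chart_at (\<gamma> t)) \<circ> \<gamma>) (at t within T)"

lemma velocity_within_UNIV: "velocity_within \<gamma> t UNIV = velocity \<gamma> t"
  by (simp add: velocity_within_def velocity_def)

lemma coords_velocity_within:
  assumes "c \<in> atlas" "\<gamma> t \<in> fst c" "t \<in> T" "continuous (at t within T) \<gamma>" "at t within T \<noteq> bot"
    and "((snd c \<circ> \<gamma>) has_vector_derivative D) (at t within T)"
  shows "coords c (\<gamma> t) (velocity_within \<gamma> t T) = D"
proof -
  have "((snd (chart_at (\<gamma> t)) \<circ> \<gamma>) has_vector_derivative of_coords c (\<gamma> t) D) (at t within T)"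
    unfolding of_coords_def by (rule vector_derivative_change_chart) (use assms chart_at in auto)
  then have "velocity_within \<gamma> t T = of_coords c (\<gamma> t) D"
    unfolding velocity_within_def by (rule vector_derivative_within[OF assms(5)])
  then show ?thesis using assms by (simp add: coords_of_coords)
qed

lemma coords_velocity:
  assumes "c \<in> atlas" "\<gamma> t \<in> fst c" "isCont \<gamma> t" "((snd c \<circ> \<gamma>) has_vector_derivative D) (at t)"
  shows "coords c (\<gamma> t) (velocity \<gamma> t) = D"
  using coords_velocity_within[of c \<gamma> t UNIV D] assms by (simp add: velocity_within_UNIV)

section \<open>Differentials of real functions in charts\<close>

lemma Ck_fun_onD: "Ck_fun_on n f UNIV \<Longrightarrow> c \<in> atlas \<Longrightarrow> Ck_on n (f \<circ> chart_inv c) (snd c ` fst c)"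
  by (auto simp: Ck_fun_on_def)

text \<open>Unlike \<open>differential\<close>, which uses the selected chart at each point, this
  keeps the chart fixed while the point moves, so that regularity in the point makes sense.\<close>

definition chart_differential :: "('m \<Rightarrow> real) \<Rightarrow> ('m, 'e) chart \<Rightarrow> 'e \<Rightarrow> 'e \<Rightarrow> real" where
  "chart_differential f c x = frechet_derivative (f \<circ> chart_inv c) (at x)"

text \<open>The squared Euclidean norm of the coordinate covector, a continuous substitute for the
  squared length of the gradient.\<close>

definition differential_sq :: "('m \<Rightarrow> real) \<Rightarrow> ('m, 'e) chart \<Rightarrow> 'e \<Rightarrow> real" where
  "differential_sq f c x = (\<Sum>i\<in>Basis. (chart_differential f c x i)\<^sup>2)"

context
  fixes f :: "'m \<Rightarrow> real" and n
  assumes f: "Ck_fun_on (Suc n) f UNIV"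
begin

lemma chart_differential:
  assumes "c \<in> atlas" "x \<in> snd c ` fst c"
  shows "((f \<circ> chart_inv c) has_derivative chart_differential f c x) (at x)"
  using Ck_fun_onD[OF f assms(1)] assms(2)
  unfolding chart_differential_def frechet_derivative_works[symmetric] by (auto simp: differentiable_def)

lemma Ck_on_chart_differential:
  assumes "c \<in> atlas"
  shows "Ck_on n (\<lambda>x. chart_differential f c x v) (snd c ` fst c)"
  by (rule Ck_on_derivative[OF Ck_fun_onD[OF f assms] chart_differential[OF assms] open_chart_range[OF assms]])

lemma continuous_on_chart_differential:
  assumes "c \<in> atlas" shows "continuous_on (snd c ` fst c) (\<lambda>x. chart_differential f c x v)"
  using Ck_on_le[OF _ Ck_on_chart_differential[OF assms], of 0] by simp

lemma isCont_differential_sq: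
  assumes "c \<in> atlas" "p \<in> fst c"
  shows "isCont (differential_sq f c) (snd c p)"
proof -
  have "continuous_on (snd c ` fst c) (differential_sq f c)"
    unfolding differential_sq_def by (intro continuous_intros continuous_on_chart_differential assms)
  then show ?thesis
    using open_chart_range assms by (simp add: continuous_on_eq_continuous_at)
qed

text \<open>Chain rule through the transition from the selected chart to \<open>c\<close>; the
  bridge from the intrinsic differential to fixed-chart estimates.\<close>

lemma differential_eq_chart_differential:
  assumes c: "c \<in> atlas" "p \<in> fst c"
  shows "differential f p v = chart_differential f c (snd c p) (coords c p v)"
proof -
  let ?d = "chart_at p"
  let ?S = "snd ?d ` (fst ?d \<inter> fst c)"
  note d = chart_at[of p]
  have "((f \<circ> chart_inv c) has_derivative chart_differential f c (snd c p)) (at ((snd c \<circ> chart_inv ?d) (snd ?d p)))"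
    using chart_differential[of c "snd c p"] c d by (simp add: chart_inv_chart)
  from diff_chain_at[OF transition_has_derivative[OF d(1) c(1) d(2) c(2)] this]
  have "((f \<circ> chart_inv c) \<circ> (snd c \<circ> chart_inv ?d) has_derivative
     (chart_differential f c (snd c p) \<circ> coords c p)) (at (snd ?d p))" unfolding coords_def .
  moreover have "open ?S" by (intro open_chart_image open_chart_dom c d)
  ultimately have "((f \<circ> chart_inv ?d) has_derivative (chart_differential f c (snd c p) \<circ> coords c p)) (at (snd ?d p))"
    by (rule has_derivative_transform_within_open) (use c d in \<open>auto simp: chart_inv_chart\<close>)
  then have "frechet_derivative (f \<circ> chart_inv ?d) (at (snd ?d p)) = chart_differential f c (snd c p) \<circ> coords c p"
    by (rule frechet_derivative_at[symmetric])
  then show ?thesis by (simp add: differential_def)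
qed

lemma linear_chart_differential:
  "c \<in> atlas \<Longrightarrow> x \<in> snd c ` fst c \<Longrightarrow> linear (chart_differential f c x)"
  using chart_differential has_derivative_linear by blast

lemma linear_differential: "linear (differential f p)"
proof -
  have "differential f p = chart_differential f (chart_at p) (snd (chart_at p) p) \<circ> coords (chart_at p) p"
    using differential_eq_chart_differential[OF chart_at] by auto
  then show ?thesis
    using chart_at by (simp add: linear_compose linear_coords linear_chart_differential)
qed

end

end

section \<open>Riemannian metric and gradient\<close>

context riemannian_manifold
begin

lemma bilinear_local_metric:
  assumes c: "c \<in> atlas" "x \<in> snd c ` fst c"
  shows "bilinear (local_metric c x)"
proof -
  have p: "chart_inv c x \<in> fst c" using chart_inv_in assms by blast
  show ?thesis
    using metric_bilinear[of "chart_inv c x"] linear_of_coords[OF c(1) p]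
    unfolding local_metric_def bilinear_def by (simp add: linear_iff)
qed

lemma local_metric_pos:
  assumes c: "c \<in> atlas" "x \<in> snd c ` fst c" and "v \<noteq> 0"
  shows "0 < local_metric c x v v"
proof -
  have p: "chart_inv c x \<in> fst c" using chart_inv_in c by blast
  have "of_coords c (chart_inv c x) v \<noteq> 0"
    using coords_of_coords[OF c(1) p, of v] linear_0[OF linear_coords[OF c(1) p]] \<open>v \<noteq> 0\<close> by auto
  then show ?thesis unfolding local_metric_def by (rule metric_pos)
qed

lemma smooth_local_metric: "c \<in> atlas \<Longrightarrow> Ck_on n (\<lambda>x. local_metric c x u v) (snd c ` fst c)"
  using metric_smooth unfolding local_metric_def smooth_on_def by blast

lemma continuous_on_local_metric: "c \<in> atlas \<Longrightarrow> continuous_on (snd c ` fst c) (\<lambda>x. local_metric c x u v)"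
  using smooth_local_metric[of c 0] by simp

lemma local_metric_coords:
  "c \<in> atlas \<Longrightarrow> p \<in> fst c \<Longrightarrow> local_metric c (snd c p) (coords c p u) (coords c p v) = g p u v"
  by (simp add: local_metric_def chart_inv_chart of_coords_coords)

lemma local_metric_comparison:
  assumes c: "c \<in> atlas" and S: "compact S" "S \<subseteq> snd c ` fst c"
  obtains m1 m2 where "0 < m1" "0 < m2"
    "\<And>x v. x \<in> S \<Longrightarrow> m1 * (norm v)\<^sup>2 \<le> local_metric c x v v"
    "\<And>x v. x \<in> S \<Longrightarrow> local_metric c x v v \<le> m2 * (norm v)\<^sup>2"
proof (rule quadratic_form_comparison[of S "local_metric c"])
  show "bilinear (local_metric c x)" if "x \<in> S" for x
    using that S(2) c by (auto intro: bilinear_local_metric)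
  show "continuous_on S (\<lambda>x. local_metric c x u v)" for u v
    by (rule continuous_on_subset[OF continuous_on_local_metric[OF c] S(2)])
  show "0 < local_metric c x v v" if "x \<in> S" "v \<noteq> 0" for x v
    using that S(2) c by (auto intro: local_metric_pos)
qed (use S that in auto)

lemma local_metric_lower_bound:
  assumes "c \<in> atlas" "compact S" "S \<subseteq> snd c ` fst c"
  obtains m where "0 < m" "\<And>x v. x \<in> S \<Longrightarrow> m * (norm v)\<^sup>2 \<le> local_metric c x v v"
  using local_metric_comparison[OF assms] by metis

lemma tangent_norm_nonneg: "0 \<le> tangent_norm p v"
  using metric_pos[of v p] bilinear_lzero[OF metric_bilinear[of p]]
  unfolding tangent_norm_def by (cases "v = 0") auto

lemma metric_nonneg: "0 \<le> g p v v"
  using metric_pos[of v p] bilinear_lzero[OF metric_bilinear[of p]] by (cases "v = 0") auto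

lemma tangent_norm_power2: "(tangent_norm p v)\<^sup>2 = g p v v"
  unfolding tangent_norm_def using metric_nonneg by simp

lemma gradient:
  assumes "Ck_fun_on (Suc n) f UNIV"
  shows "g p (gradient f p) v = differential f p v"
  using theI'[OF Riesz_bilinear[OF metric_bilinear metric_pos linear_differential[OF assms], of p]]
  unfolding gradient_def by blast

text \<open>The gradient is comparable to the Euclidean norm of the coordinate differential, which is
  evidently continuous; no regularity of the inverse metric is needed.\<close>

lemma gradient_comparison:
  assumes f: "Ck_fun_on (Suc n) f UNIV" and c: "c \<in> atlas" and S: "compact S" "S \<subseteq> snd c ` fst c"
  obtains m1 m2 where "0 < m1" "0 < m2"
    "\<And>p. p \<in> fst c \<Longrightarrow> snd c p \<in> S \<Longrightarrow>
       m1 * differential_sq f c (snd c p) \<le> g p (gradient f p) (gradient f p)"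
    "\<And>p. p \<in> fst c \<Longrightarrow> snd c p \<in> S \<Longrightarrow>
       g p (gradient f p) (gradient f p) \<le> m2 * differential_sq f c (snd c p)"
proof -
  obtain m1 m2 where m: "0 < m1" "0 < m2"
    "\<And>x v. x \<in> S \<Longrightarrow> m1 * (norm v)\<^sup>2 \<le> local_metric c x v v"
    "\<And>x v. x \<in> S \<Longrightarrow> local_metric c x v v \<le> m2 * (norm v)\<^sup>2"
    by (rule local_metric_comparison[OF c S]) (rule that)
  have *: "inverse m2 * differential_sq f c (snd c p) \<le> g p (gradient f p) (gradient f p) \<and>
     g p (gradient f p) (gradient f p) \<le> inverse m1 * differential_sq f c (snd c p)"
    if p: "p \<in> fst c" "snd c p \<in> S" for p
  proof -
    let ?x = "snd c p" and ?G = "g p (gradient f p) (gradient f p)"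
    \<comment> \<open>\<open>D\<close> is the covector of the differential and \<open>\<xi>\<close>
      the gradient in the chart; both bounds rest on the identity \<open>metric\<close> between
      them.\<close>
    define D where "D = (\<Sum>i\<in>Basis. chart_differential f c ?x i *\<^sub>R i)"
    define \<xi> where "\<xi> = coords c p (gradient f p)"
    have x: "?x \<in> snd c ` fst c" using p by auto
    have D: "chart_differential f c ?x v = D \<bullet> v" for v
      unfolding D_def by (rule linear_functional_inner[OF linear_chart_differential[OF f c x]])
    have norm_D: "(norm D)\<^sup>2 = differential_sq f c ?x"
      unfolding differential_sq_def D by (subst euclidean_inner[of D D, folded power2_norm_eq_inner]) (simp add: power2_eq_square)
    have metric: "local_metric c ?x \<xi> v = D \<bullet> v" for v
    proof -
      have "local_metric c ?x \<xi> (coords c p (of_coords c p v)) = differential f p (of_coords c p v)"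
        unfolding \<xi>_def using local_metric_coords[OF c p(1)] gradient[OF f] by simp
      then show ?thesis
        using differential_eq_chart_differential[OF f c p(1)] coords_of_coords[OF c p(1)] D by simp
    qed
    have G: "?G = local_metric c ?x \<xi> \<xi>" unfolding \<xi>_def using local_metric_coords[OF c p(1)] by simp
    have "?G = D \<bullet> \<xi>" using G metric by simp
    also have "\<dots> \<le> norm D * norm \<xi>" by (rule norm_cauchy_schwarz)
    finally have le: "?G \<le> norm D * norm \<xi>" .
    have up: "m1 * (norm \<xi>)\<^sup>2 \<le> ?G" using m(3)[OF p(2)] G by simp
    have "?G \<le> inverse m1 * (norm D)\<^sup>2"
    proof -
      have "m1 * (norm \<xi> * norm \<xi>) \<le> norm D * norm \<xi>" using up le by (simp add: power2_eq_square)
      then have "m1 * norm \<xi> \<le> norm D" by (cases "norm \<xi> = 0") (auto simp: mult.assoc[symmetric])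
      then have "norm D * norm \<xi> \<le> norm D * (inverse m1 * norm D)"
        using m(1) by (intro mult_left_mono) (auto simp: field_simps)
      then show ?thesis using le by (simp add: power2_eq_square mult_ac)
    qed
    moreover have "inverse m2 * (norm D)\<^sup>2 \<le> ?G"
    proof -
      let ?b = "local_metric c ?x"
      have bil: "bilinear ?b" by (rule bilinear_local_metric[OF c x])
      have sym: "?b u v = ?b v u" for u v by (simp add: local_metric_def metric_sym)
      \<comment> \<open>Completing the square: the form is nonnegative at \<open>?u\<close>. Given
        \<open>?b D D \<le> m2 * (norm D)\<^sup>2\<close>, the factor \<open>1 / m2\<close> is the
        optimal one and leaves \<open>(norm D)\<^sup>2 / m2\<close>.\<close>
      let ?u = "\<xi> - D /\<^sub>R m2"
      have "0 \<le> ?b ?u ?u" by (simp add: local_metric_def metric_nonneg)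
      also have "?b ?u ?u = ?b \<xi> \<xi> - 2 * inverse m2 * ?b \<xi> D + (inverse m2)\<^sup>2 * ?b D D"
        using sym[of D \<xi>] by (simp add: bilinear_lsub[OF bil] bilinear_rsub[OF bil] bilinear_lmul[OF bil]
            bilinear_rmul[OF bil] power2_eq_square algebra_simps)
      also have "?b \<xi> D = (norm D)\<^sup>2" by (simp add: metric power2_norm_eq_inner)
      finally have "0 \<le> ?G - 2 * inverse m2 * (norm D)\<^sup>2 + (inverse m2)\<^sup>2 * ?b D D" using G by simp
      moreover have "(inverse m2)\<^sup>2 * ?b D D \<le> (inverse m2)\<^sup>2 * (m2 * (norm D)\<^sup>2)"
        using m(4)[OF p(2)] by (intro mult_left_mono) auto
      moreover have "(inverse m2)\<^sup>2 * (m2 * (norm D)\<^sup>2) = inverse m2 * (norm D)\<^sup>2"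
        using m(2) by (simp add: power2_eq_square)
      ultimately show ?thesis by linarith
    qed
    ultimately show ?thesis using norm_D by simp
  qed
  show thesis
    by (rule that[of "inverse m2" "inverse m1"]) (use m * in auto)
qed

end

section \<open>Curves, length and geodesic distance\<close>

context smooth_manifold
begin

lemma C1_curve_cong:
  assumes "C1_curve \<gamma> a b" "\<And>t. t \<in> {a..b} \<Longrightarrow> \<gamma> t = \<eta> t"
  shows "C1_curve \<eta> a b"
  unfolding C1_curve_def
proof (intro conjI ballI)
  show "continuous_on {a..b} \<eta>"
    using assms(1) unfolding C1_curve_def by (elim conjE continuous_on_eq) (use assms(2) in auto)
  fix c assume "c \<in> atlas"
  then obtain D where D: "continuous_on ({a..b} \<inter> \<gamma> -` fst c) D"
    "\<And>t. t \<in> {a..b} \<inter> \<gamma> -` fst c \<Longrightarrow> ((snd c \<circ> \<gamma>) has_vector_derivative D t) (at t within {a..b})"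
    using assms(1) unfolding C1_curve_def by blast
  have eq: "{a..b} \<inter> \<eta> -` fst c = {a..b} \<inter> \<gamma> -` fst c" using assms(2) by auto
  show "\<exists>D. continuous_on ({a..b} \<inter> \<eta> -` fst c) D \<and>
        (\<forall>t\<in>{a..b} \<inter> \<eta> -` fst c. ((snd c \<circ> \<eta>) has_vector_derivative D t) (at t within {a..b}))"
    unfolding eq
  proof (intro exI[of _ D] conjI ballI D(1))
    fix t assume t: "t \<in> {a..b} \<inter> \<gamma> -` fst c"
    then show "((snd c \<circ> \<eta>) has_vector_derivative D t) (at t within {a..b})"
      using D(2)[OF t] by (rule_tac has_vector_derivative_transform[of t _ _ "snd c \<circ> \<gamma>"]) (auto simp: assms(2))
  qed
qed

lemma C1_curve_affine:
  assumes C1: "C1_curve \<gamma> (m * a + k) (m * b + k)" and "m > 0"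
  shows "C1_curve (\<lambda>t. \<gamma> (m * t + k)) a b"
  unfolding C1_curve_def
proof (intro conjI ballI)
  let ?f = "\<lambda>t. m * t + k"
  have img: "?f ` {a..b} \<subseteq> {m * a + k..m * b + k}" using \<open>m > 0\<close> by auto
  show "continuous_on {a..b} (\<lambda>t. \<gamma> (?f t))"
    using C1 img unfolding C1_curve_def by (auto intro!: continuous_on_compose2[of _ \<gamma> _ ?f] continuous_intros)
  fix c assume "c \<in> atlas"
  then obtain D where D: "continuous_on ({m * a + k..m * b + k} \<inter> \<gamma> -` fst c) D"
    "\<And>t. t \<in> {m * a + k..m * b + k} \<inter> \<gamma> -` fst c \<Longrightarrow>
       ((snd c \<circ> \<gamma>) has_vector_derivative D t) (at t within {m * a + k..m * b + k})"
    using C1 unfolding C1_curve_def by blast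
  show "\<exists>D. continuous_on ({a..b} \<inter> (\<lambda>t. \<gamma> (?f t)) -` fst c) D \<and>
     (\<forall>t\<in>{a..b} \<inter> (\<lambda>t. \<gamma> (?f t)) -` fst c.
        ((snd c \<circ> (\<lambda>t. \<gamma> (?f t))) has_vector_derivative D t) (at t within {a..b}))"
  proof (intro exI[of _ "\<lambda>t. m *\<^sub>R D (?f t)"] conjI ballI)
    show "continuous_on ({a..b} \<inter> (\<lambda>t. \<gamma> (?f t)) -` fst c) (\<lambda>t. m *\<^sub>R D (?f t))"
      using img by (intro continuous_intros continuous_on_compose2[OF D(1), of _ ?f]) auto
    fix t assume t: "t \<in> {a..b} \<inter> (\<lambda>t. \<gamma> (?f t)) -` fst c"
    have "((snd c \<circ> \<gamma>) has_vector_derivative D (?f t)) (at (?f t) within ?f ` {a..b})"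
      by (rule has_vector_derivative_within_subset[OF D(2) img]) (use t \<open>m > 0\<close> in auto)
    moreover have "(?f has_vector_derivative m) (at t within {a..b})"
      by (auto intro!: derivative_eq_intros)
    ultimately have "((snd c \<circ> \<gamma>) \<circ> ?f has_vector_derivative m *\<^sub>R D (?f t)) (at t within {a..b})"
      by (rule vector_diff_chain_within[rotated])
    then show "((snd c \<circ> (\<lambda>t. \<gamma> (?f t))) has_vector_derivative m *\<^sub>R D (?f t)) (at t within {a..b})"
      by (simp add: comp_def)
  qed
qed

lemma piecewise_C1_curve_join:
  assumes "piecewise_C1_curve \<gamma> 0 1" "piecewise_C1_curve \<eta> 0 1" "\<gamma> 1 = \<eta> 0"
  shows "piecewise_C1_curve (\<gamma> +++ \<eta>) 0 1"
proof -
  obtain S where S: "finite S" "\<And>c d. 0 \<le> c \<Longrightarrow> c < d \<Longrightarrow> d \<le> 1 \<Longrightarrow> {c<..<d} \<inter> S = {} \<Longrightarrow> C1_curve \<gamma> c d"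
    using assms(1) unfolding piecewise_C1_curve_def by blast
  obtain S' where S': "finite S'" "\<And>c d. 0 \<le> c \<Longrightarrow> c < d \<Longrightarrow> d \<le> 1 \<Longrightarrow> {c<..<d} \<inter> S' = {} \<Longrightarrow> C1_curve \<eta> c d"
    using assms(2) unfolding piecewise_C1_curve_def by blast
  \<comment> \<open>The break points of both curves, rescaled to the two halves of the unit
    interval, together with the junction.\<close>
  let ?T = "(\<lambda>s. s / 2) ` S \<union> (\<lambda>s. (s + 1) / 2) ` S' \<union> {1 / 2}"
  have "path \<gamma>" "path \<eta>" "pathfinish \<gamma> = pathstart \<eta>"
    using assms by (auto simp: path_def piecewise_C1_curve_def pathfinish_def pathstart_def)
  then have "path (\<gamma> +++ \<eta>)" by (rule path_join_imp)
  moreover have "C1_curve (\<gamma> +++ \<eta>) c d" if cd: "0 \<le> c" "c < d" "d \<le> 1" "{c<..<d} \<inter> ?T = {}" for c d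
  proof (cases "d \<le> 1 / 2")
    case True
    have "{2 * c<..<2 * d} \<inter> S = {}"
    proof (intro equals0I)
      fix s assume "s \<in> {2 * c<..<2 * d} \<inter> S"
      then have "s / 2 \<in> {c<..<d} \<inter> ?T" by auto
      then show False using cd(4) by blast
    qed
    then have "C1_curve \<gamma> (2 * c + 0) (2 * d + 0)" using cd True by (intro S(2)) auto
    then have "C1_curve (\<lambda>t. \<gamma> (2 * t + 0)) c d" by (rule C1_curve_affine) simp
    then show ?thesis by (rule C1_curve_cong) (use True in \<open>auto simp: joinpaths_def\<close>)
  next
    case False
    have "1 / 2 \<notin> {c<..<d}" using cd(4) by blast
    then have c: "1 / 2 \<le> c" using False by auto
    have "{2 * c - 1<..<2 * d - 1} \<inter> S' = {}"
    proof (intro equals0I)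
      fix s assume "s \<in> {2 * c - 1<..<2 * d - 1} \<inter> S'"
      then have "(s + 1) / 2 \<in> {c<..<d} \<inter> ?T" by auto
      then show False using cd(4) by blast
    qed
    then have "C1_curve \<eta> (2 * c + - 1) (2 * d + - 1)" using cd c by (intro S'(2)) auto
    then have "C1_curve (\<lambda>t. \<eta> (2 * t + - 1)) c d" by (rule C1_curve_affine) simp
    then show ?thesis
    proof (rule C1_curve_cong)
      fix t assume "t \<in> {c..d}"
      then show "\<eta> (2 * t + - 1) = (\<gamma> +++ \<eta>) t"
      proof (cases "t = 1 / 2")
        case True
        show ?thesis using assms(3) unfolding True by (simp add: joinpaths_def)
      next
        case False
        then show ?thesis using c \<open>t \<in> {c..d}\<close> by (simp add: joinpaths_def)
      qed
    qed
  qed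
  ultimately show ?thesis
    unfolding piecewise_C1_curve_def path_def
    using S(1) S'(1) by (intro conjI exI[of _ ?T]) auto
qed

text \<open>In the chart \<open>c\<close> the derivative is the constant \<open>y - x\<close>; in
  any other chart it is the image of \<open>y - x\<close> under the transition derivative, which is
  continuous along the curve.\<close>

lemma C1_curve_chart_segment:
  assumes c: "c \<in> atlas" and sub: "closed_segment x y \<subseteq> snd c ` fst c" and ab: "0 \<le> a" "b \<le> 1"
  shows "C1_curve (\<lambda>t. chart_inv c (linepath x y t)) a b"
proof -
  let ?\<gamma> = "\<lambda>t. chart_inv c (linepath x y t)"
  have in_range: "linepath x y t \<in> snd c ` fst c" if "t \<in> {a..b}" for t
    using that ab sub linepath_in_path[of t x y] by auto
  have cont: "continuous_on {a..b} ?\<gamma>"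
    by (rule continuous_on_compose2[OF continuous_on_chart_inv[OF c], of _ "linepath x y"])
      (use in_range in \<open>auto intro: continuous_intros\<close>)
  moreover have "\<exists>D. continuous_on ({a..b} \<inter> ?\<gamma> -` fst d) D \<and>
      (\<forall>t\<in>{a..b} \<inter> ?\<gamma> -` fst d. ((snd d \<circ> ?\<gamma>) has_vector_derivative D t) (at t within {a..b}))"
    if d: "d \<in> atlas" for d
  proof (intro exI[of _ "\<lambda>t. transition_deriv c d (?\<gamma> t) (y - x)"] conjI ballI)
    have "linepath x y t \<in> snd c ` (fst c \<inter> fst d)" if "t \<in> {a..b} \<inter> ?\<gamma> -` fst d" for t
      using that chart_inv_in[OF c in_range, of t] chart_chart_inv[OF c in_range, of t]
      by (intro image_eqI[of _ _ "?\<gamma> t"]) auto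
    then show "continuous_on ({a..b} \<inter> ?\<gamma> -` fst d) (\<lambda>t. transition_deriv c d (?\<gamma> t) (y - x))"
      by (intro continuous_on_compose2[OF continuous_on_transition_deriv[OF c d], of _ "linepath x y"])
        (auto intro: continuous_intros)
    fix t assume t: "t \<in> {a..b} \<inter> ?\<gamma> -` fst d"
    have "((snd c \<circ> ?\<gamma>) has_vector_derivative (y - x)) (at t within {a..b})"
      by (rule has_vector_derivative_transform[OF _ _ has_vector_derivative_linepath_within])
        (use t chart_chart_inv[OF c in_range] in auto)
    then show "((snd d \<circ> ?\<gamma>) has_vector_derivative transition_deriv c d (?\<gamma> t) (y - x)) (at t within {a..b})"
      using t cont chart_inv_in[OF c in_range[of t]]
      by (intro vector_derivative_change_chart c d) (auto simp: continuous_on_eq_continuous_within)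
  qed
  ultimately show ?thesis by (simp add: C1_curve_def)
qed

abbreviation C1_joined :: "'m \<Rightarrow> 'm \<Rightarrow> bool" where
  "C1_joined p q \<equiv> \<exists>\<gamma>. piecewise_C1_curve \<gamma> 0 1 \<and> \<gamma> 0 = p \<and> \<gamma> 1 = q"

lemma locally_C1_connected:
  obtains W where "open W" "p \<in> W"
    "\<And>q q'. q \<in> W \<Longrightarrow> q' \<in> W \<Longrightarrow> C1_joined q q'"
proof -
  let ?c = "chart_at p"
  note c = chart_at[of p]
  obtain r where r: "r > 0" "cball (snd ?c p) r \<subseteq> snd ?c ` (fst ?c \<inter> UNIV)"
    by (rule chart_nhd[OF c, of UNIV]) auto
  let ?W = "fst ?c \<inter> snd ?c -` ball (snd ?c p) r"
  show thesis
  proof (rule that[of ?W])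
    show "open ?W" by (rule open_chart_vimage[OF c(1)]) simp
    show "p \<in> ?W" using c r by simp
    fix q q' assume q: "q \<in> ?W" "q' \<in> ?W"
    let ?\<gamma> = "\<lambda>t. chart_inv ?c (linepath (snd ?c q) (snd ?c q') t)"
    have "closed_segment (snd ?c q) (snd ?c q') \<subseteq> cball (snd ?c p) r"
      using q by (intro closed_segment_subset) auto
    then have seg: "closed_segment (snd ?c q) (snd ?c q') \<subseteq> snd ?c ` fst ?c" using r(2) by auto
    have C1: "C1_curve ?\<gamma> a b" if "0 \<le> a" "b \<le> 1" for a b
      by (rule C1_curve_chart_segment[OF c(1) seg that])
    have "piecewise_C1_curve ?\<gamma> 0 1"
      unfolding piecewise_C1_curve_def using C1[of 0 1] C1 by (auto simp: C1_curve_def[of _ 0 1])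
    moreover have "?\<gamma> 0 = q" "?\<gamma> 1 = q'"
      using q c by (auto simp: linepath_def chart_inv_chart)
    ultimately show "C1_joined q q'" by blast
  qed
qed

text \<open>Any two points of a small coordinate ball are joined by a coordinate segment, so the
  points reachable from \<open>p\<close> form an open set, and so do the others. The infimum in
  \<open>geodesic_dist\<close> thus ranges over a nonempty set.\<close>

lemma C1_connected:
  assumes "connected (UNIV :: 'm set)"
  shows "C1_joined p q"
proof -
  define U where "U = {q. C1_joined p q}"
  have extend: "q' \<in> U" if qq': "q \<in> U" "C1_joined q q'" for q q'
  proof -
    obtain \<gamma> \<eta> where "piecewise_C1_curve \<gamma> 0 1" "\<gamma> 0 = p" "\<gamma> 1 = q"
      "piecewise_C1_curve \<eta> 0 1" "\<eta> 0 = q" "\<eta> 1 = q'" using qq' unfolding U_def by blast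
    then show ?thesis
      unfolding U_def by (auto intro!: exI[of _ "\<gamma> +++ \<eta>"] piecewise_C1_curve_join simp: joinpaths_def)
  qed
  have "open U"
  proof (subst open_subopen, intro ballI)
    fix q assume "q \<in> U"
    obtain W where "open W" "q \<in> W"
      "\<And>q1 q2. q1 \<in> W \<Longrightarrow> q2 \<in> W \<Longrightarrow> C1_joined q1 q2"
      by (rule locally_C1_connected[of q]) (rule that)
    then show "\<exists>T. open T \<and> q \<in> T \<and> T \<subseteq> U" using extend \<open>q \<in> U\<close> by (intro exI[of _ W]) blast
  qed
  moreover have "open (- U)"
  proof (subst open_subopen, intro ballI)
    fix q assume "q \<in> - U"
    obtain W where "open W" "q \<in> W"
      "\<And>q1 q2. q1 \<in> W \<Longrightarrow> q2 \<in> W \<Longrightarrow> C1_joined q1 q2"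
      by (rule locally_C1_connected[of q]) (rule that)
    then show "\<exists>T. open T \<and> q \<in> T \<and> T \<subseteq> - U" using extend \<open>q \<in> - U\<close> by (intro exI[of _ W]) blast
  qed
  moreover have "p \<in> U"
  proof -
    obtain W where "p \<in> W"
      "\<And>q1 q2. q1 \<in> W \<Longrightarrow> q2 \<in> W \<Longrightarrow> C1_joined q1 q2"
      by (rule locally_C1_connected[of p]) (rule that)
    then show ?thesis by (auto simp: U_def)
  qed
  ultimately have "U = UNIV"
    using assms unfolding connected_clopen by (auto simp: closed_def)
  then show ?thesis by (auto simp: U_def)
qed

text \<open>Away from end and break points the derivative within a small closed interval is a
  genuine two-sided one, so \<open>velocity\<close> has its intended value there.\<close>

lemma piecewise_C1_curve_derivative:
  assumes "piecewise_C1_curve \<gamma> a b"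
  obtains S where "finite S"
    "\<And>c t. c \<in> atlas \<Longrightarrow> t \<in> {a<..<b} - S \<Longrightarrow> \<gamma> t \<in> fst c \<Longrightarrow>
       ((snd c \<circ> \<gamma>) has_vector_derivative coords c (\<gamma> t) (velocity \<gamma> t)) (at t)"
proof -
  obtain S where S: "finite S" "\<And>c d. a \<le> c \<Longrightarrow> c < d \<Longrightarrow> d \<le> b \<Longrightarrow> {c<..<d} \<inter> S = {} \<Longrightarrow> C1_curve \<gamma> c d"
    using assms unfolding piecewise_C1_curve_def by blast
  show thesis
  proof (rule that[OF S(1)])
    fix c t assume c: "c \<in> atlas" "\<gamma> t \<in> fst c" and t: "t \<in> {a<..<b} - S"
    have "open ({a<..<b} - S)" using S(1) by (intro open_Diff finite_imp_closed) auto
    then obtain e where e: "e > 0" "cball t e \<subseteq> {a<..<b} - S" using t by (meson open_contains_cball)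
    then have sub: "{t - e..t + e} \<subseteq> {a<..<b} - S" by (simp add: cball_eq_atLeastAtMost)
    have "t - e \<in> {a<..<b}" "t + e \<in> {a<..<b}"
      using subsetD[OF sub, of "t - e"] subsetD[OF sub, of "t + e"] e(1) by auto
    moreover have "{t - e<..<t + e} \<inter> S = {}"
      using sub greaterThanLessThan_subseteq_atLeastAtMost_iff[of "t - e" "t + e" "t - e" "t + e"] by blast
    ultimately have C1: "C1_curve \<gamma> (t - e) (t + e)" using e(1) by (intro S(2)) auto
    have at: "at t within {t - e..t + e} = at t" using e(1) by (intro at_within_interior) auto
    obtain D where "((snd c \<circ> \<gamma>) has_vector_derivative D) (at t within {t - e..t + e})"
      using C1 c e(1) unfolding C1_curve_def by force
    then have D: "((snd c \<circ> \<gamma>) has_vector_derivative D) (at t)" by (simp add: at)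
    have "continuous (at t within {t - e..t + e}) \<gamma>"
      using C1 e(1) unfolding C1_curve_def by (auto simp: continuous_on_eq_continuous_within)
    then have "isCont \<gamma> t" by (simp add: at)
    from coords_velocity[OF c this D] D
    show "((snd c \<circ> \<gamma>) has_vector_derivative coords c (\<gamma> t) (velocity \<gamma> t)) (at t)" by simp
  qed
qed

end

context riemannian_manifold
begin

lemma tangent_norm_coords:
  "c \<in> atlas \<Longrightarrow> p \<in> fst c \<Longrightarrow> tangent_norm p v = sqrt (local_metric c (snd c p) (coords c p v) (coords c p v))"
  by (simp add: tangent_norm_def local_metric_coords)

definition speed_within :: "(real \<Rightarrow> 'm) \<Rightarrow> real set \<Rightarrow> real \<Rightarrow> real" where
  "speed_within \<gamma> T t = tangent_norm (\<gamma> t) (velocity_within \<gamma> t T)"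

text \<open>The selected chart changes along the curve, so continuity is checked at one
  \<open>t0\<close> at a time, with the speed expressed in the chart selected at
  \<open>\<gamma> t0\<close>.\<close>

lemma continuous_on_speed_within:
  assumes C1: "C1_curve \<gamma> a b" and "a < b"
  shows "continuous_on {a..b} (speed_within \<gamma> {a..b})"
  unfolding continuous_on_eq_continuous_within
proof
  fix t0 assume t0: "t0 \<in> {a..b}"
  let ?c = "chart_at (\<gamma> t0)"
  let ?T = "{a..b} \<inter> \<gamma> -` fst ?c"
  note c = chart_at[of "\<gamma> t0"]
  have cont: "continuous_on {a..b} \<gamma>" using C1 by (simp add: C1_curve_def)
  obtain D where D: "continuous_on ?T D"
    "\<And>t. t \<in> ?T \<Longrightarrow> ((snd ?c \<circ> \<gamma>) has_vector_derivative D t) (at t within {a..b})"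
    using C1 c(1) unfolding C1_curve_def by blast
  have "continuous_on ?T (\<lambda>t. sqrt (local_metric ?c (snd ?c (\<gamma> t)) (D t) (D t)))"
  proof (rule continuous_on_real_sqrt, rule continuous_on_bilinear[of "snd ?c ` fst ?c" "local_metric ?c"])
    show "continuous_on ?T (\<lambda>t. snd ?c (\<gamma> t))"
      by (rule continuous_on_compose2[OF continuous_on_chart[OF c(1)] continuous_on_subset[OF cont]]) auto
  qed (use c D(1) in \<open>auto intro: bilinear_local_metric continuous_on_local_metric\<close>)
  then have "continuous_on ?T (speed_within \<gamma> {a..b})"
  proof (rule continuous_on_eq)
    fix t assume t: "t \<in> ?T"
    have "at t within {a..b} \<noteq> bot" using t \<open>a < b\<close> by (simp add: trivial_limit_within islimpt_Icc)
    then have "coords ?c (\<gamma> t) (velocity_within \<gamma> t {a..b}) = D t"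
      using t cont c D(2)[OF t] by (intro coords_velocity_within) (auto simp: continuous_on_eq_continuous_within)
    then show "sqrt (local_metric ?c (snd ?c (\<gamma> t)) (D t) (D t)) = speed_within \<gamma> {a..b} t"
      using t c by (simp add: speed_within_def tangent_norm_coords)
  qed
  then have 1: "continuous (at t0 within ?T) (speed_within \<gamma> {a..b})"
    using t0 c(2) by (auto simp: continuous_on_eq_continuous_within)
  \<comment> \<open>\<open>?T\<close> is relatively open in \<open>{a..b}\<close>, so restricting to
    it does not change the filter at \<open>t0\<close>.\<close>
  obtain O' where O': "open O'" "O' \<inter> {a..b} = \<gamma> -` fst ?c \<inter> {a..b}"
    using cont open_chart_dom[OF c(1)] unfolding continuous_on_open_invariant by blast
  have "at t0 within ?T = at t0 within {a..b}"
    by (rule at_within_nhd[of t0 O']) (use O' t0 c in auto)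
  with 1 show "continuous (at t0 within {a..b}) (speed_within \<gamma> {a..b})"
    by simp
qed

text \<open>Without integrability the length would be the junk value \<open>0\<close> of the integral.\<close>

lemma speed_integrable:
  assumes "piecewise_C1_curve \<gamma> a b"
  shows "(\<lambda>t. tangent_norm (\<gamma> t) (velocity \<gamma> t)) integrable_on {a..b}"
proof -
  obtain S where S: "finite S" "\<And>c d. a \<le> c \<Longrightarrow> c < d \<Longrightarrow> d \<le> b \<Longrightarrow> {c<..<d} \<inter> S = {} \<Longrightarrow> C1_curve \<gamma> c d"
    using assms unfolding piecewise_C1_curve_def by blast
  let ?s = "\<lambda>t. tangent_norm (\<gamma> t) (velocity \<gamma> t)"
  have "?s integrable_on {c..d}" if "a \<le> c" "c \<le> d" "d \<le> b" for c d
    using that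
  \<comment> \<open>Splitting at an inner break point lowers the number of inner break points of
    both parts.\<close>
  proof (induction "card (S \<inter> {c<..<d})" arbitrary: c d rule: less_induct)
    case less
    show ?case
    proof (cases "c < d \<and> S \<inter> {c<..<d} \<noteq> {}")
      case True
      then obtain s where s: "s \<in> S" "c < s" "s < d" by auto
      have "S \<inter> {c<..<s} \<subset> S \<inter> {c<..<d}" "S \<inter> {s<..<d} \<subset> S \<inter> {c<..<d}" using s by auto
      then have "card (S \<inter> {c<..<s}) < card (S \<inter> {c<..<d})" "card (S \<inter> {s<..<d}) < card (S \<inter> {c<..<d})"
        using S(1) by (auto intro: psubset_card_mono)
      then have "?s integrable_on {c..s}" "?s integrable_on {s..d}"
        using less s by auto
      then show ?thesis using s by (intro Henstock_Kurzweil_Integration.integrable_combine[of c s d]) auto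
    next
      case no_break: False
      show ?thesis
      proof (cases "c < d")
        case True
        then have "C1_curve \<gamma> c d" using less no_break by (intro S(2)) auto
        then have "speed_within \<gamma> {c..d} integrable_on {c..d}"
          using True by (intro integrable_continuous_interval continuous_on_speed_within)
        then show ?thesis
        \<comment> \<open>At the end points the two-sided \<open>velocity\<close> may differ from
          the one-sided one; two points do not affect integrability.\<close>
        proof (rule integrable_spike_finite[of "{c, d}", rotated 2])
          fix t assume "t \<in> {c..d} - {c, d}"
          then have "at t within {c..d} = at t" by (intro at_within_interior) auto
          then show "?s t = speed_within \<gamma> {c..d} t"
            by (simp add: speed_within_def velocity_within_def velocity_def)
        qed simp
      next
        case False
        then have "c = d" using less by simp
        then show ?thesis using integrable_on_refl[of ?s d] by simp
      qed
    qed
  qed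
  then show ?thesis by (cases "a \<le> b") auto
qed

text \<open>The coordinates obey the fundamental theorem of calculus, and \<open>sqrt m\<close>
  times the Euclidean speed is at most the Riemannian speed. The part before \<open>\<tau>\<close>,
  possibly outside the chart, contributes a nonnegative length.\<close>

lemma curve_length_ge_chart_displacement:
  assumes c: "c \<in> atlas" and \<gamma>: "piecewise_C1_curve \<gamma> 0 1" and \<tau>: "0 \<le> \<tau>" "\<tau> \<le> 1"
    and B: "\<And>t. t \<in> {\<tau>..1} \<Longrightarrow> \<gamma> t \<in> fst c \<and> snd c (\<gamma> t) \<in> B"
    and m: "0 < m" "\<And>x v. x \<in> B \<Longrightarrow> m * (norm v)\<^sup>2 \<le> local_metric c x v v"
  shows "sqrt m * norm (snd c (\<gamma> 1) - snd c (\<gamma> \<tau>)) \<le> curve_length \<gamma> 0 1"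
proof -
  let ?s = "\<lambda>t. tangent_norm (\<gamma> t) (velocity \<gamma> t)"
  obtain S where S: "finite S" "\<And>t. t \<in> {0<..<1} - S \<Longrightarrow> \<gamma> t \<in> fst c \<Longrightarrow>
       ((snd c \<circ> \<gamma>) has_vector_derivative coords c (\<gamma> t) (velocity \<gamma> t)) (at t)"
    using piecewise_C1_curve_derivative[OF \<gamma>] c by metis
  define D where "D t = coords c (\<gamma> t) (velocity \<gamma> t)" for t
  have cont: "continuous_on {\<tau>..1} \<gamma>"
    using \<gamma> \<tau> by (auto simp: piecewise_C1_curve_def intro: continuous_on_subset)
  have FTC: "(D has_integral ((snd c \<circ> \<gamma>) 1 - (snd c \<circ> \<gamma>) \<tau>)) {\<tau>..1}"
  proof (rule fundamental_theorem_of_calculus_interior_strong[OF S(1) \<tau>(2)])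
    show "continuous_on {\<tau>..1} (snd c \<circ> \<gamma>)"
      using B by (intro continuous_on_compose cont continuous_on_subset[OF continuous_on_chart[OF c]]) auto
    fix t assume "t \<in> {\<tau><..<1} - S"
    then show "((snd c \<circ> \<gamma>) has_vector_derivative D t) (at t)"
      unfolding D_def using B[of t] \<tau> by (intro S(2)) auto
  qed
  have s_int: "?s integrable_on {0..1}" by (rule speed_integrable[OF \<gamma>])
  then have s_int': "?s integrable_on {\<tau>..1}"
    by (rule integrable_on_subinterval) (use \<tau> in auto)
  have "norm (integral {\<tau>..1} (\<lambda>t. sqrt m *\<^sub>R D t)) \<le> integral {\<tau>..1} ?s"
  proof (rule integral_norm_bound_integral)
    show "(\<lambda>t. sqrt m *\<^sub>R D t) integrable_on {\<tau>..1}" using FTC by (intro integrable_cmul) blast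
    fix t assume "t \<in> {\<tau>..1}"
    then have t: "\<gamma> t \<in> fst c" "snd c (\<gamma> t) \<in> B" using B by auto
    have "norm (sqrt m *\<^sub>R D t) = sqrt (m * (norm (D t))\<^sup>2)" using m(1) by (simp add: real_sqrt_mult)
    also have "\<dots> \<le> ?s t"
      unfolding tangent_norm_coords[OF c t(1)] D_def by (intro real_sqrt_le_mono m(2) t)
    finally show "norm (sqrt m *\<^sub>R D t) \<le> ?s t" .
  qed (rule s_int')
  also have "integral {\<tau>..1} ?s \<le> curve_length \<gamma> 0 1"
    unfolding curve_length_def
    by (rule integral_subset_le[OF _ s_int' s_int]) (use \<tau> tangent_norm_nonneg in auto)
  finally show ?thesis
    using m(1) integral_unique[OF FTC] by simp
qed

text \<open>A curve from \<open>p\<close> to \<open>q\<close> either stays in the chart ball or crosses an annulus after its last exit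
  from the ball. Connectedness ensures that the infimum is not taken over the empty set.\<close>

lemma geodesic_dist_lower_bound:
  assumes conn: "connected (UNIV :: 'm set)" and c: "c \<in> atlas" "p0 \<in> fst c"
    and r: "r > 0" "cball (snd c p0) r \<subseteq> snd c ` fst c"
  obtains \<kappa> where "\<kappa> > 0"
    "\<And>p q. q \<in> fst c \<Longrightarrow> snd c q \<in> cball (snd c p0) (r / 2) \<Longrightarrow> geodesic_dist p q < \<kappa> * (r / 2) \<Longrightarrow>
       p \<in> fst c \<and> \<kappa> * norm (snd c q - snd c p) \<le> geodesic_dist p q"
proof -
  let ?B = "cball (snd c p0) r"
  let ?U = "fst c \<inter> snd c -` ball (snd c p0) r"
  obtain m where m: "0 < m" "\<And>x v. x \<in> ?B \<Longrightarrow> m * (norm v)\<^sup>2 \<le> local_metric c x v v"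
    by (rule local_metric_lower_bound[OF c(1) compact_cball r(2)]) (rule that)
  define \<kappa> where "\<kappa> = sqrt m"
  have U: "open ?U" by (rule open_chart_vimage[OF c(1)]) simp
  \<comment> \<open>Closedness in the whole manifold, from compactness and the Hausdorff property,
    later keeps the limit point \<open>\<gamma> \<tau>\<close> inside the chart.\<close>
  have K: "closed (chart_inv c ` ?B)"
    using continuous_on_subset[OF continuous_on_chart_inv[OF c(1)] r(2)]
    by (intro compact_imp_closed compact_continuous_image) auto
  have K_sub: "p \<in> fst c \<and> snd c p \<in> ?B" if p: "p \<in> chart_inv c ` ?B" for p
  proof -
    obtain x where x: "x \<in> ?B" "p = chart_inv c x" using p by blast
    then have "x \<in> snd c ` fst c" using r(2) by blast
    then show ?thesis using chart_inv_in[OF c(1)] chart_chart_inv[OF c(1)] x by metis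
  qed
  have sub_K: "p \<in> chart_inv c ` ?B" if "p \<in> ?U" for p
  proof (rule image_eqI)
    show "p = chart_inv c (snd c p)" using chart_inv_chart[OF c(1), of p] that by simp
    show "snd c p \<in> ?B" using that by auto
  qed
  have key: "\<gamma> 0 \<in> fst c \<and> \<kappa> * norm (snd c (\<gamma> 1) - snd c (\<gamma> 0)) \<le> curve_length \<gamma> 0 1 \<or>
      \<kappa> * (r / 2) \<le> curve_length \<gamma> 0 1"
    if \<gamma>: "piecewise_C1_curve \<gamma> 0 1" and q: "\<gamma> 1 \<in> fst c" "snd c (\<gamma> 1) \<in> cball (snd c p0) (r / 2)" for \<gamma>
  proof (cases "\<gamma> ` {0..1} \<subseteq> ?U")
    case True
    have B: "\<gamma> t \<in> fst c \<and> snd c (\<gamma> t) \<in> ?B" if "t \<in> {0..1}" for t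
    proof -
      have "\<gamma> t \<in> ?U" using True that by blast
      then show ?thesis by auto
    qed
    have "\<kappa> * norm (snd c (\<gamma> 1) - snd c (\<gamma> 0)) \<le> curve_length \<gamma> 0 1"
      unfolding \<kappa>_def by (rule curve_length_ge_chart_displacement[OF c(1) \<gamma> _ _ B m]) auto
    then show ?thesis using B[of 0] by auto
  next
    case False
    have cont: "continuous_on {0..1} \<gamma>" using \<gamma> by (simp add: piecewise_C1_curve_def)
    \<comment> \<open>The times spent outside the open ball; the supremum is attained and is the
      last such time.\<close>
    define Z where "Z = {0..1} \<inter> \<gamma> -` (- ?U)"
    have "closed Z" unfolding Z_def
      using U by (intro continuous_closed_preimage[OF cont]) (auto simp: closed_def)
    moreover have "Z \<noteq> {}" "bdd_above Z" using False by (auto simp: Z_def)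
    ultimately have \<tau>: "Sup Z \<in> Z" by (rule closed_contains_Sup[rotated 2])
    define \<tau> where "\<tau> = Sup Z"
    have "\<gamma> 1 \<in> ?U" using q r(1) by auto
    then have \<tau>01: "0 \<le> \<tau>" "\<tau> < 1" using \<tau> unfolding \<tau>_def[symmetric] by (auto simp: Z_def less_le)
    have after: "\<gamma> t \<in> ?U" if "t \<in> {\<tau><..1}" for t
    proof (rule ccontr)
      assume "\<gamma> t \<notin> ?U"
      then have "t \<in> Z" using that \<tau>01 by (auto simp: Z_def)
      then have "t \<le> \<tau>" unfolding \<tau>_def by (intro cSup_upper \<open>bdd_above Z\<close>)
      then show False using that by simp
    qed
    have "closed ({0..1} \<inter> \<gamma> -` (chart_inv c ` ?B))"
      by (intro continuous_closed_preimage[OF cont] K) simp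
    moreover have "{\<tau><..1} \<subseteq> {0..1} \<inter> \<gamma> -` (chart_inv c ` ?B)" using after sub_K \<tau>01 by fastforce
    ultimately have "closure {\<tau><..1} \<subseteq> {0..1} \<inter> \<gamma> -` (chart_inv c ` ?B)" by (intro closure_minimal)
    then have in_B: "\<gamma> t \<in> fst c \<and> snd c (\<gamma> t) \<in> ?B" if "t \<in> {\<tau>..1}" for t
      using that \<tau>01 K_sub by (auto simp: closure_greaterThanAtMost)
    have "\<kappa> * norm (snd c (\<gamma> 1) - snd c (\<gamma> \<tau>)) \<le> curve_length \<gamma> 0 1"
      unfolding \<kappa>_def
      by (rule curve_length_ge_chart_displacement[OF c(1) \<gamma> \<tau>01(1) less_imp_le[OF \<tau>01(2)] in_B m])
    \<comment> \<open>The coordinate distance from the centre is at least \<open>r\<close> at time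
      \<open>\<tau>\<close> and at most \<open>r / 2\<close> at time 1.\<close>
    moreover have "\<kappa> * (r / 2) \<le> \<kappa> * norm (snd c (\<gamma> 1) - snd c (\<gamma> \<tau>))"
    proof -
      have "\<gamma> \<tau> \<notin> ?U" using \<tau> unfolding \<tau>_def[symmetric] by (simp add: Z_def)
      then have "r \<le> dist (snd c p0) (snd c (\<gamma> \<tau>))" using in_B[of \<tau>] \<tau>01 by auto
      then have "r / 2 \<le> norm (snd c (\<gamma> 1) - snd c (\<gamma> \<tau>))"
        using q(2) dist_triangle[of "snd c p0" "snd c (\<gamma> \<tau>)" "snd c (\<gamma> 1)"] by (simp add: dist_norm)
      then show ?thesis
        using m(1) by (intro mult_left_mono) (auto simp: \<kappa>_def)
    qed
    ultimately show ?thesis by linarith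
  qed
  show thesis
  proof (rule that)
    show "\<kappa> > 0" using m(1) by (simp add: \<kappa>_def)
    fix p q assume q: "q \<in> fst c" "snd c q \<in> cball (snd c p0) (r / 2)" and lt: "geodesic_dist p q < \<kappa> * (r / 2)"
    let ?L = "{curve_length \<gamma> 0 1 | \<gamma>. piecewise_C1_curve \<gamma> 0 1 \<and> \<gamma> 0 = p \<and> \<gamma> 1 = q}"
    have ne: "?L \<noteq> {}" using C1_connected[OF conn, of p q] by blast
    have key': "p \<in> fst c \<and> \<kappa> * norm (snd c q - snd c p) \<le> l \<or> \<kappa> * (r / 2) \<le> l" if "l \<in> ?L" for l
      using that key q by blast
    have "\<exists>l\<in>?L. l < \<kappa> * (r / 2)"
      using lt cInf_lessD[OF ne] unfolding geodesic_dist_def by blast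
    then have p: "p \<in> fst c" using key' by fastforce
    have "min (\<kappa> * norm (snd c q - snd c p)) (\<kappa> * (r / 2)) \<le> geodesic_dist p q"
      unfolding geodesic_dist_def by (rule cInf_greatest[OF ne]) (use key' in fastforce)
    then show "p \<in> fst c \<and> \<kappa> * norm (snd c q - snd c p) \<le> geodesic_dist p q"
      using p lt by auto
  qed
qed

end

section \<open>Uniqueness of geodesics\<close>

text \<open>Boundedness is included because it makes products of Lipschitz functions Lipschitz. The
  class is then closed under the polynomial operations that build \<open>christoffel1\<close> from
  the derivatives of the metric.\<close>

definition bounded_Lipschitz_on :: "('c::metric_space \<Rightarrow> real) \<Rightarrow> 'c set \<Rightarrow> bool" where
  "bounded_Lipschitz_on f S \<longleftrightarrow>
     (\<exists>L\<ge>0. \<forall>x\<in>S. \<bar>f x\<bar> \<le> L \<and> (\<forall>y\<in>S. \<bar>f x - f y\<bar> \<le> L * dist x y))"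

lemma bounded_Lipschitz_onI:
  assumes "\<And>x. x \<in> S \<Longrightarrow> \<bar>f x\<bar> \<le> A" "\<And>x y. x \<in> S \<Longrightarrow> y \<in> S \<Longrightarrow> \<bar>f x - f y\<bar> \<le> B * dist x y"
  shows "bounded_Lipschitz_on f S"
  unfolding bounded_Lipschitz_on_def
proof (intro exI[of _ "max 0 (max A B)"] conjI ballI)
  fix x y assume "x \<in> S" "y \<in> S"
  have "B * dist x y \<le> max 0 (max A B) * dist x y" by (intro mult_right_mono) auto
  then show "\<bar>f x - f y\<bar> \<le> max 0 (max A B) * dist x y"
    using assms(2)[OF \<open>x \<in> S\<close> \<open>y \<in> S\<close>] by linarith
qed (use assms(1) in \<open>auto simp: le_max_iff_disj\<close>)

lemma bounded_Lipschitz_on_const [intro]: "bounded_Lipschitz_on (\<lambda>_. k) S"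
  by (rule bounded_Lipschitz_onI[where A = "\<bar>k\<bar>" and B = 0]) auto

lemma bounded_Lipschitz_on_add [intro]:
  assumes "bounded_Lipschitz_on f S" "bounded_Lipschitz_on h S"
  shows "bounded_Lipschitz_on (\<lambda>x. f x + h x) S"
proof -
  obtain L L' where "\<And>x. x \<in> S \<Longrightarrow> \<bar>f x\<bar> \<le> L" "\<And>x y. x \<in> S \<Longrightarrow> y \<in> S \<Longrightarrow> \<bar>f x - f y\<bar> \<le> L * dist x y"
    "\<And>x. x \<in> S \<Longrightarrow> \<bar>h x\<bar> \<le> L'" "\<And>x y. x \<in> S \<Longrightarrow> y \<in> S \<Longrightarrow> \<bar>h x - h y\<bar> \<le> L' * dist x y"
    using assms unfolding bounded_Lipschitz_on_def by blast
  then show ?thesis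
    by (intro bounded_Lipschitz_onI[where A = "L + L'" and B = "L + L'"]) (fastforce simp: algebra_simps abs_le_iff)+
qed

lemma bounded_Lipschitz_on_mult [intro]:
  assumes "bounded_Lipschitz_on f S" "bounded_Lipschitz_on h S"
  shows "bounded_Lipschitz_on (\<lambda>x. f x * h x) S"
proof -
  obtain L L' where L: "0 \<le> L" "\<And>x. x \<in> S \<Longrightarrow> \<bar>f x\<bar> \<le> L" "\<And>x y. x \<in> S \<Longrightarrow> y \<in> S \<Longrightarrow> \<bar>f x - f y\<bar> \<le> L * dist x y"
    "0 \<le> L'" "\<And>x. x \<in> S \<Longrightarrow> \<bar>h x\<bar> \<le> L'" "\<And>x y. x \<in> S \<Longrightarrow> y \<in> S \<Longrightarrow> \<bar>h x - h y\<bar> \<le> L' * dist x y"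
    using assms unfolding bounded_Lipschitz_on_def by blast
  show ?thesis
  proof (rule bounded_Lipschitz_onI)
    show "\<bar>f x * h x\<bar> \<le> L * L'" if "x \<in> S" for x
      unfolding abs_mult using L that by (intro mult_mono) auto
    fix x y assume xy: "x \<in> S" "y \<in> S"
    have "\<bar>f x * h x - f y * h y\<bar> = \<bar>(f x - f y) * h x + f y * (h x - h y)\<bar>" by (simp add: algebra_simps)
    also have "\<dots> \<le> \<bar>f x - f y\<bar> * \<bar>h x\<bar> + \<bar>f y\<bar> * \<bar>h x - h y\<bar>"
      by (rule order_trans[OF abs_triangle_ineq]) (simp add: abs_mult)
    also have "\<dots> \<le> (L * dist x y) * L' + L * (L' * dist x y)"
      using L xy by (intro add_mono mult_mono) auto
    finally show "\<bar>f x * h x - f y * h y\<bar> \<le> (2 * L * L') * dist x y" by (simp add: algebra_simps)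
  qed
qed

lemma bounded_Lipschitz_on_sum [intro]:
  "(\<And>i. i \<in> A \<Longrightarrow> bounded_Lipschitz_on (f i) S) \<Longrightarrow> bounded_Lipschitz_on (\<lambda>x. \<Sum>i\<in>A. f i x) S"
  by (induction A rule: infinite_finite_induct) auto

lemma bounded_Lipschitz_on_diff [intro]:
  assumes "bounded_Lipschitz_on f S" "bounded_Lipschitz_on h S"
  shows "bounded_Lipschitz_on (\<lambda>x. f x - h x) S"
  using bounded_Lipschitz_on_add[OF assms(1) bounded_Lipschitz_on_mult[OF bounded_Lipschitz_on_const[of "-1"] assms(2)]] by simp

lemma bounded_Lipschitz_on_cong:
  "bounded_Lipschitz_on f S \<Longrightarrow> (\<And>x. x \<in> S \<Longrightarrow> f x = h x) \<Longrightarrow> bounded_Lipschitz_on h S"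
  by (auto simp: bounded_Lipschitz_on_def)

lemma bounded_Lipschitz_on_C1_fst:
  fixes f :: "'e::euclidean_space \<Rightarrow> real" and T :: "'c::metric_space set"
  assumes f: "Ck_on 1 f S" and B: "compact B" "convex B" "B \<subseteq> S"
  shows "bounded_Lipschitz_on (\<lambda>p. f (fst p)) (B \<times> T)"
proof -
  obtain L where L: "0 \<le> L" "\<And>x y. x \<in> B \<Longrightarrow> y \<in> B \<Longrightarrow> norm (f x - f y) \<le> L * norm (x - y)"
    by (rule C1_Lipschitz[OF assms]) (rule that)
  have "continuous_on B f" using Ck_on_le[OF _ f, of 0] B(3) by (auto intro: continuous_on_subset)
  then have "bounded (f ` B)" by (intro compact_imp_bounded compact_continuous_image B(1))
  then obtain A where A: "\<And>x. x \<in> B \<Longrightarrow> \<bar>f x\<bar> \<le> A" by (auto simp: bounded_iff)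
  show ?thesis
  proof (rule bounded_Lipschitz_onI)
    fix p q assume "p \<in> B \<times> T" "q \<in> B \<times> T"
    then have "\<bar>f (fst p) - f (fst q)\<bar> \<le> L * dist (fst p) (fst q)"
      using L(2)[of "fst p" "fst q"] by (auto simp: dist_norm)
    also have "\<dots> \<le> L * dist p q" by (intro mult_left_mono dist_fst_le L)
    finally show "\<bar>f (fst p) - f (fst q)\<bar> \<le> L * dist p q" .
  qed (use A in auto)
qed

lemma bounded_Lipschitz_on_inner_snd:
  fixes i :: "'e::euclidean_space"
  assumes "bounded T"
  shows "bounded_Lipschitz_on (\<lambda>p. snd p \<bullet> i) (B \<times> T)"
proof -
  obtain A where A: "\<And>x. x \<in> T \<Longrightarrow> norm x \<le> A" using assms by (auto simp: bounded_iff)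
  show ?thesis
  proof (rule bounded_Lipschitz_onI)
    fix p assume "p \<in> B \<times> T"
    then have "norm (snd p) * norm i \<le> A * norm i" using A by (intro mult_right_mono) auto
    then show "\<bar>snd p \<bullet> i\<bar> \<le> A * norm i" using Cauchy_Schwarz_ineq2[of "snd p" i] by linarith
  next
    fix p q :: "'a \<times> 'e"
    have "\<bar>snd p \<bullet> i - snd q \<bullet> i\<bar> \<le> dist (snd p) (snd q) * norm i"
      using Cauchy_Schwarz_ineq2[of "snd p - snd q" i] by (simp add: inner_diff_left dist_norm)
    also have "\<dots> \<le> norm i * dist p q" by (subst mult.commute) (intro mult_left_mono dist_snd_le norm_ge_zero)
    finally show "\<bar>snd p \<bullet> i - snd q \<bullet> i\<bar> \<le> norm i * dist p q" .
  qed
qed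

context riemannian_manifold
begin

definition metric_deriv :: "('m, 'e) chart \<Rightarrow> 'e \<Rightarrow> 'e \<Rightarrow> 'e \<Rightarrow> 'e \<Rightarrow> real" where
  "metric_deriv c x v w = frechet_derivative (\<lambda>y. local_metric c y v w) (at x)"

lemma metric_deriv:
  assumes "c \<in> atlas" "x \<in> snd c ` fst c"
  shows "((\<lambda>y. local_metric c y v w) has_derivative metric_deriv c x v w) (at x)"
  using smooth_local_metric[OF assms(1), of 1 v w] assms(2)
  unfolding metric_deriv_def frechet_derivative_works[symmetric] by (auto simp: differentiable_def)

text \<open>Expanding in the basis separates the polynomial dependence on the vectors from the
  dependence on \<open>x\<close>, which is left in finitely many coefficient functions.\<close>

lemma metric_deriv_Basis:
  assumes c: "c \<in> atlas" "x \<in> snd c ` fst c"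
  shows "metric_deriv c x v w a =
    (\<Sum>i\<in>Basis. \<Sum>j\<in>Basis. \<Sum>k\<in>Basis. (v \<bullet> i) * (w \<bullet> j) * (a \<bullet> k) * metric_deriv c x i j k)"
proof -
  have "((\<lambda>y. \<Sum>i\<in>Basis. \<Sum>j\<in>Basis. (v \<bullet> i) * (w \<bullet> j) * local_metric c y i j) has_derivative
      (\<lambda>a. \<Sum>i\<in>Basis. \<Sum>j\<in>Basis. (v \<bullet> i) * (w \<bullet> j) * metric_deriv c x i j a)) (at x)"
    by (intro has_derivative_sum has_derivative_mult_right metric_deriv c)
  then have "((\<lambda>y. local_metric c y v w) has_derivative
      (\<lambda>a. \<Sum>i\<in>Basis. \<Sum>j\<in>Basis. (v \<bullet> i) * (w \<bullet> j) * metric_deriv c x i j a)) (at x)"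
    by (rule has_derivative_transform_within_open[OF _ open_chart_range[OF c(1)] c(2)])
      (rule bilinear_Basis[OF bilinear_local_metric[OF c(1)], symmetric])
  from has_derivative_unique[OF metric_deriv[OF c] this]
  have "metric_deriv c x v w a = (\<Sum>i\<in>Basis. \<Sum>j\<in>Basis. (v \<bullet> i) * (w \<bullet> j) * metric_deriv c x i j a)"
    by (rule fun_cong)
  moreover have "metric_deriv c x i j a = (\<Sum>k\<in>Basis. (a \<bullet> k) * metric_deriv c x i j k)" for i j
    using metric_deriv[OF c] has_derivative_linear by (intro linear_functional_Basis) blast
  ultimately show ?thesis by (simp add: sum_distrib_left mult.assoc)
qed

lemma christoffel1_eq:
  "christoffel1 c x u v w = (metric_deriv c x v w u + metric_deriv c x u w v - metric_deriv c x u v w) / 2"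
  by (simp add: christoffel1_def metric_deriv_def)

context
  fixes c x assumes c: "c \<in> atlas" "x \<in> snd c ` fst c"
begin

lemma metric_deriv_linear:
  "linear (\<lambda>v. metric_deriv c x v w a)" "linear (\<lambda>w. metric_deriv c x v w a)" "linear (metric_deriv c x v w)"
proof -
  show "linear (metric_deriv c x v w)" using metric_deriv[OF c] has_derivative_linear by blast
  have add: "metric_deriv c x (v + v') w a = metric_deriv c x v w a + metric_deriv c x v' w a"
    "metric_deriv c x v (w + w') a = metric_deriv c x v w a + metric_deriv c x v w' a" for v v' w w'
    unfolding metric_deriv_Basis[OF c, of "v + v'"] metric_deriv_Basis[OF c, of v w]
      metric_deriv_Basis[OF c, of v "w + w'"] metric_deriv_Basis[OF c, of v w'] metric_deriv_Basis[OF c, of v' w]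
    by (simp_all add: inner_add_left algebra_simps sum.distrib)
  have scale: "metric_deriv c x (s *\<^sub>R v) w a = s * metric_deriv c x v w a"
    "metric_deriv c x v (s *\<^sub>R w) a = s * metric_deriv c x v w a" for v w s
    unfolding metric_deriv_Basis[OF c, of "s *\<^sub>R v"] metric_deriv_Basis[OF c, of v w]
      metric_deriv_Basis[OF c, of v "s *\<^sub>R w"]
    by (simp_all add: sum_distrib_left mult_ac)
  show "linear (\<lambda>v. metric_deriv c x v w a)" "linear (\<lambda>w. metric_deriv c x v w a)"
    by (auto intro!: linearI simp: add scale)
qed

lemma linear_christoffel1: "linear (christoffel1 c x u v)"
  unfolding christoffel1_eq
  by (intro linearI; simp add: linear_add[OF metric_deriv_linear(2)] linear_add[OF metric_deriv_linear(3)]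
      linear_cmul[OF metric_deriv_linear(2)] linear_cmul[OF metric_deriv_linear(3)] algebra_simps add_divide_distrib diff_divide_distrib)

lemma christoffel: "local_metric c x (christoffel c x u v) w = christoffel1 c x u v w"
  using theI'[OF Riesz_bilinear[OF bilinear_local_metric[OF c] local_metric_pos[OF c] linear_christoffel1]]
  unfolding christoffel_def by blast

lemma christoffel_unique: "(\<And>w. local_metric c x k w = christoffel1 c x u v w) \<Longrightarrow> k = christoffel c x u v"
  using Riesz_bilinear[OF bilinear_local_metric[OF c] local_metric_pos[OF c] linear_christoffel1, of u v] christoffel
  by metis

text \<open>Transferred from the trilinear first-kind form through uniqueness of the represented
  vector; it allows geodesics to be rescaled in time.\<close>

lemma christoffel_scale: "christoffel c x (s *\<^sub>R u) (s *\<^sub>R u) = s\<^sup>2 *\<^sub>R christoffel c x u u"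
proof (rule christoffel_unique[symmetric])
  fix w
  have "christoffel1 c x (s *\<^sub>R u) (s *\<^sub>R u) w = s\<^sup>2 * christoffel1 c x u u w"
    unfolding christoffel1_eq
    by (simp add: linear_cmul[OF metric_deriv_linear(1)] linear_cmul[OF metric_deriv_linear(2)]
        linear_cmul[OF metric_deriv_linear(3)] power2_eq_square algebra_simps)
  then show "local_metric c x (s\<^sup>2 *\<^sub>R christoffel c x u u) w = christoffel1 c x (s *\<^sub>R u) (s *\<^sub>R u) w"
    by (simp add: bilinear_lmul[OF bilinear_local_metric[OF c]] christoffel)
qed

end

text \<open>Comparing the defining equations \<open>g\<^sub>x(k, \<cdot>) = \<Gamma>\<^sub>x(u, u, \<cdot>)\<close> at two points avoids
  inverting the metric.\<close>

lemma christoffel_Lipschitz: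
  assumes c: "c \<in> atlas" and B: "compact B" "convex B" "B \<subseteq> snd c ` fst c"
  obtains L where "0 \<le> L"
    "\<And>x y u v. x \<in> B \<Longrightarrow> y \<in> B \<Longrightarrow> norm u \<le> V \<Longrightarrow> norm v \<le> V \<Longrightarrow>
       norm (christoffel c x u u - christoffel c y v v) \<le> L * norm (x - y, u - v)"
proof -
  let ?S = "B \<times> cball (0::'e) V"
  let ?\<chi> = "\<lambda>p. christoffel1 c (fst p) (snd p) (snd p)" and ?G = "\<lambda>p. local_metric c (fst p)"
  let ?T = "\<lambda>u v a p. \<Sum>i\<in>Basis. \<Sum>j\<in>Basis. \<Sum>k\<in>Basis. (u \<bullet> i) * (v \<bullet> j) * (a \<bullet> k) * metric_deriv c (fst p) i j k"
  obtain m where m: "0 < m" "\<And>x v. x \<in> B \<Longrightarrow> m * (norm v)\<^sup>2 \<le> local_metric c x v v"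
    by (rule local_metric_lower_bound[OF c B(1,3)]) (rule that)
  have metric_BL: "bounded_Lipschitz_on (\<lambda>p. ?G p i j) ?S" for i j
    by (rule bounded_Lipschitz_on_C1_fst[OF smooth_local_metric[OF c] B])
  have deriv_BL: "bounded_Lipschitz_on (\<lambda>p. metric_deriv c (fst p) i j k) ?S" for i j k
  proof (rule bounded_Lipschitz_on_C1_fst[OF _ B])
    show "Ck_on 1 (\<lambda>x. metric_deriv c x i j k) (snd c ` fst c)"
      by (rule Ck_on_derivative[OF smooth_local_metric[OF c] metric_deriv[OF c] open_chart_range[OF c]])
  qed
  note snd_BL = bounded_Lipschitz_on_inner_snd[OF bounded_cball[of "0::'e" V], where B = B]
  have chr_BL: "bounded_Lipschitz_on (\<lambda>p. ?\<chi> p w) ?S" for w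
  proof (rule bounded_Lipschitz_on_cong)
    show "bounded_Lipschitz_on (\<lambda>p. 1 / 2 * (?T (snd p) w (snd p) p + ?T (snd p) w (snd p) p - ?T (snd p) (snd p) w p)) ?S"
      by (intro bounded_Lipschitz_on_mult bounded_Lipschitz_on_add bounded_Lipschitz_on_diff
          bounded_Lipschitz_on_sum bounded_Lipschitz_on_const snd_BL deriv_BL)
    fix p assume "p \<in> ?S"
    then have x: "fst p \<in> snd c ` fst c" using B(3) by auto
    show "1 / 2 * (?T (snd p) w (snd p) p + ?T (snd p) w (snd p) p - ?T (snd p) (snd p) w p)
       = ?\<chi> p w"
      unfolding christoffel1_eq metric_deriv_Basis[OF c x, of "snd p" w "snd p"] metric_deriv_Basis[OF c x, of "snd p" "snd p" w]
      by simp
  qed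
  have "\<exists>L\<ge>0. \<forall>p\<in>?S. \<bar>?\<chi> p w\<bar> \<le> L \<and>
      (\<forall>q\<in>?S. \<bar>?\<chi> p w - ?\<chi> q w\<bar> \<le> L * dist p q)" for w
    using chr_BL[of w] unfolding bounded_Lipschitz_on_def .
  then obtain LC where LC: "\<And>w. 0 \<le> LC w" "\<And>w p. p \<in> ?S \<Longrightarrow> \<bar>?\<chi> p w\<bar> \<le> LC w"
      "\<And>w p q. p \<in> ?S \<Longrightarrow> q \<in> ?S \<Longrightarrow>
         \<bar>?\<chi> p w - ?\<chi> q w\<bar> \<le> LC w * dist p q"
    by metis
  have "\<exists>L\<ge>0. \<forall>p\<in>?S. \<bar>?G p i j\<bar> \<le> L \<and>
      (\<forall>q\<in>?S. \<bar>?G p i j - ?G q i j\<bar> \<le> L * dist p q)" for i j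
    using metric_BL[of i j] unfolding bounded_Lipschitz_on_def .
  then obtain LG where LG: "\<And>i j. 0 \<le> LG i j"
      "\<And>i j p q. p \<in> ?S \<Longrightarrow> q \<in> ?S \<Longrightarrow>
         \<bar>?G p i j - ?G q i j\<bar> \<le> LG i j * dist p q"
    by metis
  define C where "C = (\<Sum>i\<in>(Basis::'e set). LC i)"
  define G where "G = (\<Sum>i\<in>(Basis::'e set). \<Sum>j\<in>(Basis::'e set). LG i j)"
  have C0: "0 \<le> C" and G0: "0 \<le> G" using LC(1) LG(1) by (auto simp: C_def G_def intro!: sum_nonneg)
  let ?k = "\<lambda>p. christoffel c (fst p) (snd p) (snd p)"
  have chr_eq: "local_metric c (fst p) (?k p) w = ?\<chi> p w" if "p \<in> ?S" for p w
    using that B(3) by (intro christoffel[OF c]) auto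
  \<comment> \<open>Testing the defining equation with \<open>?k p\<close> itself gives
    \<open>m * (norm (?k p))\<^sup>2 \<le> C * norm (?k p)\<close>.\<close>
  have k_bound: "norm (?k p) \<le> C / m" if p: "p \<in> ?S" for p
  proof -
    have "m * (norm (?k p))\<^sup>2 \<le> local_metric c (fst p) (?k p) (?k p)" using m(2) p by auto
    also have "\<dots> = ?\<chi> p (?k p)" by (rule chr_eq[OF p])
    also have "\<dots> \<le> norm (?\<chi> p (?k p))" by simp
    also have "\<dots> \<le> C * norm (?k p)"
      unfolding C_def using p B(3) LC(2)[OF p] by (intro norm_linear_le_Basis linear_christoffel1[OF c]) auto
    finally have "m * norm (?k p) \<le> C \<or> norm (?k p) = 0"
      by (auto simp: power2_eq_square mult.assoc[symmetric])
    then show ?thesis using m(1) C0 by (auto simp: field_simps)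
  qed
  define L where "L = (C + G * (C / m)) / m"
  have main: "norm (?k p - ?k q) \<le> L * dist p q" if p: "p \<in> ?S" and q: "q \<in> ?S" for p q
  proof -
    let ?\<delta> = "?k p - ?k q"
    have x: "fst p \<in> snd c ` fst c" "fst q \<in> snd c ` fst c" using p q B(3) by auto
    note bp = bilinear_local_metric[OF c x(1)] and bq = bilinear_local_metric[OF c x(2)]
    let ?D = "\<lambda>w. ?\<chi> p w - ?\<chi> q w"
    let ?E = "\<lambda>u w. local_metric c (fst p) u w - local_metric c (fst q) u w"
    \<comment> \<open>Testing with \<open>?\<delta>\<close> at \<open>p\<close> and exchanging the
      metric at \<open>p\<close> for the one at \<open>q\<close> in the term with
      \<open>?k q\<close> leaves a difference of first-kind symbols and a difference of metrics,
      both Lipschitz.\<close>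
    have "m * (norm ?\<delta>)\<^sup>2 \<le> local_metric c (fst p) ?\<delta> ?\<delta>" using m(2) p by auto
    also have "\<dots> = ?D ?\<delta> - ?E (?k q) ?\<delta>"
      by (simp add: bilinear_lsub[OF bp] chr_eq[OF p] chr_eq[OF q])
    also have "\<dots> \<le> norm (?D ?\<delta>) + norm (?E (?k q) ?\<delta>)" by simp
    also have "norm (?D ?\<delta>) \<le> (\<Sum>i\<in>Basis. LC i * dist p q) * norm ?\<delta>"
      using LC(3)[OF p q] by (intro norm_linear_le_Basis linear_compose_sub linear_christoffel1[OF c] x) auto
    also have "norm (?E (?k q) ?\<delta>) \<le> (\<Sum>j\<in>Basis. (\<Sum>i\<in>Basis. LG i j * dist p q) * norm (?k q)) * norm ?\<delta>"
    proof (rule norm_linear_le_Basis)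
      show "linear (?E (?k q))" using bp bq by (intro linear_compose_sub) (auto simp: bilinear_def)
      fix j :: 'e
      show "norm (?E (?k q) j) \<le> (\<Sum>i\<in>Basis. LG i j * dist p q) * norm (?k q)"
      proof (rule norm_linear_le_Basis)
        show "linear (\<lambda>u. ?E u j)" using bp bq by (intro linear_compose_sub) (auto simp: bilinear_def)
      qed (use LG(2)[OF p q] in auto)
    qed
    also have "(\<Sum>i\<in>Basis. LC i * dist p q) = C * dist p q" by (simp add: C_def sum_distrib_right)
    also have "(\<Sum>j\<in>Basis. (\<Sum>i\<in>Basis. LG i j * dist p q) * norm (?k q)) = G * dist p q * norm (?k q)"
      unfolding G_def by (subst sum.swap) (simp add: sum_distrib_right)
    also have "C * dist p q * norm ?\<delta> + G * dist p q * norm (?k q) * norm ?\<delta>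
        \<le> C * dist p q * norm ?\<delta> + G * dist p q * (C / m) * norm ?\<delta>"
      using G0 k_bound[OF q] by (intro add_left_mono mult_right_mono mult_left_mono mult_nonneg_nonneg) auto
    also have "\<dots> = (m * (L * dist p q)) * norm ?\<delta>" using m(1) by (simp add: L_def field_simps)
    finally have le: "(m * norm ?\<delta>) * norm ?\<delta> \<le> (m * (L * dist p q)) * norm ?\<delta>"
      by (simp only: power2_eq_square mult.assoc)
    have "0 \<le> L * dist p q" using C0 G0 m(1) by (auto simp: L_def)
    then show ?thesis
      using mult_right_le_imp_le[OF le] m(1) by (cases "norm ?\<delta> = 0") auto
  qed
  show thesis
  proof (rule that)
    show "0 \<le> L" using C0 G0 m(1) by (auto simp: L_def)
    fix x y u v :: 'e
    assume "x \<in> B" "y \<in> B" "norm u \<le> V" "norm v \<le> V"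
    then show "norm (christoffel c x u u - christoffel c y v v) \<le> L * norm (x - y, u - v)"
      using main[of "(x, u)" "(y, v)"] by (simp add: dist_norm)
  qed
qed

end

lemma isCont_tendsto_nhds: "isCont f x \<Longrightarrow> (f \<longlongrightarrow> f x) (nhds x)"
  by (simp add: isCont_def tendsto_at_iff_tendsto_nhds)

lemma has_vector_derivative_quotient_at_right:
  fixes \<phi> :: "real \<Rightarrow> 'b::real_normed_vector"
  assumes "(\<phi> has_vector_derivative D) (at 0)"
  shows "((\<lambda>t. (\<phi> t - \<phi> 0) /\<^sub>R t) \<longlongrightarrow> D) (at_right 0)"
proof -
  have "((\<lambda>t. norm (\<phi> t - \<phi> 0 - t *\<^sub>R D) / norm t) \<longlongrightarrow> 0) (at 0)"
    using assms by (simp add: has_vector_derivative_def has_derivative_at)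
  then have "((\<lambda>t. norm (\<phi> t - \<phi> 0 - t *\<^sub>R D) / norm t) \<longlongrightarrow> 0) (at_right 0)"
    by (rule tendsto_mono[OF at_le, rotated]) simp
  moreover have "\<forall>\<^sub>F t in at_right 0. norm (\<phi> t - \<phi> 0 - t *\<^sub>R D) / norm t = norm ((\<phi> t - \<phi> 0) /\<^sub>R t - D)"
    using eventually_at_right_less[of "0::real"]
  proof eventually_elim
    case (elim t)
    then have "(\<phi> t - \<phi> 0) /\<^sub>R t - D = (\<phi> t - \<phi> 0 - t *\<^sub>R D) /\<^sub>R t"
      by (simp add: scaleR_diff_right)
    then show ?case by (simp add: divide_inverse mult.commute)
  qed
  ultimately have "((\<lambda>t. norm ((\<phi> t - \<phi> 0) /\<^sub>R t - D)) \<longlongrightarrow> 0) (at_right 0)"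
    by (rule Lim_transform_eventually)
  then show ?thesis by (rule LIM_zero_cancel[OF tendsto_norm_zero_cancel])
qed

context riemannian_manifold
begin

text \<open>\<open>geodesic_on\<close> provides derivatives in each chart existentially. Identifying
  them with the components of \<open>velocity\<close> turns the geodesic equation into a first-order
  system for position and velocity, in which solutions can be compared.\<close>

lemma geodesic_chart:
  assumes "geodesic_on \<gamma> J" "c \<in> atlas" "t \<in> J" "\<gamma> t \<in> fst c"
  defines "v \<equiv> \<lambda>t. coords c (\<gamma> t) (velocity \<gamma> t)"
  shows "((snd c \<circ> \<gamma>) has_vector_derivative v t) (at t)"
    and "(v has_vector_derivative - christoffel c (snd c (\<gamma> t)) (v t) (v t)) (at t)"
    and "isCont \<gamma> t"
proof -
  have J: "open J" "continuous_on J \<gamma>" using assms(1) by (auto simp: geodesic_on_def)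
  have cont: "isCont \<gamma> t" if "t \<in> J" for t
    using J that by (simp add: continuous_on_eq_continuous_at)
  show "isCont \<gamma> t" by (rule cont[OF assms(3)])
  obtain x' x'' where D: "\<And>t. t \<in> J \<inter> \<gamma> -` fst c \<Longrightarrow> ((snd c \<circ> \<gamma>) has_vector_derivative x' t) (at t) \<and>
      (x' has_vector_derivative x'' t) (at t) \<and> x'' t + christoffel c (snd c (\<gamma> t)) (x' t) (x' t) = 0"
    using assms(1,2) unfolding geodesic_on_def by meson
  have v: "v s = x' s" if "s \<in> J \<inter> \<gamma> -` fst c" for s
    unfolding v_def using that D[OF that] by (intro coords_velocity assms(2) cont) auto
  have t: "t \<in> J \<inter> \<gamma> -` fst c" using assms by simp
  show "((snd c \<circ> \<gamma>) has_vector_derivative v t) (at t)" using D[OF t] v[OF t] by simp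
  have "open (J \<inter> \<gamma> -` fst c)"
    using J open_chart_dom[OF assms(2)] by (simp add: continuous_open_preimage)
  then have "(v has_vector_derivative x'' t) (at t)"
    using v[symmetric]
    by (rule has_vector_derivative_transform_within_open[OF conjunct1[OF conjunct2[OF D[OF t]]] _ t])
  moreover have "x'' t = - christoffel c (snd c (\<gamma> t)) (v t) (v t)"
    using D[OF t] v[OF t] by (simp add: add_eq_0_iff2)
  ultimately show "(v has_vector_derivative - christoffel c (snd c (\<gamma> t)) (v t) (v t)) (at t)" by simp
qed

text \<open>For a short time both solutions stay in a compact region of phase space, where the
  system is Lipschitz by \<open>christoffel_Lipschitz\<close>. The squared phase-space distance
  \<open>\<psi>\<close> then satisfies the hypotheses of
  \<open>zero_if_derivative_le_self\<close>.\<close>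

lemma geodesic_locally_unique:
  assumes \<gamma>: "geodesic_on \<gamma> J" "geodesic_on \<eta> J" and t0: "t0 \<in> J"
    and init: "\<gamma> t0 = \<eta> t0" "velocity \<gamma> t0 = velocity \<eta> t0"
  obtains e where "e > 0" "{t0 - e<..<t0 + e} \<subseteq> J"
    "\<And>t. t \<in> {t0 - e<..<t0 + e} \<Longrightarrow> \<gamma> t = \<eta> t \<and> velocity \<gamma> t = velocity \<eta> t"
proof -
  let ?c = "chart_at (\<gamma> t0)"
  note c = chart_at[of "\<gamma> t0"]
  have J: "open J" using \<gamma> by (auto simp: geodesic_on_def)
  obtain r where r: "r > 0" "cball (snd ?c (\<gamma> t0)) r \<subseteq> snd ?c ` (fst ?c \<inter> UNIV)"
    by (rule chart_nhd[OF c open_UNIV UNIV_I]) (rule that)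
  let ?B = "cball (snd ?c (\<gamma> t0)) r"
  define v where "v \<theta> t = coords ?c (\<theta> t) (velocity \<theta> t)" for \<theta> t
  \<comment> \<open>Any bound strictly above the initial Euclidean speed works; continuity keeps
    both velocities below it near \<open>t0\<close>.\<close>
  define V where "V = norm (v \<gamma> t0) + 1"
  let ?ok = "\<lambda>\<theta> t. \<theta> t \<in> fst ?c \<and> snd ?c (\<theta> t) \<in> ?B \<and> norm (v \<theta> t) \<le> V"
  have near: "\<forall>\<^sub>F t in nhds t0. ?ok \<theta> t"
    if \<theta>: "geodesic_on \<theta> J" "\<theta> t0 = \<gamma> t0" "velocity \<theta> t0 = velocity \<gamma> t0" for \<theta>
  proof -
    have th: "\<theta> t0 \<in> fst ?c" using c \<theta> by simp
    note G = geodesic_chart[OF \<theta>(1) c(1) t0 th]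
    have "isCont (v \<theta>) t0" using has_vector_derivative_continuous[OF G(2)] unfolding v_def .
    then have 1: "(v \<theta> \<longlongrightarrow> v \<theta> t0) (nhds t0)" by (rule isCont_tendsto_nhds)
    have 2: "(\<theta> \<longlongrightarrow> \<theta> t0) (nhds t0)" using G(3) by (rule isCont_tendsto_nhds)
    have U: "open (fst ?c \<inter> snd ?c -` ball (snd ?c (\<gamma> t0)) r)" by (rule open_chart_vimage[OF c(1)]) simp
    have "\<forall>\<^sub>F t in nhds t0. \<theta> t \<in> fst ?c \<inter> snd ?c -` ball (snd ?c (\<gamma> t0)) r"
      using \<theta> c r(1) by (intro topological_tendstoD[OF 2 U]) auto
    moreover have "\<forall>\<^sub>F t in nhds t0. norm (v \<theta> t) < V"
      using \<theta> by (intro order_tendstoD(2)[OF tendsto_norm[OF 1]]) (auto simp: V_def v_def)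
    ultimately show ?thesis by eventually_elim auto
  qed
  have "\<forall>\<^sub>F t in nhds t0. t \<in> J" using J t0 by (simp add: eventually_nhds_in_open)
  with near[OF \<gamma>(1) refl refl] near[OF \<gamma>(2) init[symmetric]]
  have "\<forall>\<^sub>F t in nhds t0. t \<in> J \<and> ?ok \<gamma> t \<and> ?ok \<eta> t"
    by eventually_elim auto
  then obtain e where e: "e > 0" and "\<And>t. dist t t0 < e \<Longrightarrow> t \<in> J \<and> ?ok \<gamma> t \<and> ?ok \<eta> t"
    unfolding eventually_nhds_metric by blast
  then have N: "t \<in> J" "\<gamma> t \<in> fst ?c" "snd ?c (\<gamma> t) \<in> ?B" "norm (v \<gamma> t) \<le> V"
     "\<eta> t \<in> fst ?c" "snd ?c (\<eta> t) \<in> ?B" "norm (v \<eta> t) \<le> V" if "t \<in> {t0 - e<..<t0 + e}" for t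
    using that by (auto simp: dist_real_def abs_less_iff)
  obtain L where L: "0 \<le> L" "\<And>x y u v. x \<in> ?B \<Longrightarrow> y \<in> ?B \<Longrightarrow> norm u \<le> V \<Longrightarrow> norm v \<le> V \<Longrightarrow>
       norm (christoffel ?c x u u - christoffel ?c y v v) \<le> L * norm (x - y, u - v)"
    by (rule christoffel_Lipschitz[OF c(1), of ?B V]) (use r(2) that in auto)
  define a where "a t = snd ?c (\<gamma> t) - snd ?c (\<eta> t)" for t
  define b where "b t = v \<gamma> t - v \<eta> t" for t
  define b' where "b' t = christoffel ?c (snd ?c (\<eta> t)) (v \<eta> t) (v \<eta> t) - christoffel ?c (snd ?c (\<gamma> t)) (v \<gamma> t) (v \<gamma> t)" for t
  define \<psi> where "\<psi> t = a t \<bullet> a t + b t \<bullet> b t" for t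
  have zero: "\<psi> t = 0" if t: "t \<in> {t0 - e<..<t0 + e}" for t
  proof (rule zero_if_derivative_le_self[of "{t0 - e<..<t0 + e}" t0 t])
    show "is_interval {t0 - e<..<t0 + e}" by simp
    show "\<psi> t0 = 0" using init by (simp add: \<psi>_def a_def b_def v_def)
    show "0 \<le> \<psi> s" for s by (simp add: \<psi>_def)
    fix s assume s: "s \<in> {t0 - e<..<t0 + e}"
    note Gs = geodesic_chart[OF \<gamma>(1) c(1) N(1,2)[OF s]] and Es = geodesic_chart[OF \<gamma>(2) c(1) N(1,5)[OF s]]
    have a': "(a has_vector_derivative b s) (at s)"
      using has_vector_derivative_diff[OF Gs(1) Es(1)] unfolding a_def b_def v_def comp_def .
    have b': "(b has_vector_derivative b' s) (at s)"
      using has_vector_derivative_diff[OF Gs(2) Es(2)] unfolding b_def b'_def v_def by simp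
    show "(\<psi> has_real_derivative (2 * (a s \<bullet> b s) + 2 * (b s \<bullet> b' s))) (at s)"
      unfolding \<psi>_def has_real_derivative_iff_has_vector_derivative
      by (rule has_vector_derivative_eq_rhs[OF has_vector_derivative_add[OF
            bounded_bilinear.has_vector_derivative[OF bounded_bilinear_inner a' a']
            bounded_bilinear.has_vector_derivative[OF bounded_bilinear_inner b' b']]])
        (simp add: inner_commute)
    have norm_b': "norm (b' s) \<le> L * norm (a s, b s)"
      using L(2)[OF N(3)[OF s] N(6)[OF s] N(4)[OF s] N(7)[OF s]] unfolding b'_def a_def b_def by (simp add: norm_minus_commute)
    have \<psi>_eq: "\<psi> s = (norm (a s, b s))\<^sup>2" by (simp add: \<psi>_def norm_Pair power2_norm_eq_inner)
    have le: "norm (a s) \<le> norm (a s, b s)" "norm (b s) \<le> norm (a s, b s)"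
      by (auto simp: norm_Pair intro: real_le_rsqrt)
    have "\<bar>a s \<bullet> b s\<bar> \<le> \<psi> s"
      unfolding \<psi>_eq power2_eq_square
      by (rule order_trans[OF Cauchy_Schwarz_ineq2]) (intro mult_mono le, auto)
    moreover have "\<bar>b s \<bullet> b' s\<bar> \<le> L * \<psi> s"
    proof -
      have "\<bar>b s \<bullet> b' s\<bar> \<le> norm (b s) * norm (b' s)" by (rule Cauchy_Schwarz_ineq2)
      also have "\<dots> \<le> norm (a s, b s) * (L * norm (a s, b s))" by (intro mult_mono le norm_b') auto
      finally show ?thesis by (simp add: \<psi>_eq power2_eq_square mult_ac)
    qed
    ultimately show "\<bar>2 * (a s \<bullet> b s) + 2 * (b s \<bullet> b' s)\<bar> \<le> (2 + 2 * L) * \<psi> s"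
      by (simp add: algebra_simps abs_le_iff)
  qed (use e t in auto)
  show thesis
  proof (rule that[OF e])
    show "{t0 - e<..<t0 + e} \<subseteq> J" using N(1) by blast
    fix t assume t: "t \<in> {t0 - e<..<t0 + e}"
    have "a t \<bullet> a t = 0" "b t \<bullet> b t = 0"
      using zero[OF t] inner_ge_zero[of "a t"] inner_ge_zero[of "b t"] unfolding \<psi>_def by linarith+
    then have ab: "a t = 0" "b t = 0" by auto
    have "\<gamma> t = \<eta> t"
      using ab(1) inj_on_chart[OF c(1)] N(2,5)[OF t] by (auto simp: a_def inj_on_def)
    moreover have "velocity \<gamma> t = velocity \<eta> t"
      using ab(2) calculation of_coords_coords[OF c(1) N(2)[OF t]] unfolding b_def v_def by (metis right_minus_eq)
    ultimately show "\<gamma> t = \<eta> t \<and> velocity \<gamma> t = velocity \<eta> t" ..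
  qed
qed

lemma geodesic_on_subset:
  "geodesic_on \<gamma> J \<Longrightarrow> open J' \<Longrightarrow> is_interval J' \<Longrightarrow> J' \<subseteq> J \<Longrightarrow> geodesic_on \<gamma> J'"
  unfolding geodesic_on_def by (fastforce intro: continuous_on_subset)

text \<open>The exponential map is a definite description, so it is meaningful only thanks to uniqueness.\<close>

lemma geodesic_unique:
  assumes \<gamma>: "geodesic_on \<gamma> J1" "geodesic_on \<eta> J2" and t0: "t0 \<in> J1 \<inter> J2"
    and init: "\<gamma> t0 = \<eta> t0" "velocity \<gamma> t0 = velocity \<eta> t0" and t: "t \<in> J1 \<inter> J2"
  shows "\<gamma> t = \<eta> t"
proof -
  let ?J = "J1 \<inter> J2"
  have J: "open ?J" "is_interval ?J"
    using \<gamma> by (auto simp: geodesic_on_def intro: is_interval_Int)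
  have geo: "geodesic_on \<gamma> ?J" "geodesic_on \<eta> ?J"
    using geodesic_on_subset[OF \<gamma>(1) J] geodesic_on_subset[OF \<gamma>(2) J] by auto
  define E where "E = {t \<in> ?J. \<gamma> t = \<eta> t \<and> velocity \<gamma> t = velocity \<eta> t}"
  have "open E"
  proof (subst open_subopen, intro ballI)
    fix s assume "s \<in> E"
    then have s: "s \<in> ?J" "\<gamma> s = \<eta> s" "velocity \<gamma> s = velocity \<eta> s" by (auto simp: E_def)
    obtain e where "e > 0" "{s - e<..<s + e} \<subseteq> ?J"
      "\<And>t. t \<in> {s - e<..<s + e} \<Longrightarrow> \<gamma> t = \<eta> t \<and> velocity \<gamma> t = velocity \<eta> t"
      by (rule geodesic_locally_unique[OF geo s]) (rule that)
    then show "\<exists>T. open T \<and> s \<in> T \<and> T \<subseteq> E" unfolding E_def by (intro exI[of _ "{s - e<..<s + e}"]) auto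
  qed
  moreover have "open (?J - E)"
  proof (subst open_subopen, intro ballI)
    fix s assume s: "s \<in> ?J - E"
    let ?c = "chart_at (\<gamma> s)"
    note c = chart_at[of "\<gamma> s"]
    have nhds_J: "\<forall>\<^sub>F t in nhds s. t \<in> ?J" using J(1) s by (intro eventually_nhds_in_open) auto
    have \<gamma>_lim: "(\<gamma> \<longlongrightarrow> \<gamma> s) (nhds s)" and \<eta>_lim: "(\<eta> \<longlongrightarrow> \<eta> s) (nhds s)"
      using geo s J(1) by (auto simp: geodesic_on_def continuous_on_eq_continuous_at intro: isCont_tendsto_nhds)
    have "\<forall>\<^sub>F t in nhds s. t \<in> ?J - E"
    \<comment> \<open>Disagreement is an open condition for two reasons: distinct positions are
      separated by the Hausdorff property, and distinct velocities at a common position are compared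
      in a fixed chart, where they vary continuously.\<close>
    proof (cases "\<gamma> s = \<eta> s")
      case False
      then obtain U W where UW: "open U" "open W" "\<gamma> s \<in> U" "\<eta> s \<in> W" "U \<inter> W = {}"
        using hausdorff by metis
      have "\<forall>\<^sub>F t in nhds s. \<gamma> t \<in> U" "\<forall>\<^sub>F t in nhds s. \<eta> t \<in> W"
        using topological_tendstoD[OF \<gamma>_lim UW(1,3)] topological_tendstoD[OF \<eta>_lim UW(2,4)] by auto
      with nhds_J show ?thesis by eventually_elim (use UW(5) in \<open>auto simp: E_def\<close>)
    next
      case True
      then have ne: "velocity \<gamma> s \<noteq> velocity \<eta> s" using s by (auto simp: E_def)
      have \<eta>s: "\<eta> s \<in> fst ?c" using True c by simp
      have sJ: "s \<in> ?J" using s by simp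
      let ?v = "\<lambda>\<theta> t. coords ?c (\<theta> t) (velocity \<theta> t)"
      have "(?v \<gamma> \<longlongrightarrow> ?v \<gamma> s) (nhds s)"
        by (rule isCont_tendsto_nhds[OF has_vector_derivative_continuous[OF geodesic_chart(2)[OF geo(1) c(1) sJ c(2)]]])
      moreover have "(?v \<eta> \<longlongrightarrow> ?v \<eta> s) (nhds s)"
        by (rule isCont_tendsto_nhds[OF has_vector_derivative_continuous[OF geodesic_chart(2)[OF geo(2) c(1) sJ \<eta>s]]])
      ultimately have "((\<lambda>t. ?v \<gamma> t - ?v \<eta> t) \<longlongrightarrow> ?v \<gamma> s - ?v \<eta> s) (nhds s)" by (rule tendsto_diff)
      moreover have "?v \<gamma> s - ?v \<eta> s \<noteq> 0"
        using ne True of_coords_coords[OF c] by (metis right_minus_eq)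
      ultimately have "\<forall>\<^sub>F t in nhds s. ?v \<gamma> t - ?v \<eta> t \<noteq> 0" by (rule tendsto_imp_eventually_ne)
      with nhds_J show ?thesis by eventually_elim (auto simp: E_def)
    qed
    then show "\<exists>T. open T \<and> s \<in> T \<and> T \<subseteq> ?J - E" unfolding eventually_nhds by blast
  qed
  moreover have "connected ?J" using J(2) by (simp add: is_interval_connected)
  moreover have "t0 \<in> E" using t0 init by (simp add: E_def)
  ultimately have "?J - E = {}"
    using connectedD[of ?J E "?J - E"] t0 by blast
  then show ?thesis using t by (auto simp: E_def)
qed

section \<open>The exponential map\<close>

lemma exp_map_eq:
  assumes "geodesic_on \<gamma> J" "{0..1} \<subseteq> J" "\<gamma> 0 = p" "velocity \<gamma> 0 = v"
  shows "exp_map p v = \<gamma> 1"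
  unfolding exp_map_def
proof (rule the_equality)
  show "exp_reaches p v (\<gamma> 1)" using assms by (auto simp: exp_reaches_def)
  fix q assume "exp_reaches p v q"
  then obtain \<eta> J' where \<eta>: "geodesic_on \<eta> J'" "{0..1} \<subseteq> J'" "\<eta> 0 = p" "velocity \<eta> 0 = v" "\<eta> 1 = q"
    unfolding exp_reaches_def by blast
  have "0 \<in> J \<inter> J'" "1 \<in> J \<inter> J'" using assms(2) \<eta>(2) by auto
  then show "q = \<gamma> 1" using geodesic_unique[OF \<eta>(1) assms(1), of 0 1] \<eta> assms by auto
qed

text \<open>Velocity acquires a factor \<open>s\<close> and acceleration \<open>s\<^sup>2\<close>,
  matching the quadratic homogeneity of the Christoffel term.\<close>

lemma geodesic_scale:
  assumes \<gamma>: "geodesic_on \<gamma> J" and "s > 0"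
  shows "geodesic_on (\<lambda>t. \<gamma> (s * t)) ((\<lambda>t. s * t) -` J)"
proof -
  let ?f = "\<lambda>t. s * t :: real"
  have J: "open J" "is_interval J" "continuous_on J \<gamma>" using \<gamma> by (auto simp: geodesic_on_def)
  have "open (?f -` J)" by (intro continuous_open_vimage J(1)) (auto intro: continuous_intros)
  moreover have "is_interval (?f -` J)"
    unfolding is_interval_1
  proof (intro ballI allI impI)
    fix x y z assume "x \<in> ?f -` J" "y \<in> ?f -` J" "x \<le> z \<and> z \<le> y"
    then have "?f x \<in> J" "?f y \<in> J" "?f x \<le> ?f z" "?f z \<le> ?f y" using \<open>s > 0\<close> by auto
    then show "z \<in> ?f -` J" using mem_is_interval_1_I[OF J(2)] by blast
  qed
  moreover have "continuous_on (?f -` J) (\<lambda>t. \<gamma> (?f t))"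
    by (rule continuous_on_compose2[OF J(3)]) (auto intro: continuous_intros)
  moreover have "\<exists>x' x''. \<forall>t\<in>?f -` J \<inter> (\<lambda>t. \<gamma> (?f t)) -` fst c.
        ((snd c \<circ> (\<lambda>t. \<gamma> (?f t))) has_vector_derivative x' t) (at t) \<and>
        (x' has_vector_derivative x'' t) (at t) \<and>
        x'' t + christoffel c (snd c (\<gamma> (?f t))) (x' t) (x' t) = 0" if c: "c \<in> atlas" for c
  proof -
    obtain x' x'' where D: "\<And>t. t \<in> J \<inter> \<gamma> -` fst c \<Longrightarrow> ((snd c \<circ> \<gamma>) has_vector_derivative x' t) (at t) \<and>
      (x' has_vector_derivative x'' t) (at t) \<and> x'' t + christoffel c (snd c (\<gamma> t)) (x' t) (x' t) = 0"
      using \<gamma> c unfolding geodesic_on_def by meson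
    have f: "(?f has_vector_derivative s) (at t)" for t by (auto intro!: derivative_eq_intros)
    show ?thesis
    proof (rule exI[of _ "\<lambda>t. s *\<^sub>R x' (?f t)"], rule exI[of _ "\<lambda>t. s *\<^sub>R s *\<^sub>R x'' (?f t)"], intro ballI conjI)
      fix t assume t: "t \<in> ?f -` J \<inter> (\<lambda>t. \<gamma> (?f t)) -` fst c"
      then have ft: "?f t \<in> J \<inter> \<gamma> -` fst c" by simp
      note D = D[OF ft]
      show "((snd c \<circ> (\<lambda>t. \<gamma> (?f t))) has_vector_derivative s *\<^sub>R x' (?f t)) (at t)"
        using vector_diff_chain_at[OF f conjunct1[OF D]] by (simp add: comp_def)
      have "(x' \<circ> ?f has_vector_derivative s *\<^sub>R x'' (?f t)) (at t)"
        using D by (intro vector_diff_chain_at f) auto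
      then show "((\<lambda>t. s *\<^sub>R x' (?f t)) has_vector_derivative s *\<^sub>R s *\<^sub>R x'' (?f t)) (at t)"
        unfolding comp_def by (intro bounded_linear.has_vector_derivative[OF bounded_linear_scaleR_right])
      have "christoffel c (snd c (\<gamma> (?f t))) (s *\<^sub>R x' (?f t)) (s *\<^sub>R x' (?f t))
          = s *\<^sub>R s *\<^sub>R christoffel c (snd c (\<gamma> (?f t))) (x' (?f t)) (x' (?f t))"
        using ft c by (subst christoffel_scale) (auto simp: power2_eq_square)
      then show "s *\<^sub>R s *\<^sub>R x'' (?f t) + christoffel c (snd c (\<gamma> (?f t))) (s *\<^sub>R x' (?f t)) (s *\<^sub>R x' (?f t)) = 0"
        using D by (metis scaleR_right_distrib scaleR_zero_right)
    qed
  qed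
  ultimately show ?thesis unfolding geodesic_on_def by blast
qed

lemma exp_map_scale:
  assumes \<gamma>: "geodesic_on \<gamma> J" "{0..1} \<subseteq> J" "\<gamma> 0 = p" "velocity \<gamma> 0 = v" and s: "0 < s" "s \<le> 1"
  shows "exp_map p (s *\<^sub>R v) = \<gamma> s"
proof -
  let ?f = "\<lambda>t. s * t :: real" and ?c = "chart_at p"
  note c = chart_at[of p]
  have geo: "geodesic_on (\<lambda>t. \<gamma> (?f t)) (?f -` J)" by (rule geodesic_scale[OF \<gamma>(1) s(1)])
  have sub: "{0..1} \<subseteq> ?f -` J"
  proof
    fix t :: real assume "t \<in> {0..1}"
    then have "s * t \<in> {0..1}" using s by (auto intro: mult_le_one)
    then show "t \<in> ?f -` J" using \<gamma>(2) by blast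
  qed
  have 0: "0 \<in> J" using \<gamma>(2) by auto
  have "((snd ?c \<circ> \<gamma>) has_vector_derivative v) (at 0)"
    using geodesic_chart(1)[OF \<gamma>(1) c(1) 0] c(2) \<gamma>(3,4) by (simp add: coords_chart_at)
  moreover have "(?f has_vector_derivative s) (at 0)" by (auto intro!: derivative_eq_intros)
  ultimately have "((snd ?c \<circ> \<gamma>) \<circ> ?f has_vector_derivative s *\<^sub>R v) (at 0)"
    by (intro vector_diff_chain_at) auto
  then have "((snd ?c \<circ> (\<lambda>t. \<gamma> (?f t))) has_vector_derivative s *\<^sub>R v) (at 0)" by (simp add: comp_def)
  then have "velocity (\<lambda>t. \<gamma> (?f t)) 0 = s *\<^sub>R v"
    using \<gamma>(3) by (auto simp: velocity_def intro: vector_derivative_at)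
  then show ?thesis using exp_map_eq[OF geo sub] \<gamma>(3) by simp
qed

section \<open>Retractions to first order\<close>

text \<open>An arbitrary \<open>v\<close> is shrunk into the ball inside
  \<open>exp_domain p\<close>; the geodesic with initial velocity \<open>s *\<^sub>R v\<close>, run
  as \<open>\<gamma> (t / s)\<close>, has initial velocity \<open>v\<close> again and gives
  \<open>exp_map p (t *\<^sub>R v)\<close> for small positive \<open>t\<close>.\<close>

lemma exp_map_first_order:
  assumes ball: "r > 0" "tangent_ball p r \<subseteq> exp_domain p" and c: "c \<in> atlas" "p \<in> fst c"
  obtains \<eta> where "\<forall>\<^sub>F t in at_right (0::real). exp_map p (t *\<^sub>R v) = \<eta> t"
    "\<eta> 0 = p" "isCont \<eta> 0" "((snd c \<circ> \<eta>) has_vector_derivative coords c p v) (at 0)"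
proof -
  \<comment> \<open>The summand 1 keeps the denominator positive when \<open>v = 0\<close> and puts
    the scaled vector strictly inside the ball.\<close>
  define s where "s = r / (tangent_norm p v + 1)"
  have pos: "0 < tangent_norm p v + 1" using tangent_norm_nonneg[of p v] by simp
  then have s: "s > 0" using ball(1) by (simp add: s_def)
  have "tangent_norm p (s *\<^sub>R v) = s * tangent_norm p v"
    using s by (simp add: tangent_norm_def bilinear_lmul[OF metric_bilinear] bilinear_rmul[OF metric_bilinear]
        real_sqrt_mult)
  also have "\<dots> < r" using ball(1) pos by (simp add: s_def field_simps)
  finally have "s *\<^sub>R v \<in> exp_domain p" using ball(2) by (auto simp: tangent_ball_def)
  then obtain \<gamma> J where \<gamma>: "geodesic_on \<gamma> J" "{0..1} \<subseteq> J" "\<gamma> 0 = p" "velocity \<gamma> 0 = s *\<^sub>R v"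
    unfolding exp_domain_def exp_reaches_def by blast
  have 0: "0 \<in> J" using \<gamma>(2) by auto
  have \<gamma>0: "\<gamma> 0 \<in> fst c" using c \<gamma>(3) by simp
  note G = geodesic_chart[OF \<gamma>(1) c(1) 0 \<gamma>0]
  show thesis
  proof (rule that[of "\<lambda>t. \<gamma> (t / s)"])
    have "exp_map p (t *\<^sub>R v) = \<gamma> (t / s)" if "t \<in> {0<..<s}" for t
      using exp_map_scale[OF \<gamma>, of "t / s"] that s by auto
    moreover have "\<forall>\<^sub>F t in at_right 0. t \<in> {0<..<s}" using s by (rule eventually_at_right_real)
    ultimately show "\<forall>\<^sub>F t in at_right 0. exp_map p (t *\<^sub>R v) = \<gamma> (t / s)" by (auto elim: eventually_mono)
    show "isCont (\<lambda>t. \<gamma> (t / s)) 0"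
    proof (rule isCont_o2[where g = \<gamma> and f = "\<lambda>t. t / s"])
      show "isCont (\<lambda>t. t / s) 0" using s by (intro continuous_intros) auto
    qed (use G(3) in simp)
    have "((\<lambda>t. t / s) has_vector_derivative inverse s) (at 0)"
      by (auto intro!: derivative_eq_intros simp: divide_inverse)
    then have "((snd c \<circ> \<gamma>) \<circ> (\<lambda>t. t / s) has_vector_derivative inverse s *\<^sub>R coords c p (s *\<^sub>R v)) (at 0)"
      using G(1) \<gamma>(3,4) by (intro vector_diff_chain_at) auto
    then show "(snd c \<circ> (\<lambda>t. \<gamma> (t / s)) has_vector_derivative coords c p v) (at 0)"
      using s linear_cmul[OF linear_coords[OF c]] by (simp add: comp_def)
  qed (use \<gamma>(3) in simp)
qed

text \<open>\<open>geodesic_dist_lower_bound\<close> converts an \<open>O(t\<^sup>2)\<close>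
  geodesic distance into an \<open>O(t\<^sup>2)\<close> coordinate distance, which vanishes after
  division by \<open>t\<close>. The filter \<open>at 0\<close> ignores \<open>t = 0\<close>, so
  \<open>R p 0 = p\<close> is obtained as a limit and rests on \<open>cont\<close>.\<close>

lemma retraction_first_order:
  assumes conn: "connected (UNIV :: 'm set)" and R: "retraction R"
    and ball: "r > 0" "tangent_ball p r \<subseteq> exp_domain p" and c: "c \<in> atlas" "p \<in> fst c"
    and cont: "((\<lambda>t. R p (t *\<^sub>R v)) \<longlongrightarrow> R p 0) (at_right 0)"
  shows "R p 0 = p"
    and "((\<lambda>t. (snd c (R p (t *\<^sub>R v)) - snd c p) /\<^sub>R t) \<longlongrightarrow> coords c p v) (at_right 0)"
proof -
  let ?F = "at_right (0::real)" and ?r = "\<lambda>t. R p (t *\<^sub>R v)"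
  obtain \<eta> where \<eta>: "\<forall>\<^sub>F t in ?F. exp_map p (t *\<^sub>R v) = \<eta> t"
    "\<eta> 0 = p" "isCont \<eta> 0" "((snd c \<circ> \<eta>) has_vector_derivative coords c p v) (at 0)"
    by (rule exp_map_first_order[OF ball c]) (rule that)
  obtain \<rho> where \<rho>: "\<rho> > 0" "cball (snd c p) \<rho> \<subseteq> snd c ` (fst c \<inter> UNIV)"
    by (rule chart_nhd[OF c open_UNIV UNIV_I]) (rule that)
  obtain \<kappa> where \<kappa>: "\<kappa> > 0"
    "\<And>p' q. q \<in> fst c \<Longrightarrow> snd c q \<in> cball (snd c p) (\<rho> / 2) \<Longrightarrow> geodesic_dist p' q < \<kappa> * (\<rho> / 2) \<Longrightarrow>
       p' \<in> fst c \<and> \<kappa> * norm (snd c q - snd c p') \<le> geodesic_dist p' q"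
    by (rule geodesic_dist_lower_bound[OF conn c \<rho>(1) \<rho>(2)[unfolded Int_UNIV_right]]) (rule that)
  have "(\<lambda>t. geodesic_dist (?r t) (exp_map p (t *\<^sub>R v))) \<in> O[at 0](\<lambda>t. t\<^sup>2)"
    using R unfolding retraction_def by blast
  then obtain B where "B > 0" "\<forall>\<^sub>F t in at 0. norm (geodesic_dist (?r t) (exp_map p (t *\<^sub>R v))) \<le> B * norm (t\<^sup>2)"
    by (rule landau_o.bigE)
  then have B: "B > 0" "\<forall>\<^sub>F t in ?F. geodesic_dist (?r t) (exp_map p (t *\<^sub>R v)) \<le> B * t\<^sup>2"
    unfolding eventually_at_split by (auto elim!: eventually_mono)
  have lim0: "((\<lambda>t. t) \<longlongrightarrow> 0) ?F" by (rule tendsto_ident_at)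
  have "((\<lambda>t. B * t\<^sup>2) \<longlongrightarrow> B * 0\<^sup>2) ?F" by (intro tendsto_intros lim0)
  then have small: "\<forall>\<^sub>F t in ?F. B * t\<^sup>2 < \<kappa> * (\<rho> / 2)"
    using \<kappa>(1) \<rho>(1) by (intro order_tendstoD(2)[of _ "B * 0\<^sup>2"]) auto
  have \<eta>_lim: "(\<eta> \<longlongrightarrow> p) ?F"
    using \<eta>(2,3) by (auto simp: isCont_def intro: filterlim_at_split[THEN iffD1, THEN conjunct2])
  have "\<forall>\<^sub>F t in ?F. \<eta> t \<in> fst c \<inter> snd c -` ball (snd c p) (\<rho> / 2)"
    using c \<rho>(1) by (intro topological_tendstoD[OF \<eta>_lim] open_chart_vimage) auto
  with \<eta>(1) B(2) small
  \<comment> \<open>Only the exponential curve is known to be in the chart; that the retraction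
    curve is there too is part of the conclusion of the distance bound.\<close>
  have close: "\<forall>\<^sub>F t in ?F. ?r t \<in> fst c \<and> norm (snd c (\<eta> t) - snd c (?r t)) \<le> (B / \<kappa>) * t\<^sup>2"
  proof eventually_elim
    case (elim t)
    then have "?r t \<in> fst c \<and> \<kappa> * norm (snd c (\<eta> t) - snd c (?r t)) \<le> B * t\<^sup>2"
      using \<kappa>(2)[of "\<eta> t" "?r t"] by auto
    then show ?case using \<kappa>(1) by (simp add: field_simps)
  qed
  have quot: "((\<lambda>t. (snd c (\<eta> t) - snd c p) /\<^sub>R t) \<longlongrightarrow> coords c p v) ?F"
    using has_vector_derivative_quotient_at_right[OF \<eta>(4)] \<eta>(2) by simp
  have diff: "((\<lambda>t. (snd c (\<eta> t) - snd c (?r t)) /\<^sub>R t) \<longlongrightarrow> 0) ?F"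
  proof (rule Lim_null_comparison)
    have "\<forall>\<^sub>F t in ?F. t > 0" by (rule eventually_at_right_less)
    with close show "\<forall>\<^sub>F t in ?F. norm ((snd c (\<eta> t) - snd c (?r t)) /\<^sub>R t) \<le> (B / \<kappa>) * t"
    proof eventually_elim
      case (elim t)
      have "norm ((snd c (\<eta> t) - snd c (?r t)) /\<^sub>R t) = norm (snd c (\<eta> t) - snd c (?r t)) / t"
        using elim by (simp add: divide_inverse mult.commute)
      also have "\<dots> \<le> (B / \<kappa>) * t\<^sup>2 / t" using elim by (intro divide_right_mono) auto
      also have "\<dots> = (B / \<kappa>) * t" using elim by (simp add: power2_eq_square)
      finally show ?case .
    qed
    have "((\<lambda>t. (B / \<kappa>) * t) \<longlongrightarrow> (B / \<kappa>) * 0) ?F" by (intro tendsto_intros lim0)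
    then show "((\<lambda>t. (B / \<kappa>) * t) \<longlongrightarrow> 0) ?F" by simp
  qed
  have eq: "(snd c (\<eta> t) - snd c p) /\<^sub>R t - (snd c (\<eta> t) - snd c (?r t)) /\<^sub>R t =
      (snd c (?r t) - snd c p) /\<^sub>R t" for t by (simp add: algebra_simps)
  show main: "((\<lambda>t. (snd c (?r t) - snd c p) /\<^sub>R t) \<longlongrightarrow> coords c p v) ?F"
    using tendsto_diff[OF quot diff] unfolding eq by simp
  have "((\<lambda>t. t *\<^sub>R ((snd c (?r t) - snd c p) /\<^sub>R t)) \<longlongrightarrow> 0 *\<^sub>R coords c p v) ?F"
    by (intro tendsto_scaleR lim0 main)
  moreover have "\<forall>\<^sub>F t in ?F. t *\<^sub>R ((snd c (?r t) - snd c p) /\<^sub>R t) = snd c (?r t) - snd c p"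
    using eventually_at_right_less[of "0::real"] by eventually_elim simp
  ultimately have "((\<lambda>t. snd c (?r t) - snd c p) \<longlongrightarrow> 0 *\<^sub>R coords c p v) ?F"
    by (rule Lim_transform_eventually)
  then have "((\<lambda>t. snd c (?r t) - snd c p) \<longlongrightarrow> 0) ?F" by simp
  then have "((\<lambda>t. snd c (?r t)) \<longlongrightarrow> snd c p) ?F" by (rule Lim_null[THEN iffD2])
  moreover have "isCont (chart_inv c) (snd c p)"
    using continuous_on_chart_inv[OF c(1)] open_chart_range[OF c(1)] c(2)
    by (simp add: continuous_on_eq_continuous_at)
  ultimately have "((\<lambda>t. chart_inv c (snd c (?r t))) \<longlongrightarrow> chart_inv c (snd c p)) ?F"
    by (rule isCont_tendsto_compose[rotated])
  moreover have "\<forall>\<^sub>F t in ?F. chart_inv c (snd c (?r t)) = ?r t"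
    using close by eventually_elim (simp add: chart_inv_chart[OF c(1)])
  ultimately have "((\<lambda>t. ?r t) \<longlongrightarrow> chart_inv c (snd c p)) ?F"
    by (rule Lim_transform_eventually)
  then have "((\<lambda>t. ?r t) \<longlongrightarrow> p) ?F" using c by (simp add: chart_inv_chart)
  then show "R p 0 = p" by (rule tendsto_unique[OF trivial_limit_at_right_real cont])
qed

end

section \<open>One step of the algorithm in a chart\<close>

context riemannian_manifold
begin

context
  fixes R :: "'m \<Rightarrow> 'e \<Rightarrow> 'm"
  assumes conn: "connected (UNIV :: 'm set)" and R: "retraction R" and R_C2: "Ck_on_tangent_bundle 2 R"
    and exp_dom: "\<And>p. \<exists>r>0. tangent_ball p r \<subseteq> exp_domain p"
begin

text \<open>\<open>R\<close> in bundle coordinates, with position and vector varying jointly: the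
  form in which \<open>Ck_on_tangent_bundle\<close> states regularity.\<close>

definition chart_retraction :: "('m, 'e) chart \<Rightarrow> 'e \<times> 'e \<Rightarrow> 'm" where
  "chart_retraction c = (\<lambda>(x, \<xi>). R (chart_inv c x) (of_coords c (chart_inv c x) \<xi>))"

lemma chart_retraction_coords:
  "c \<in> atlas \<Longrightarrow> p \<in> fst c \<Longrightarrow> chart_retraction c (snd c p, coords c p v) = R p v"
  by (simp add: chart_retraction_def chart_inv_chart of_coords_coords)

lemma Ck_chart_retraction: "c \<in> atlas \<Longrightarrow> Ck_map_on 2 (chart_retraction c) ((snd c ` fst c) \<times> UNIV)"
  using R_C2 unfolding Ck_on_tangent_bundle_def chart_retraction_def by blast

lemma continuous_on_chart_retraction:
  "c \<in> atlas \<Longrightarrow> continuous_on ((snd c ` fst c) \<times> UNIV) (chart_retraction c)"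
  using Ck_chart_retraction unfolding Ck_map_on_def by blast

lemma chart_retraction_tendsto:
  assumes c: "c \<in> atlas" "p \<in> fst c"
  shows "((\<lambda>t. R p (t *\<^sub>R v)) \<longlongrightarrow> R p 0) (at_right 0)"
proof -
  let ?D = "(snd c ` fst c) \<times> (UNIV :: 'e set)"
  have "open ?D" by (intro open_Times open_chart_range c open_UNIV)
  then have "isCont (chart_retraction c) (snd c p, 0)"
    using continuous_on_chart_retraction[OF c(1)] c(2) by (simp add: continuous_on_eq_continuous_at)
  moreover have "((\<lambda>t. (snd c p, t *\<^sub>R coords c p v)) \<longlongrightarrow> (snd c p, 0 *\<^sub>R coords c p v)) (at_right 0)"
    by (intro tendsto_intros)
  ultimately have "((\<lambda>t. chart_retraction c (snd c p, t *\<^sub>R coords c p v)) \<longlongrightarrow> chart_retraction c (snd c p, 0)) (at_right 0)"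
    using isCont_tendsto_compose by fastforce
  moreover have "chart_retraction c (snd c p, t *\<^sub>R coords c p v) = R p (t *\<^sub>R v)" for t
    using chart_retraction_coords[OF c, of "t *\<^sub>R v"] linear_cmul[OF linear_coords[OF c]] by simp
  moreover have "chart_retraction c (snd c p, 0) = R p 0"
    using chart_retraction_coords[OF c, of 0] linear_0[OF linear_coords[OF c]] by simp
  ultimately show ?thesis by simp
qed

lemma retraction_0: "R p 0 = p"
proof -
  obtain r where "r > 0" "tangent_ball p r \<subseteq> exp_domain p" using exp_dom by blast
  from retraction_first_order(1)[OF conn R this chart_at chart_retraction_tendsto[OF chart_at, of p 0]]
  show ?thesis .
qed

text \<open>Taylor's formula in bundle coordinates from \<open>(snd c p, 0)\<close> to
  \<open>(snd c p, coords c p v)\<close>, both in one compact ball, so that \<open>L\<close> serves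
  all base points and vectors at once. The increment points along the fibre, where the derivative is
  the identity.\<close>

lemma retraction_second_order:
  assumes c: "c \<in> atlas" "p0 \<in> fst c"
  obtains r L where "r > 0" "L \<ge> 0" "cball (snd c p0) r \<subseteq> snd c ` fst c"
    "\<And>p v. p \<in> fst c \<Longrightarrow> snd c p \<in> cball (snd c p0) r \<Longrightarrow> norm (coords c p v) \<le> r \<Longrightarrow>
       R p v \<in> fst c \<and> norm (snd c (R p v) - snd c p - coords c p v) \<le> L * (norm (coords c p v))\<^sup>2"
proof -
  let ?D = "(snd c ` fst c) \<times> (UNIV :: 'e set)"
  let ?f = "snd c \<circ> chart_retraction c"
  define W where "W = ?D \<inter> chart_retraction c -` fst c"
  have D: "open ?D" by (intro open_Times open_chart_range c open_UNIV)
  have W: "open W" unfolding W_def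
    by (intro continuous_open_preimage continuous_on_chart_retraction open_chart_dom c D)
  have C2: "Ck_on 2 ?f W"
    using Ck_chart_retraction[OF c(1)] c(1) unfolding Ck_map_on_def W_def by blast
  then obtain F where F: "\<And>y. y \<in> W \<Longrightarrow> (?f has_derivative F y) (at y)"
    by (auto simp: numeral_2_eq_2)
  have base: "chart_retraction c (snd c p, 0) = p" if "p \<in> fst c" for p
    using chart_retraction_coords[OF c(1) that, of 0] linear_0[OF linear_coords[OF c(1) that]] by (simp add: retraction_0)
  have in_W: "(snd c p, 0) \<in> W" if "p \<in> fst c" for p using that base by (auto simp: W_def)
  \<comment> \<open>The fibre derivative and the limit in \<open>retraction_first_order\<close> are
    limits of the same difference quotient.\<close>
  have F_fibre: "F (snd c p, 0) (0, \<xi>) = \<xi>" if p: "p \<in> fst c" for p \<xi>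
  proof -
    define v where "v = of_coords c p \<xi>"
    have v: "coords c p v = \<xi>" using coords_of_coords[OF c(1) p] by (simp add: v_def)
    have R_eq: "R p (t *\<^sub>R v) = chart_retraction c (snd c p, t *\<^sub>R \<xi>)" for t
      using chart_retraction_coords[OF c(1) p, of "t *\<^sub>R v"] linear_cmul[OF linear_coords[OF c(1) p]] v by simp
    obtain r where r: "r > 0" "tangent_ball p r \<subseteq> exp_domain p" using exp_dom by blast
    have lim: "((\<lambda>t. (?f (snd c p, t *\<^sub>R \<xi>) - snd c p) /\<^sub>R t) \<longlongrightarrow> \<xi>) (at_right 0)"
      using retraction_first_order(2)[OF conn R r c(1) p chart_retraction_tendsto[OF c(1) p, of v]]
      unfolding R_eq v by simp
    have "((\<lambda>t. (snd c p, t *\<^sub>R \<xi>)) has_vector_derivative (0, \<xi>)) (at 0)"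
      unfolding has_vector_derivative_def
      by (rule has_derivative_eq_rhs[OF has_derivative_Pair[OF has_derivative_const
            has_derivative_scaleR_left[OF has_derivative_ident]]]) auto
    then have "(?f \<circ> (\<lambda>t. (snd c p, t *\<^sub>R \<xi>)) has_vector_derivative F (snd c p, 0) (0, \<xi>)) (at 0)"
      by (rule vector_derivative_diff_chain_within[OF _ has_derivative_at_withinI])
        (simp only: scaleR_zero_left F[OF in_W[OF p]])
    then have "((\<lambda>t. ?f (snd c p, t *\<^sub>R \<xi>)) has_vector_derivative F (snd c p, 0) (0, \<xi>)) (at 0)"
      by (simp only: comp_def)
    from has_vector_derivative_quotient_at_right[OF this]
    have "((\<lambda>t. (?f (snd c p, t *\<^sub>R \<xi>) - snd c p) /\<^sub>R t) \<longlongrightarrow> F (snd c p, 0) (0, \<xi>)) (at_right 0)"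
      using base[OF p] by simp
    from tendsto_unique[OF _ this lim] show ?thesis by simp
  qed
  obtain \<rho> where \<rho>: "\<rho> > 0" "cball (snd c p0, 0) \<rho> \<subseteq> W"
    using W in_W[OF c(2)] by (meson open_contains_cball)
  obtain L where L: "L \<ge> 0" "\<And>x y. x \<in> cball (snd c p0, 0) \<rho> \<Longrightarrow> y \<in> cball (snd c p0, 0) \<rho> \<Longrightarrow>
      norm (?f y - ?f x - F x (y - x)) \<le> L * (norm (y - x))\<^sup>2"
    by (rule C2_Taylor[OF C2 F W compact_cball convex_cball \<rho>(2)]) (auto intro: that)
  have in_ball: "(x, \<xi>) \<in> cball (snd c p0, 0) \<rho>" if "x \<in> cball (snd c p0) (\<rho> / 2)" "norm \<xi> \<le> \<rho> / 2" for x \<xi>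
  proof -
    have "dist (snd c p0, 0) (x, \<xi>) \<le> dist (snd c p0) x + norm \<xi>"
      unfolding dist_Pair_Pair using sqrt_sum_squares_le_sum[of "dist (snd c p0) x" "dist 0 \<xi>"] by simp
    then show ?thesis using that by simp
  qed
  show thesis
  proof (rule that[of "\<rho> / 2" L])
    show "cball (snd c p0) (\<rho> / 2) \<subseteq> snd c ` fst c"
      using in_ball[of _ 0] \<rho> by (force simp: W_def)
    fix p v assume p: "p \<in> fst c" "snd c p \<in> cball (snd c p0) (\<rho> / 2)" "norm (coords c p v) \<le> \<rho> / 2"
    let ?\<xi> = "coords c p v"
    have 1: "(snd c p, ?\<xi>) \<in> cball (snd c p0, 0) \<rho>" "(snd c p, 0 :: 'e) \<in> cball (snd c p0, 0) \<rho>"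
      using in_ball[of "snd c p" "coords c p v"] in_ball[of "snd c p" 0] p \<rho>(1) by auto
    have "R p v \<in> fst c"
      using 1(1) \<rho>(2) chart_retraction_coords[OF c(1) p(1)] by (auto simp: W_def)
    moreover have "norm (snd c (R p v) - snd c p - ?\<xi>) \<le> L * (norm ?\<xi>)\<^sup>2"
      using L(2)[OF 1(2,1)] F_fibre[OF p(1)] base[OF p(1)] chart_retraction_coords[OF c(1) p(1)]
      by (simp add: norm_Pair)
    ultimately show "R p v \<in> fst c \<and> norm (snd c (R p v) - snd c p - ?\<xi>) \<le> L * (norm ?\<xi>)\<^sup>2" ..
  qed (use \<rho> L in auto)
qed

context
  fixes f :: "'m \<Rightarrow> real"
  assumes f: "Ck_fun_on 2 f UNIV"
begin

lemma f_Suc: "Ck_fun_on (Suc 1) f UNIV"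
  using f by (simp add: numeral_2_eq_2 del: Ck_on.simps)

abbreviation taylor_error :: "'m \<Rightarrow> 'e \<Rightarrow> real \<Rightarrow> real" where
  "taylor_error p v \<gamma> \<equiv> \<bar>f (R p (- \<gamma> *\<^sub>R v)) - f p + \<gamma> * differential f p v\<bar>"

text \<open>\<open>r\<close> and \<open>s\<close> restrict position and step size; \<open>L\<close>
  bounds the coordinate speed for the escape argument, \<open>M\<close> the second-order error for
  summability.\<close>

abbreviation step_bounds ::
  "real \<Rightarrow> ('m, 'e) chart \<Rightarrow> 'm \<Rightarrow> real \<Rightarrow> real \<Rightarrow> real \<Rightarrow> real \<Rightarrow> bool" where
  "step_bounds A c p0 r s L M \<equiv> \<forall>p v \<gamma>. p \<in> fst c \<longrightarrow> snd c p \<in> cball (snd c p0) r \<longrightarrow>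
     tangent_norm p v \<le> A \<longrightarrow> 0 < \<gamma> \<longrightarrow> \<gamma> \<le> s \<longrightarrow>
     R p (- \<gamma> *\<^sub>R v) \<in> fst c \<and> norm (snd c (R p (- \<gamma> *\<^sub>R v)) - snd c p) \<le> L * \<gamma> \<and>
     taylor_error p v \<gamma> \<le> M * \<gamma>\<^sup>2"

lemma step_in_chart:
  assumes c: "c \<in> atlas" "p0 \<in> fst c" and "A > 0"
  obtains r s L M where "r > 0" "s > 0" "L > 0" "M > 0" "cball (snd c p0) r \<subseteq> snd c ` fst c"
    "step_bounds A c p0 r s L M"
proof -
  obtain r L where r: "r > 0" "L \<ge> 0" "cball (snd c p0) r \<subseteq> snd c ` fst c"
    and step: "\<And>p v. p \<in> fst c \<Longrightarrow> snd c p \<in> cball (snd c p0) r \<Longrightarrow> norm (coords c p v) \<le> r \<Longrightarrow>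
       R p v \<in> fst c \<and> norm (snd c (R p v) - snd c p - coords c p v) \<le> L * (norm (coords c p v))\<^sup>2"
    by (rule retraction_second_order[OF c]) (rule that)
  let ?B = "cball (snd c p0) r"
  obtain m where m: "0 < m" "\<And>x v. x \<in> ?B \<Longrightarrow> m * (norm v)\<^sup>2 \<le> local_metric c x v v"
    by (rule local_metric_lower_bound[OF c(1) compact_cball r(3)]) (rule that)
  obtain L2 where L2: "L2 \<ge> 0" "\<And>x y. x \<in> ?B \<Longrightarrow> y \<in> ?B \<Longrightarrow>
      norm ((f \<circ> chart_inv c) y - (f \<circ> chart_inv c) x - chart_differential f c x (y - x)) \<le> L2 * (norm (y - x))\<^sup>2"
    by (rule C2_Taylor[OF Ck_fun_onD[OF f c(1)] chart_differential[OF f_Suc c(1)] open_chart_range[OF c(1)]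
          compact_cball convex_cball r(3)]) (auto intro: that)
  have "\<exists>b. \<forall>x\<in>?B. norm (chart_differential f c x i) \<le> b" for i
  proof -
    have "bounded ((\<lambda>x. chart_differential f c x i) ` ?B)"
      by (intro compact_imp_bounded compact_continuous_image compact_cball
          continuous_on_subset[OF continuous_on_chart_differential[OF f_Suc c(1)] r(3)])
    then show ?thesis by (auto simp: bounded_iff)
  qed
  then obtain b where b: "\<And>x i. x \<in> ?B \<Longrightarrow> norm (chart_differential f c x i) \<le> b i" by metis
  define K where "K = \<bar>\<Sum>i\<in>Basis. b i\<bar>"
  have K: "\<bar>chart_differential f c x v\<bar> \<le> K * norm v" if "x \<in> ?B" for x v
  proof -
    have "norm (chart_differential f c x v) \<le> (\<Sum>i\<in>Basis. b i) * norm v"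
      using that r(3) b by (intro norm_linear_le_Basis linear_chart_differential[OF f_Suc c(1)]) auto
    also have "\<dots> \<le> K * norm v" by (intro mult_right_mono) (auto simp: K_def)
    finally show ?thesis by simp
  qed
  \<comment> \<open>\<open>A'\<close> bounds the components of \<open>v\<close> in the chart,
    \<open>L'\<close> the coordinate displacement per unit of step size. \<open>s\<close> keeps the
    components of the step below \<open>r\<close> and the new point, started in the half ball,
    inside the full ball where the Taylor bound for \<open>f\<close> holds.\<close>
  define A' where "A' = A / sqrt m"
  have A': "A' > 0" using \<open>A > 0\<close> m(1) by (simp add: A'_def)
  define L' where "L' = (1 + L * r) * A'"
  have L': "L' > 0" using A' r(1,2) by (simp add: L'_def add_pos_nonneg)
  define s where "s = min (r / A') (r / 2 / L')"
  \<comment> \<open>Taylor remainder of \<open>f\<close> over the displacement, plus the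
    differential applied to the deviation of \<open>R\<close> from the straight step; the summand 1
    ensures positivity.\<close>
  define M where "M = L2 * L'\<^sup>2 + K * (L * A'\<^sup>2) + 1"
  have M: "M > 0" using L2(1) r(2) by (auto simp: M_def K_def intro!: add_nonneg_pos)
  show thesis
  proof (rule that[of "r / 2" s L' M])
    show "cball (snd c p0) (r / 2) \<subseteq> snd c ` fst c" using r(1,3) by (auto intro!: subset_trans[OF _ r(3)])
    show "s > 0" using A' L' r(1) by (simp add: s_def)
    show "step_bounds A c p0 (r / 2) s L' M"
    proof (intro allI impI)
      fix p v \<gamma> assume p: "p \<in> fst c" "snd c p \<in> cball (snd c p0) (r / 2)" and v: "tangent_norm p v \<le> A"
        and \<gamma>: "0 < \<gamma>" "\<gamma> \<le> s"
      have pB: "snd c p \<in> ?B" using p(2) r(1) by auto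
      define \<xi> where "\<xi> = coords c p (- \<gamma> *\<^sub>R v)"
      have \<xi>_eq: "\<xi> = - \<gamma> *\<^sub>R coords c p v" unfolding \<xi>_def by (rule linear_cmul[OF linear_coords[OF c(1) p(1)]])
      have "sqrt m * norm (coords c p v) = sqrt (m * (norm (coords c p v))\<^sup>2)" using m(1) by (simp add: real_sqrt_mult)
      also have "\<dots> \<le> tangent_norm p v"
        unfolding tangent_norm_coords[OF c(1) p(1)] by (intro real_sqrt_le_mono m(2) pB)
      finally have "norm (coords c p v) \<le> A'" using v m(1) by (simp add: A'_def field_simps)
      then have \<xi>: "norm \<xi> \<le> A' * \<gamma>" using \<gamma>(1) by (simp add: \<xi>_eq mult.commute)
      have "A' * \<gamma> \<le> r" using \<gamma>(2) A' by (simp add: s_def field_simps)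
      then have \<xi>r: "norm \<xi> \<le> r" using \<xi> by simp
      let ?q = "R p (- \<gamma> *\<^sub>R v)"
      have q: "?q \<in> fst c" "norm (snd c ?q - snd c p - \<xi>) \<le> L * (norm \<xi>)\<^sup>2"
        using step[OF p(1) pB, of "- \<gamma> *\<^sub>R v"] \<xi>r by (auto simp: \<xi>_def)
      have "norm (snd c ?q - snd c p) \<le> norm (snd c ?q - snd c p - \<xi>) + norm \<xi>"
        using norm_triangle_ineq[of "snd c ?q - snd c p - \<xi>" \<xi>] by simp
      also have "\<dots> \<le> L * (norm \<xi>)\<^sup>2 + norm \<xi>" using q(2) by simp
      also have "L * (norm \<xi>)\<^sup>2 \<le> L * (r * norm \<xi>)"
        unfolding power2_eq_square using \<xi>r r(2) by (intro mult_left_mono mult_right_mono) auto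
      also have "L * (r * norm \<xi>) + norm \<xi> = (1 + L * r) * norm \<xi>" by (simp add: algebra_simps)
      also have "\<dots> \<le> (1 + L * r) * (A' * \<gamma>)" using \<xi> r(1,2) by (intro mult_left_mono) auto
      finally have move: "norm (snd c ?q - snd c p) \<le> L' * \<gamma>" by (simp add: L'_def mult.assoc)
      have "L' * \<gamma> \<le> r / 2" using \<gamma>(2) L' by (simp add: s_def field_simps)
      then have qB: "snd c ?q \<in> ?B"
        using move p(2) dist_triangle[of "snd c p0" "snd c ?q" "snd c p"] by (simp add: dist_norm norm_minus_commute)
      have diff: "differential f p (- \<gamma> *\<^sub>R v) = chart_differential f c (snd c p) \<xi>"
        unfolding \<xi>_def by (rule differential_eq_chart_differential[OF f_Suc c(1) p(1)])
      have lin: "linear (chart_differential f c (snd c p))"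
        using p(1) by (intro linear_chart_differential[OF f_Suc c(1)]) auto
      have "f ?q - f p + \<gamma> * differential f p v = f ?q - f p - differential f p (- \<gamma> *\<^sub>R v)"
        by (simp only: linear_cmul[OF linear_differential[OF f_Suc]]) simp
      also have "\<dots> = (f ?q - f p - chart_differential f c (snd c p) (snd c ?q - snd c p))
         + chart_differential f c (snd c p) (snd c ?q - snd c p - \<xi>)"
        unfolding diff by (simp add: linear_diff[OF lin])
      also have "\<bar>\<dots>\<bar> \<le> L2 * (norm (snd c ?q - snd c p))\<^sup>2 + K * norm (snd c ?q - snd c p - \<xi>)"
        using L2(2)[OF pB qB] K[OF pB, of "snd c ?q - snd c p - \<xi>"] chart_inv_chart[OF c(1)] p(1) q(1)
        by (auto simp: abs_le_iff)
      also have "\<dots> \<le> L2 * (L' * \<gamma>)\<^sup>2 + K * (L * (A' * \<gamma>)\<^sup>2)"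
      proof (intro add_mono mult_left_mono power_mono)
        show "norm (snd c ?q - snd c p - \<xi>) \<le> L * (A' * \<gamma>)\<^sup>2"
          using q(2) \<xi> r(2) by (intro order_trans[OF q(2)] mult_left_mono power_mono) auto
      qed (use L2 move in \<open>auto simp: K_def\<close>)
      also have "\<dots> \<le> M * \<gamma>\<^sup>2" by (simp add: M_def power_mult_distrib algebra_simps)
      finally show "?q \<in> fst c \<and> norm (snd c ?q - snd c p) \<le> L' * \<gamma> \<and>
         \<bar>f ?q - f p + \<gamma> * differential f p v\<bar> \<le> M * \<gamma>\<^sup>2" using q(1) move by blast
    qed
  qed (use r L' M in auto)
qed

text \<open>A finite subcover of \<open>K\<close> by the neighbourhoods from
  \<open>step_in_chart\<close>. The inserted 1 and the added 1 take care of an empty subcover; the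
  sum replaces a maximum of constants.\<close>

lemma step_uniform:
  assumes K: "compact K" and "A > 0"
  obtains s M where "s > 0" "M > 0"
    "\<And>p v \<gamma>. p \<in> K \<Longrightarrow> tangent_norm p v \<le> A \<Longrightarrow> 0 < \<gamma> \<Longrightarrow> \<gamma> \<le> s \<Longrightarrow>
       taylor_error p v \<gamma> \<le> M * \<gamma>\<^sup>2"
proof -
  have "\<exists>U s M. open U \<and> p0 \<in> U \<and> s > 0 \<and> M > 0 \<and> (\<forall>p\<in>U. \<forall>v \<gamma>. tangent_norm p v \<le> A \<longrightarrow> 0 < \<gamma> \<longrightarrow> \<gamma> \<le> s \<longrightarrow>
       taylor_error p v \<gamma> \<le> M * \<gamma>\<^sup>2)" for p0
  proof -
    let ?c = "chart_at p0"
    note c = chart_at[of p0]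
    obtain r s L M where r: "r > 0" "s > 0" "L > 0" "M > 0" "cball (snd ?c p0) r \<subseteq> snd ?c ` fst ?c"
      and step: "step_bounds A ?c p0 r s L M"
      by (rule step_in_chart[OF c \<open>A > 0\<close>]) (rule that)
    have "open (fst ?c \<inter> snd ?c -` ball (snd ?c p0) r)" by (rule open_chart_vimage[OF c(1)]) simp
    then show ?thesis
      using r c step by (intro exI[of _ "fst ?c \<inter> snd ?c -` ball (snd ?c p0) r"] exI[of _ s] exI[of _ M]) auto
  qed
  then obtain U s M where U: "\<And>p0. open (U p0)" "\<And>p0. p0 \<in> U p0" "\<And>p0. s p0 > 0" "\<And>p0. M p0 > 0"
    and step: "\<And>p0 p v \<gamma>. p \<in> U p0 \<Longrightarrow> tangent_norm p v \<le> A \<Longrightarrow> 0 < \<gamma> \<Longrightarrow> \<gamma> \<le> s p0 \<Longrightarrow>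
       taylor_error p v \<gamma> \<le> M p0 * \<gamma>\<^sup>2"
    by metis
  obtain T where T: "T \<subseteq> K" "finite T" "K \<subseteq> (\<Union>p\<in>T. U p)"
    by (rule compactE_image[OF K, of K U]) (use U in auto)
  show thesis
  proof (rule that[of "Min (insert 1 (s ` T))" "1 + (\<Sum>p\<in>T. M p)"])
    show "0 < Min (insert 1 (s ` T))" using T(2) U(3) by simp
    show "0 < 1 + (\<Sum>p\<in>T. M p)" using U(4) by (intro add_pos_nonneg sum_nonneg) (auto intro: less_imp_le)
    fix p v \<gamma> assume p: "p \<in> K" "tangent_norm p v \<le> A" "0 < \<gamma>" "\<gamma> \<le> Min (insert 1 (s ` T))"
    obtain p0 where p0: "p0 \<in> T" "p \<in> U p0" using p(1) T(3) by blast
    have "\<gamma> \<le> s p0" using p(4) p0(1) T(2) by simp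
    then have "taylor_error p v \<gamma> \<le> M p0 * \<gamma>\<^sup>2"
      by (intro step p0 p)
    also have "M p0 \<le> (\<Sum>p\<in>T. M p)" using p0(1) T(2) U(4) by (intro member_le_sum) (auto intro: less_imp_le)
    finally show "taylor_error p v \<gamma> \<le> (1 + (\<Sum>p\<in>T. M p)) * \<gamma>\<^sup>2"
      by (auto simp: mult_right_mono algebra_simps intro: order_trans)
  qed
qed

section \<open>Convergence along a single trajectory\<close>

context
  fixes K :: "'m set" and A :: real and \<gamma> :: "nat \<Rightarrow> real" and p :: "nat \<Rightarrow> 'm" and h :: "nat \<Rightarrow> 'e"
  assumes K: "compact K" and A: "A > 0"
    and \<gamma>: "\<And>t. \<gamma> t > 0" "summable (\<lambda>t. (\<gamma> t)\<^sup>2)" "filterlim (\<lambda>n. \<Sum>t<n. \<gamma> t) at_top sequentially"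
    and p: "\<And>t. p t \<in> K" "\<And>t. p (Suc t) = R (p t) (- \<gamma> t *\<^sub>R h t)"
    and h: "\<And>t. tangent_norm (p t) (h t) \<le> A"
    and noise: "convergent (\<lambda>n. \<Sum>t<n. \<gamma> t * (differential f (p t) (h t) - g (p t) (gradient f (p t)) (gradient f (p t))))"
begin

definition sq_grad :: "'m \<Rightarrow> real" where
  "sq_grad q = g q (gradient f q) (gradient f q)"

lemma \<gamma>_eventually_le: "s > 0 \<Longrightarrow> \<forall>\<^sub>F t in sequentially. \<gamma> t \<le> s"
proof -
  assume "s > 0"
  have "(\<lambda>t. sqrt ((\<gamma> t)\<^sup>2)) \<longlonglongrightarrow> sqrt 0" by (intro tendsto_real_sqrt summable_LIMSEQ_zero \<gamma>(2))
  then have "\<gamma> \<longlonglongrightarrow> 0" using \<gamma>(1) by (simp add: less_imp_le)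
  from order_tendstoD(2)[OF this \<open>s > 0\<close>] show ?thesis by eventually_elim simp
qed

lemma cost_converges: "convergent (\<lambda>t. f (p t))"
  and summable_sq_grad: "summable (\<lambda>t. \<gamma> t * sq_grad (p t))"
proof -
  obtain s M where s: "s > 0" "M > 0" and step: "\<And>q v \<delta>. q \<in> K \<Longrightarrow> tangent_norm q v \<le> A \<Longrightarrow> 0 < \<delta> \<Longrightarrow> \<delta> \<le> s \<Longrightarrow>
       taylor_error q v \<delta> \<le> M * \<delta>\<^sup>2"
    by (rule step_uniform[OF K A]) (rule that)
  define Y where "Y t = differential f (p t) (h t) - sq_grad (p t)" for t
  define e where "e t = f (p (Suc t)) - f (p t) + \<gamma> t * differential f (p t) (h t)" for t
  have "\<forall>\<^sub>F t in sequentially. norm (e t) \<le> M * (\<gamma> t)\<^sup>2"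
    using \<gamma>_eventually_le[OF s(1)]
    by eventually_elim (use step p h \<gamma>(1) in \<open>simp add: e_def\<close>)
  then have "summable e" by (rule summable_comparison_test_ev) (intro summable_mult \<gamma>(2))
  then have e_conv: "convergent (\<lambda>n. \<Sum>t<n. e t)" by (simp add: summable_iff_convergent)
  have Y_conv: "convergent (\<lambda>n. \<Sum>t<n. \<gamma> t * Y t)" using noise by (simp add: Y_def sq_grad_def)
  \<comment> \<open>Telescoping, with the mean and the noise part of each decrease separated. Noise
    and error sums converge, so bounds on \<open>f\<close> bound the sum of nonnegative
    terms.\<close>
  have f_eq: "f (p n) = f (p 0) - (\<Sum>t<n. \<gamma> t * sq_grad (p t)) - (\<Sum>t<n. \<gamma> t * Y t) + (\<Sum>t<n. e t)" for n
    by (induction n) (simp_all add: Y_def e_def algebra_simps)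
  have "continuous_on K f"
  proof -
    have "isCont f q" for q
    proof -
      let ?c = "chart_at q"
      note c = chart_at[of q]
      have "isCont (f \<circ> chart_inv ?c) (snd ?c q)"
        using chart_differential[OF f_Suc c(1), of "snd ?c q"] c(2) has_derivative_continuous by blast
      moreover have "isCont (snd ?c) q"
        using continuous_on_chart[OF c(1)] open_chart_dom[OF c(1)] c(2) by (simp add: continuous_on_eq_continuous_at)
      ultimately have "isCont ((f \<circ> chart_inv ?c) \<circ> snd ?c) q" by (rule continuous_at_compose[rotated])
      moreover have "\<forall>\<^sub>F q' in nhds q. ((f \<circ> chart_inv ?c) \<circ> snd ?c) q' = f q'"
        using eventually_nhds_in_open[OF open_chart_dom[OF c(1)] c(2)]
        by eventually_elim (simp add: chart_inv_chart[OF c(1)])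
      ultimately show "isCont f q" by (rule isCont_cong[THEN iffD1, rotated])
    qed
    then show ?thesis by (simp add: continuous_at_imp_continuous_on)
  qed
  then have "bounded (f ` K)" by (intro compact_imp_bounded compact_continuous_image K)
  then obtain B1 where B1: "\<And>t. \<bar>f (p t)\<bar> \<le> B1" using p(1) by (auto simp: bounded_iff)
  obtain B2 where B2: "\<And>n. \<bar>\<Sum>t<n. \<gamma> t * Y t\<bar> \<le> B2"
    using convergent_imp_Bseq[OF Y_conv] by (auto simp: Bseq_def)
  obtain B3 where B3: "\<And>n. \<bar>\<Sum>t<n. e t\<bar> \<le> B3"
    using convergent_imp_Bseq[OF e_conv] by (auto simp: Bseq_def)
  show sum: "summable (\<lambda>t. \<gamma> t * sq_grad (p t))"
  proof (rule bounded_imp_summable)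
    show "0 \<le> \<gamma> t * sq_grad (p t)" for t using \<gamma>(1)[of t] metric_nonneg by (simp add: sq_grad_def)
    show "(\<Sum>t\<le>n. \<gamma> t * sq_grad (p t)) \<le> 2 * B1 + B2 + B3" for n
      using f_eq[of "Suc n"] B1[of 0] B1[of "Suc n"] B2[of "Suc n"] B3[of "Suc n"]
      by (simp only: lessThan_Suc_atMost abs_le_iff) linarith
  qed
  have "convergent (\<lambda>n. \<Sum>t<n. \<gamma> t * sq_grad (p t))" using sum by (simp add: summable_iff_convergent)
  then have conv: "convergent (\<lambda>n. f (p 0) - (\<Sum>t<n. \<gamma> t * sq_grad (p t)) - (\<Sum>t<n. \<gamma> t * Y t) + (\<Sum>t<n. e t))"
    by (intro convergent_add convergent_diff convergent_const e_conv Y_conv)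
  show "convergent (\<lambda>t. f (p t))"
    by (rule back_subst[of convergent, OF conv]) (rule ext, rule f_eq[symmetric])
qed

text \<open>\<open>eventually_far\<close> for the coordinate distance to \<open>q\<close>: near
  \<open>q\<close> the squared gradient stays above a positive constant by comparison with the
  continuous \<open>differential_sq\<close>.\<close>

lemma eventually_avoids_noncritical:
  assumes "sq_grad q > 0"
  obtains U where "open U" "q \<in> U" "\<forall>\<^sub>F t in sequentially. p t \<notin> U"
proof -
  let ?c = "chart_at q"
  note c = chart_at[of q]
  let ?N = "differential_sq f ?c"
  obtain r s L M where r: "r > 0" "s > 0" "L > 0" "M > 0" "cball (snd ?c q) r \<subseteq> snd ?c ` fst ?c"
    and step: "step_bounds A ?c q r s L M"
    by (rule step_in_chart[OF c A]) (rule that)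
  obtain m1 m2 where m: "0 < m1" "0 < m2"
    "\<And>p. p \<in> fst ?c \<Longrightarrow> snd ?c p \<in> cball (snd ?c q) r \<Longrightarrow>
       m1 * differential_sq f ?c (snd ?c p) \<le> g p (gradient f p) (gradient f p)"
    "\<And>p. p \<in> fst ?c \<Longrightarrow> snd ?c p \<in> cball (snd ?c q) r \<Longrightarrow>
       g p (gradient f p) (gradient f p) \<le> m2 * differential_sq f ?c (snd ?c p)"
    by (rule gradient_comparison[OF f_Suc c(1) compact_cball r(5)]) (rule that)
  have "sq_grad q \<le> m2 * ?N (snd ?c q)" unfolding sq_grad_def using c(2) r(1) by (intro m(4)) auto
  then have N0: "?N (snd ?c q) > 0" using assms m(2) by (metis dual_order.strict_trans1 zero_less_mult_pos)
  from isCont_differential_sq[OF f_Suc c]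
  have "\<forall>\<^sub>F x in nhds (snd ?c q). ?N x > ?N (snd ?c q) / 2"
    using N0 by (intro order_tendstoD(1)[OF isCont_tendsto_nhds]) auto
  then obtain d where d: "d > 0" "\<And>x. dist x (snd ?c q) < d \<Longrightarrow> ?N x > ?N (snd ?c q) / 2"
    unfolding eventually_nhds_metric by blast
  define r' where "r' = min r d"
  have r': "r' > 0" "r' \<le> r" using r(1) d(1) by (auto simp: r'_def)
  \<comment> \<open>Off the chart domain the coordinate is meaningless; the value \<open>r'\<close>
    counts such points as far, so that nothing has to be checked there.\<close>
  define \<rho> where "\<rho> t = (if p t \<in> fst ?c then norm (snd ?c (p t) - snd ?c q) else r')" for t
  have "\<forall>\<^sub>F t in sequentially. \<rho> t < r' \<longrightarrow> sq_grad (p t) \<ge> m1 * (?N (snd ?c q) / 2) \<and> \<rho> (Suc t) \<le> \<rho> t + L * \<gamma> t"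
    using \<gamma>_eventually_le[OF r(2)]
  proof eventually_elim
    case (elim t)
    show ?case
    proof
      assume lt: "\<rho> t < r'"
      then have pt: "p t \<in> fst ?c" "norm (snd ?c (p t) - snd ?c q) < r'" by (auto simp: \<rho>_def split: if_splits)
      then have B: "snd ?c (p t) \<in> cball (snd ?c q) r" using r'(2) by (auto simp: dist_norm norm_minus_commute)
      have "?N (snd ?c (p t)) > ?N (snd ?c q) / 2" using pt(2) by (intro d(2)) (auto simp: r'_def dist_norm)
      then have "m1 * (?N (snd ?c q) / 2) \<le> m1 * ?N (snd ?c (p t))" using m(1) by simp
      also have "\<dots> \<le> sq_grad (p t)" unfolding sq_grad_def by (intro m(3) pt B)
      finally have 1: "sq_grad (p t) \<ge> m1 * (?N (snd ?c q) / 2)" .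
      have S: "p (Suc t) \<in> fst ?c" "norm (snd ?c (p (Suc t)) - snd ?c (p t)) \<le> L * \<gamma> t"
        using step[rule_format, OF pt(1) B h \<gamma>(1) elim] by (simp_all add: p(2))
      then have "\<rho> (Suc t) \<le> \<rho> t + L * \<gamma> t"
        using norm_triangle_ineq[of "snd ?c (p (Suc t)) - snd ?c (p t)" "snd ?c (p t) - snd ?c q"] pt(1)
        by (simp add: \<rho>_def)
      with 1 show "sq_grad (p t) \<ge> m1 * (?N (snd ?c q) / 2) \<and> \<rho> (Suc t) \<le> \<rho> t + L * \<gamma> t" ..
    qed
  qed
  note near = this
  have "m1 * (?N (snd ?c q) / 2) > 0" using N0 m(1) by simp
  moreover have "0 \<le> sq_grad (p t)" for t by (simp add: sq_grad_def metric_nonneg)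
  ultimately have ev: "\<forall>\<^sub>F t in sequentially. \<rho> t \<ge> r' / 2"
    using eventually_far[OF \<gamma>(1,3) _ summable_sq_grad _ r'(1) r(3) near] by blast
  show thesis
  proof (rule that)
    show "open (fst ?c \<inter> snd ?c -` ball (snd ?c q) (r' / 2))" by (rule open_chart_vimage[OF c(1)]) simp
    show "q \<in> fst ?c \<inter> snd ?c -` ball (snd ?c q) (r' / 2)" using c r'(1) by simp
    show "\<forall>\<^sub>F t in sequentially. p t \<notin> fst ?c \<inter> snd ?c -` ball (snd ?c q) (r' / 2)"
      using ev by eventually_elim (auto simp: \<rho>_def dist_norm norm_minus_commute)
  qed
qed

text \<open>Comparability with a continuous function controls the squared gradient near its zeros,
  which suffices because the trajectory eventually leaves neighbourhoods of all other
  points.\<close>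

lemma sq_grad_small_near_critical:
  assumes "sq_grad q = 0" "\<epsilon> > 0"
  obtains U where "open U" "q \<in> U" "\<And>q'. q' \<in> U \<Longrightarrow> sq_grad q' < \<epsilon>"
proof -
  let ?c = "chart_at q"
  note c = chart_at[of q]
  let ?N = "differential_sq f ?c"
  obtain r where r: "r > 0" "cball (snd ?c q) r \<subseteq> snd ?c ` (fst ?c \<inter> UNIV)"
    by (rule chart_nhd[OF c open_UNIV UNIV_I]) (rule that)
  obtain m1 m2 where m: "0 < m1" "0 < m2"
    "\<And>p. p \<in> fst ?c \<Longrightarrow> snd ?c p \<in> cball (snd ?c q) r \<Longrightarrow>
       m1 * differential_sq f ?c (snd ?c p) \<le> g p (gradient f p) (gradient f p)"
    "\<And>p. p \<in> fst ?c \<Longrightarrow> snd ?c p \<in> cball (snd ?c q) r \<Longrightarrow>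
       g p (gradient f p) (gradient f p) \<le> m2 * differential_sq f ?c (snd ?c p)"
    by (rule gradient_comparison[OF f_Suc c(1) compact_cball r(2)[unfolded Int_UNIV_right]]) (rule that)
  have "m1 * ?N (snd ?c q) \<le> sq_grad q" unfolding sq_grad_def using c(2) r(1) by (intro m(3)) auto
  then have N0: "?N (snd ?c q) < \<epsilon> / m2" using assms m by (simp add: mult_le_0_iff) (smt (verit) divide_pos_pos)
  from isCont_differential_sq[OF f_Suc c]
  have "\<forall>\<^sub>F x in nhds (snd ?c q). ?N x < \<epsilon> / m2"
    using N0 by (intro order_tendstoD(2)[OF isCont_tendsto_nhds]) auto
  then obtain d where d: "d > 0" "\<And>x. dist x (snd ?c q) < d \<Longrightarrow> ?N x < \<epsilon> / m2"
    unfolding eventually_nhds_metric by blast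
  let ?U = "fst ?c \<inter> snd ?c -` ball (snd ?c q) (min r d)"
  show thesis
  proof (rule that)
    show "open ?U" by (rule open_chart_vimage[OF c(1)]) simp
    show "q \<in> ?U" using c r(1) d(1) by simp
    fix q' assume q': "q' \<in> ?U"
    have "sq_grad q' \<le> m2 * ?N (snd ?c q')" unfolding sq_grad_def using q' by (intro m(4)) auto
    also have "\<dots> < m2 * (\<epsilon> / m2)" using q' m(2) d(2)[of "snd ?c q'"] by (intro mult_strict_left_mono) (auto simp: dist_commute)
    finally show "sq_grad q' < \<epsilon>" using m(2) by simp
  qed
qed

text \<open>Every point has a neighbourhood that is harmless or eventually avoided; compactness of
  \<open>K\<close> reduces these eventual statements to finitely many.\<close>

lemma sq_grad_tendsto_0: "(\<lambda>t. sq_grad (p t)) \<longlonglongrightarrow> 0"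
proof (rule order_tendstoI)
  fix a :: real assume "a < 0"
  have "a < sq_grad (p t)" for t
    using \<open>a < 0\<close> metric_nonneg[of "p t" "gradient f (p t)"] by (simp add: sq_grad_def)
  then show "\<forall>\<^sub>F t in sequentially. a < sq_grad (p t)" by simp
next
  fix \<epsilon> :: real assume \<epsilon>: "0 < \<epsilon>"
  have "\<exists>U. open U \<and> q \<in> U \<and> (\<forall>\<^sub>F t in sequentially. p t \<in> U \<longrightarrow> sq_grad (p t) < \<epsilon>)" for q
  proof (cases "sq_grad q = 0")
    case True
    obtain U where U: "open U" "q \<in> U" "\<And>q'. q' \<in> U \<Longrightarrow> sq_grad q' < \<epsilon>"
      by (rule sq_grad_small_near_critical[OF True \<epsilon>]) (rule that)
    then show ?thesis by (intro exI[of _ U]) auto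
  next
    case False
    then have "sq_grad q > 0" using metric_nonneg[of q "gradient f q"] by (simp add: sq_grad_def)
    then obtain U where U: "open U" "q \<in> U" "\<forall>\<^sub>F t in sequentially. p t \<notin> U"
      by (rule eventually_avoids_noncritical)
    from U(3) have "\<forall>\<^sub>F t in sequentially. p t \<in> U \<longrightarrow> sq_grad (p t) < \<epsilon>"
      by eventually_elim simp
    then show ?thesis using U by blast
  qed
  then obtain U where U: "\<And>q. open (U q)" "\<And>q. q \<in> U q"
    "\<And>q. \<forall>\<^sub>F t in sequentially. p t \<in> U q \<longrightarrow> sq_grad (p t) < \<epsilon>" by metis
  obtain T where T: "T \<subseteq> K" "finite T" "K \<subseteq> (\<Union>q\<in>T. U q)"
    by (rule compactE_image[OF K, of K U]) (use U in auto)
  have "\<forall>\<^sub>F t in sequentially. \<forall>q\<in>T. p t \<in> U q \<longrightarrow> sq_grad (p t) < \<epsilon>"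
    by (rule eventually_ball_finite[OF T(2)]) (use U(3) in blast)
  then show "\<forall>\<^sub>F t in sequentially. sq_grad (p t) < \<epsilon>"
    by eventually_elim (use T(3) p(1) in blast)
qed

lemma gradient_norm_tendsto_0: "(\<lambda>t. tangent_norm (p t) (gradient f (p t))) \<longlonglongrightarrow> 0"
  using tendsto_real_sqrt[OF sq_grad_tendsto_0] by (simp add: tangent_norm_def sq_grad_def)

end

end

end

end

section \<open>Measurability\<close>

context smooth_manifold
begin

text \<open>Measurability is glued over countably many pieces; second countability provides them by
  Lindelof's theorem.\<close>

lemma countable_atlas:
  obtains \<C> where "\<C> \<subseteq> atlas" "countable \<C>" "(\<Union>c\<in>\<C>. fst c) = UNIV"
proof -
  obtain F where F: "F \<subseteq> fst ` atlas" "countable F" "\<Union>F = \<Union>(fst ` atlas)"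
    by (rule Lindelof[of "fst ` atlas"]) (use open_chart_dom in blast)+
  obtain \<C> where "countable \<C>" "\<C> \<subseteq> atlas" "F = fst ` \<C>"
    using countable_subset_image[of F fst atlas] F(1,2) by blast
  then show thesis using that F(3) atlas_cover by auto
qed

lemma measurable_if_measurable_on_charts:
  assumes "\<And>c. c \<in> atlas \<Longrightarrow> f \<in> restrict_space (P \<Otimes>\<^sub>M borel) (space P \<times> fst c) \<rightarrow>\<^sub>M N"
  shows "f \<in> P \<Otimes>\<^sub>M (borel :: 'm measure) \<rightarrow>\<^sub>M N"
proof -
  obtain \<C> where C: "\<C> \<subseteq> atlas" "countable \<C>" "(\<Union>c\<in>\<C>. fst c) = UNIV" by (rule countable_atlas)
  show ?thesis
  proof (rule measurable_piecewise_restrict[of "(\<lambda>c. space P \<times> fst c) ` \<C>"])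
    show "countable ((\<lambda>c. space P \<times> fst c) ` \<C>)" using C(2) by simp
    show "space (P \<Otimes>\<^sub>M borel) \<subseteq> \<Union> ((\<lambda>c. space P \<times> fst c) ` \<C>)"
      using C(3) by (auto simp: space_pair_measure)
    fix S assume "S \<in> (\<lambda>c. space P \<times> fst c) ` \<C>"
    then obtain c where c: "c \<in> atlas" "S = space P \<times> fst c" using C(1) by blast
    have "space P \<times> fst c \<in> sets (P \<Otimes>\<^sub>M borel)"
      using open_chart_dom[OF c(1)] by (intro pair_measureI sets.top borel_open)
    then show "S \<inter> space (P \<Otimes>\<^sub>M borel) \<in> sets (P \<Otimes>\<^sub>M borel)" unfolding c(2) by (rule sets.Int) simp
    show "f \<in> restrict_space (P \<Otimes>\<^sub>M borel) S \<rightarrow>\<^sub>M N" unfolding c(2) by (rule assms[OF c(1)])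
  qed
qed

text \<open>Measurability of \<open>H\<close> is given through chart components, so it passes to any
  quantity that is, in each chart, a continuous function of position and components; gluing does the
  rest.\<close>

lemma measurable_tangent_field_compose:
  fixes \<phi> :: "('m, 'e) chart \<Rightarrow> 'e \<times> 'e \<Rightarrow> 'b::topological_space"
  assumes H: "measurable_tangent_field P H"
    and \<phi>: "\<And>c. c \<in> atlas \<Longrightarrow> continuous_on ((snd c ` fst c) \<times> UNIV) (\<phi> c)"
    and F: "\<And>c s q. c \<in> atlas \<Longrightarrow> q \<in> fst c \<Longrightarrow> F (s, q) = \<phi> c (snd c q, coords c q (H s q))"
  shows "F \<in> borel_measurable (P \<Otimes>\<^sub>M borel)"
proof (rule measurable_if_measurable_on_charts)
  fix c assume c: "c \<in> atlas"
  let ?M = "restrict_space (P \<Otimes>\<^sub>M (borel :: 'm measure)) (space P \<times> fst c)"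
  let ?D = "(snd c ` fst c) \<times> (UNIV :: 'e set)"
  have space: "space ?M = space P \<times> fst c" by (auto simp: space_restrict_space space_pair_measure)
  have "snd \<in> ?M \<rightarrow>\<^sub>M restrict_space borel (fst c)"
    by (rule measurable_restrict_space3) auto
  then have 1: "(\<lambda>x. snd c (snd x)) \<in> borel_measurable ?M"
    by (rule measurable_compose[OF _ borel_measurable_continuous_on_restrict[OF continuous_on_chart[OF c]]])
  have "(\<lambda>(s, q). coords c q (H s q)) \<in> borel_measurable ?M"
    using H c by (auto simp: measurable_tangent_field_def)
  then have "(\<lambda>x. (snd c (snd x), (\<lambda>(s, q). coords c q (H s q)) x)) \<in> borel_measurable ?M"
    by (intro borel_measurable_Pair 1)
  then have "(\<lambda>x. (snd c (snd x), (\<lambda>(s, q). coords c q (H s q)) x)) \<in> ?M \<rightarrow>\<^sub>M restrict_space borel ?D"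
    by (rule measurable_restrict_space2[rotated]) (auto simp: space)
  then have "(\<lambda>x. \<phi> c (snd c (snd x), (\<lambda>(s, q). coords c q (H s q)) x)) \<in> borel_measurable ?M"
    by (rule measurable_compose[OF _ borel_measurable_continuous_on_restrict[OF \<phi>[OF c]]])
  then show "F \<in> borel_measurable ?M"
    by (rule measurable_cong[THEN iffD1, rotated]) (auto simp: space F[OF c])
qed

end

context riemannian_manifold
begin

lemma retraction_step_measurable:
  assumes H: "measurable_tangent_field P H" and R: "Ck_on_tangent_bundle n R"
  shows "(\<lambda>(s, q). R q (a *\<^sub>R H s q)) \<in> P \<Otimes>\<^sub>M borel \<rightarrow>\<^sub>M borel"
proof (rule measurable_tangent_field_compose[OF H])
  let ?\<phi> = "\<lambda>c (x, \<xi>). R (chart_inv c x) (of_coords c (chart_inv c x) (a *\<^sub>R \<xi>))"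
  fix c assume c: "c \<in> atlas"
  have "continuous_on ((snd c ` fst c) \<times> UNIV) (\<lambda>(x, \<xi>). R (chart_inv c x) (of_coords c (chart_inv c x) \<xi>))"
    using R c by (auto simp: Ck_on_tangent_bundle_def Ck_map_on_def)
  then have "continuous_on ((snd c ` fst c) \<times> UNIV)
      (\<lambda>y. (\<lambda>(x, \<xi>). R (chart_inv c x) (of_coords c (chart_inv c x) \<xi>)) (fst y, a *\<^sub>R snd y))"
    by (rule continuous_on_compose2) (auto intro!: continuous_intros)
  then show "continuous_on ((snd c ` fst c) \<times> UNIV) (?\<phi> c)" by (simp add: split_def)
  fix s q assume "q \<in> fst c"
  then show "(\<lambda>(s, q). R q (a *\<^sub>R H s q)) (s, q) = ?\<phi> c (snd c q, coords c q (H s q))"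
    using c by (simp add: chart_inv_chart linear_cmul[OF linear_coords, symmetric] of_coords_coords)
qed

lemma differential_measurable:
  assumes H: "measurable_tangent_field P H" and f: "Ck_fun_on (Suc n) f UNIV"
  shows "(\<lambda>(s, q). differential f q (H s q)) \<in> borel_measurable (P \<Otimes>\<^sub>M borel)"
proof (rule measurable_tangent_field_compose[OF H])
  let ?\<phi> = "\<lambda>c (x, \<xi>). \<Sum>i\<in>Basis. (\<xi> \<bullet> i) * chart_differential f c x i"
  fix c assume c: "c \<in> atlas"
  have "continuous_on ((snd c ` fst c) \<times> (UNIV :: 'e set)) (\<lambda>y. chart_differential f c (fst y) i)" for i
    by (rule continuous_on_compose2[OF continuous_on_chart_differential[OF f c]]) (auto intro: continuous_intros)
  then show "continuous_on ((snd c ` fst c) \<times> UNIV) (?\<phi> c)"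
    unfolding split_def by (intro continuous_intros)
  fix s q assume q: "q \<in> fst c"
  let ?x = "snd c q" and ?v = "coords c q (H s q)"
  have lin: "linear (chart_differential f c ?x)" using q by (intro linear_chart_differential[OF f c]) auto
  show "(\<lambda>(s, q). differential f q (H s q)) (s, q) = ?\<phi> c (?x, ?v)"
    using linear_functional_Basis[OF lin, of ?v] by (simp add: differential_eq_chart_differential[OF f c q])
qed

text \<open>Expand the forms at \<open>u + v\<close> and \<open>u - v\<close>. This arithmetic-mean
  version of Cauchy-Schwarz avoids square roots.\<close>

lemma abs_metric_le: "\<bar>g p u v\<bar> \<le> (g p u u + g p v v) / 2"
proof -
  have "0 \<le> g p (u + v) (u + v)" "0 \<le> g p (u - v) (u - v)" by (rule metric_nonneg)+
  then show ?thesis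
    using metric_sym[of p v u]
    by (auto simp: bilinear_ladd[OF metric_bilinear] bilinear_radd[OF metric_bilinear]
        bilinear_lsub[OF metric_bilinear] bilinear_rsub[OF metric_bilinear])
qed

lemma injectivity_radius_posD:
  assumes "0 < injectivity_radius p"
  shows "\<exists>r>0. tangent_ball p r \<subseteq> exp_domain p"
  using assms unfolding injectivity_radius_def by (auto simp: less_Sup_iff)

end

theorem theorem2:
  fixes atlas :: "('m::{t2_space, second_countable_topology}, 'e::euclidean_space) chart set"
    and g :: "'m \<Rightarrow> 'e \<Rightarrow> 'e \<Rightarrow> real"
    and I :: real
    and P :: "'z measure"
    and Q :: "'z \<Rightarrow> 'm \<Rightarrow> real"
    and C :: "'m \<Rightarrow> real"
    and H :: "'z \<Rightarrow> 'm \<Rightarrow> 'e"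
    and \<Omega> :: "'a measure"
    and z :: "nat \<Rightarrow> 'a \<Rightarrow> 'z"
    and R :: "'m \<Rightarrow> 'e \<Rightarrow> 'm"
    and \<gamma> :: "nat \<Rightarrow> real"
    and w :: "nat \<Rightarrow> 'a \<Rightarrow> 'm"
    and w0 :: 'm
    and K :: "'m set"
    and A :: real
  assumes manifold: "riemannian_manifold atlas g" "connected (UNIV :: 'm set)"
    and injectivity: "I > 0" "\<And>p. ereal I \<le> riemannian_manifold.injectivity_radius atlas g p"
    and P: "prob_space P"
    and cost: "\<And>p. integrable P (\<lambda>s. Q s p)" "\<And>p. C p = (\<integral>s. Q s p \<partial>P)"
      "smooth_manifold.Ck_fun_on atlas 3 C UNIV"
    and H_measurable: "smooth_manifold.measurable_tangent_field atlas P H"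
    and H_mean: "\<And>p. integrable P (\<lambda>s. H s p)"
      "\<And>p. (\<integral>s. H s p \<partial>P) = riemannian_manifold.gradient atlas g C p"
    and samples: "prob_space \<Omega>" "prob_space.indep_vars \<Omega> (\<lambda>t. P) z UNIV"
      "\<And>t. distr \<Omega> P (z t) = P"
    and R: "riemannian_manifold.retraction atlas g R"
      "smooth_manifold.Ck_on_tangent_bundle atlas 2 R"
    and algorithm: "\<And>\<omega>. \<omega> \<in> space \<Omega> \<Longrightarrow> w 0 \<omega> = w0"
      "\<And>t \<omega>. \<omega> \<in> space \<Omega> \<Longrightarrow> w (Suc t) \<omega> = R (w t \<omega>) (- \<gamma> t *\<^sub>R H (z t \<omega>) (w t \<omega>))"
    and steps: "\<And>t. \<gamma> t > 0" "summable (\<lambda>t. (\<gamma> t)\<^sup>2)"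
      "filterlim (\<lambda>n. \<Sum>t<n. \<gamma> t) at_top sequentially"
    and K: "compact K" "AE \<omega> in \<Omega>. \<forall>t. w t \<omega> \<in> K"
    and H_bound: "A > 0"
      "\<And>p s. p \<in> K \<Longrightarrow> s \<in> space P \<Longrightarrow> riemannian_manifold.tangent_norm g p (H s p) \<le> A"
  shows "(AE \<omega> in \<Omega>. convergent (\<lambda>t. C (w t \<omega>))) \<and>
         (AE \<omega> in \<Omega>. (\<lambda>t. riemannian_manifold.tangent_norm g (w t \<omega>)
                              (riemannian_manifold.gradient atlas g C (w t \<omega>))) \<longlonglongrightarrow> 0)"
proof -
  interpret riemannian_manifold atlas g by fact
  interpret P: prob_space P by fact
  interpret \<Omega>: prob_space \<Omega> by fact
  have C2: "Ck_fun_on 2 C UNIV" using cost(3) by (auto simp: Ck_fun_on_def intro: Ck_on_le[of 2 3])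
  then have C_Suc: "Ck_fun_on (Suc 1) C UNIV" by (simp add: numeral_2_eq_2 del: Ck_on.simps)
  have exp_dom: "\<exists>r>0. tangent_ball p r \<subseteq> exp_domain p" for p
    using injectivity(1) injectivity(2)[of p] by (intro injectivity_radius_posD) (auto intro: less_le_trans[of 0 "ereal I"])
  define G where "G q = g q (gradient C q) (gradient C q)" for q
  have bl: "bounded_linear (differential C q)" for q
    using linear_differential[OF C_Suc] by (simp add: linear_conv_bounded_linear)
  have dC_int: "integrable P (\<lambda>s. differential C q (H s q))" for q
    by (rule integrable_bounded_linear[OF bl H_mean(1)])
  \<comment> \<open>At a fixed \<open>q\<close> all \<open>H s q\<close> are encoded in the same
    chart, so \<open>H_mean\<close> is an ordinary vector integral, through which the linear
    \<open>differential C q\<close> passes.\<close>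
  have dC_mean: "(\<integral>s. differential C q (H s q) \<partial>P) = G q" for q
    unfolding integral_bounded_linear[OF bl H_mean(1)] H_mean(2) G_def by (rule gradient[OF C_Suc, symmetric])
  have dC_le: "\<bar>differential C q (H s q)\<bar> \<le> (G q + A\<^sup>2) / 2" if "q \<in> K" "s \<in> space P" for q s
  proof -
    have "\<bar>g q (gradient C q) (H s q)\<bar> \<le> (G q + g q (H s q) (H s q)) / 2"
      unfolding G_def by (rule abs_metric_le)
    also have "g q (H s q) (H s q) \<le> A\<^sup>2"
      unfolding tangent_norm_power2[symmetric] using that by (intro power_mono H_bound tangent_norm_nonneg)
    finally show ?thesis by (simp add: gradient[OF C_Suc])
  qed
  \<comment> \<open>Averaging \<open>dC_le\<close> over \<open>P\<close> gives
    \<open>G q \<le> (G q + A\<^sup>2) / 2\<close>.\<close>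
  have G_le: "G q \<le> A\<^sup>2" if "q \<in> K" for q
  proof -
    have "(\<integral>s. differential C q (H s q) \<partial>P) \<le> (\<integral>s. (G q + A\<^sup>2) / 2 \<partial>P)"
    proof (intro integral_mono dC_int)
      show "differential C q (H s q) \<le> (G q + A\<^sup>2) / 2" if "s \<in> space P" for s
        using dC_le[OF \<open>q \<in> K\<close> that] by (simp only: abs_le_iff)
    qed simp
    then show ?thesis by (simp add: dC_mean P.prob_space)
  qed
  \<comment> \<open>The indicator makes the noise bounded at every state and keeps its mean 0; on
    the almost sure event that the trajectory stays in \<open>K\<close> it equals 1.\<close>
  define y where "y = (\<lambda>(s, q). indicator K q * (differential C q (H s q) - G q))"
  have dC_meas [measurable]: "(\<lambda>(s, q). differential C q (H s q)) \<in> borel_measurable (P \<Otimes>\<^sub>M borel)"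
    by (rule differential_measurable[OF H_measurable C_Suc])
  \<comment> \<open>\<open>gradient\<close> is a definite description in jumping charts;
    measurability of \<open>G\<close> comes from \<open>dC_mean\<close>, as a parameter
    integral.\<close>
  have [measurable]: "G \<in> borel_measurable borel"
  proof -
    have "(\<lambda>(q, s). differential C q (H s q)) \<in> borel_measurable (borel \<Otimes>\<^sub>M P)"
      using measurable_compose[OF measurable_pair_swap' dC_meas] by (simp add: split_def)
    from P.borel_measurable_lebesgue_integral[OF this] show ?thesis by (simp add: dC_mean)
  qed
  have [measurable]: "K \<in> sets borel" using K(1) by (simp add: compact_imp_closed)
  have y_meas: "y \<in> borel_measurable (P \<Otimes>\<^sub>M borel)"
  proof -
    have "(\<lambda>x. indicator K (snd x) * ((\<lambda>(s, q). differential C q (H s q)) x - G (snd x))) \<in> borel_measurable (P \<Otimes>\<^sub>M borel)"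
      by measurable
    then show ?thesis by (simp add: y_def split_def)
  qed
  \<comment> \<open>On \<open>K\<close> the sum \<open>(G q + A\<^sup>2) / 2 + G q\<close> is at
    most \<open>2 * A\<^sup>2\<close> by \<open>G_le\<close>.\<close>
  have y_bound: "\<bar>y (s, q)\<bar> \<le> 2 * A\<^sup>2" if "s \<in> space P" for s q
  proof (cases "q \<in> K")
    case True
    have "0 \<le> G q" by (simp add: G_def metric_nonneg)
    then show ?thesis using dC_le[OF True that] G_le[OF True] True by (auto simp: y_def abs_le_iff field_simps)
  next
    case False
    then show ?thesis by (simp add: y_def)
  qed
  have y_mean: "(\<integral>s. y (s, q) \<partial>P) = 0" for q
    using dC_int by (simp add: y_def dC_mean P.prob_space)
  have noise: "AE \<omega> in \<Omega>. convergent (\<lambda>n. \<Sum>t<n. \<gamma> t * y (z t \<omega>, w t \<omega>))"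
  proof (rule \<Omega>.AE_convergent_markov_chain[OF P samples(2,3), where N = borel and B = "2 * A\<^sup>2"
        and \<Phi> = "\<lambda>t (s, q). R q (- \<gamma> t *\<^sub>R H s q)"])
    show "(\<lambda>(s, q). R q (- \<gamma> t *\<^sub>R H s q)) \<in> P \<Otimes>\<^sub>M borel \<rightarrow>\<^sub>M borel" for t
      by (rule retraction_step_measurable[OF H_measurable R(2)])
  qed (use algorithm y_meas y_bound y_mean steps in auto)
  have z_in: "z t \<omega> \<in> space P" if "\<omega> \<in> space \<Omega>" for t \<omega>
    using samples(2) that by (auto simp: \<Omega>.indep_vars_def dest: measurable_space)
  have "AE \<omega> in \<Omega>. convergent (\<lambda>t. C (w t \<omega>)) \<and> (\<lambda>t. tangent_norm (w t \<omega>) (gradient C (w t \<omega>))) \<longlonglongrightarrow> 0"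
    using noise K(2) AE_space
  proof eventually_elim
    case (elim \<omega>)
    have conv: "convergent (\<lambda>n. \<Sum>t<n. \<gamma> t * (differential C (w t \<omega>) (H (z t \<omega>) (w t \<omega>)) -
        g (w t \<omega>) (gradient C (w t \<omega>)) (gradient C (w t \<omega>))))"
      using elim(1,2) by (simp add: y_def G_def)
    have bound: "tangent_norm (w t \<omega>) (H (z t \<omega>) (w t \<omega>)) \<le> A" for t
      using elim(2,3) z_in by (intro H_bound) auto
    note trajectory = manifold(2) R exp_dom C2 K(1) H_bound(1) steps elim(2)[rule_format]
      algorithm(2)[OF elim(3)] bound conv
    show ?case
      using cost_converges[OF trajectory] gradient_norm_tendsto_0[OF trajectory] by blast
  qed
  then show ?thesis by (auto elim: eventually_mono)
qed

end
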